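(* Let $n\ge 2$ be even. (i) There exists $\varepsilon_n>0$ such that every set $P=\{v_1,\dots,v_{n/2},w_1,\dots,w_{n/2}\}$ that is generic and in convex position, where $v_i$ lies within distance $\varepsilon_n$ of $(i,0)$ and $w_i$ lies within distance $\varepsilon_n$ of $(i,1)$ for all $i$, satisfies $\operatorname{cr}(P)\ge \lfloor \tfrac58 (n-2)\rfloor$. (ii) For every $\varepsilon>0$ there exists such a set $P_0$ (generic, in convex position, with $v_i$ within distance $\varepsilon$ of $(i,0)$ and $w_i$ within distance $\varepsilon$ of $(i,1)$) with $\operatorname{cr}(P_0)\le \lfloor \tfrac58 (n-2)\rfloor$.
   Context: The $2\times\frac n2$ grid is the set of points $(i,0)$ and $(i,1)$ for $i=1,\dots,n/2$; a perturbation of it is obtained by moving each grid point by a sufficiently small amount. A finite planar point set is in general position if no three of its points are collinear. It is generic if it is in general position and every subset of it has a unique (Euclidean) minimum spanning tree (MST); for a generic set $X$, $T_X$ denotes the MST of $X$, drawn with straight-line edges. For disjoint point sets $R,B$ with $R\cup B$ generic, $\operatorname{cr}(R,B)$ denotes the number of crossings between the edges of $T_R$ and the edges of $T_B$. For a generic point set $P$, $\operatorname{cr}(P)=\max \operatorname{cr}(R,B)$, the maximum over all partitions $P=R\cup B$ into two disjoint sets. *)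

theory Defs
  imports "HOL-Analysis.Analysis"
begin

type_synonym pt = "real \<times> real"

text \<open>Edges are unordered pairs (2-element sets) of points; drawn as straight segments.\<close>

definition edge_len :: "pt set \<Rightarrow> real" where
  "edge_len e = Max {dist a b | a b. a \<in> e \<and> b \<in> e}"

definition tree_weight :: "pt set set \<Rightarrow> real" where
  "tree_weight E = (\<Sum>e\<in>E. edge_len e)"

definition all_pairs :: "pt set \<Rightarrow> pt set set" where
  "all_pairs X = {{a, b} | a b. a \<in> X \<and> b \<in> X \<and> a \<noteq> b}"

definition adj :: "pt set set \<Rightarrow> (pt \<times> pt) set" where
  "adj E = {(a, b). {a, b} \<in> E \<and> a \<noteq> b}"

text \<open>A spanning tree of the complete geometric graph on X: connected with |X|-1 edges.\<close>
definition spanning_tree :: "pt set \<Rightarrow> pt set set \<Rightarrow> bool" where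
  "spanning_tree X E \<longleftrightarrow> E \<subseteq> all_pairs X \<and>
     (\<forall>a\<in>X. \<forall>b\<in>X. (a, b) \<in> (adj E)\<^sup>*) \<and> card E = card X - 1"

definition is_mst :: "pt set \<Rightarrow> pt set set \<Rightarrow> bool" where
  "is_mst X E \<longleftrightarrow> spanning_tree X E \<and>
     (\<forall>E'. spanning_tree X E' \<longrightarrow> tree_weight E \<le> tree_weight E')"

definition general_position :: "pt set \<Rightarrow> bool" where
  "general_position P \<longleftrightarrow> (\<forall>a\<in>P. \<forall>b\<in>P. \<forall>c\<in>P.
     a \<noteq> b \<and> a \<noteq> c \<and> b \<noteq> c \<longrightarrow> \<not> collinear {a, b, c})"

definition generic :: "pt set \<Rightarrow> bool" where
  "generic P \<longleftrightarrow> finite P \<and> general_position P \<and> (\<forall>X\<subseteq>P. \<exists>!E. is_mst X E)"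

definition MST :: "pt set \<Rightarrow> pt set set" where
  "MST X = (THE E. is_mst X E)"

definition convex_position :: "pt set \<Rightarrow> bool" where
  "convex_position P \<longleftrightarrow> (\<forall>p\<in>P. p \<notin> convex hull (P - {p}))"

text \<open>Number of crossings between edges of T_R and edges of T_B.\<close>
definition cr_pair :: "pt set \<Rightarrow> pt set \<Rightarrow> nat" where
  "cr_pair R B = card {(e, f). e \<in> MST R \<and> f \<in> MST B \<and>
      convex hull e \<inter> convex hull f \<noteq> {}}"

definition cr :: "pt set \<Rightarrow> nat" where
  "cr P = Max {cr_pair R (P - R) | R. R \<subseteq> P}"

end

theory Submission
  imports Defs
begin

text \<open>
Lower bound. Colour columns s, ..., s + 4 as follows: s and s + 4 are bichromatic with red in row r and
blue in the other row, s + 1 and s + 3 are entirely blue, s + 2 is entirely red. The red tree contains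
two chords of length 2 in row r and the vertical in column s + 2, the blue tree contains two verticals and a chord from
column s + 1 to column s + 3 which runs in its shorter row. If r is that row, convexity makes the three
chords cross consecutively, which gives 5 crossings on 4 gaps, independently of how the perturbation
breaks ties. Consecutive blocks share a bichromatic column, which is a cut vertex for both trees, so
their crossings add up; the remaining gaps get one crossing of diagonals each.

Upper bound. Perturb so that verticals are slightly longer than unit horizontals and so that, of two
tied chords starting in column a, the shorter one lies in the top row exactly for even a. Then a
monochromatic run of columns contains a single vertical, edges join consecutive columns of a colour,
and the only crossings are those of two diagonals of a unit square, of a chord with the vertical of the
run that it spans, and of two consecutive chords in the same row. By the tie rule two consecutive chords
between monochromatic columns cross only if the run between them has length at least 2. Hence crossings can be
charged to distinct gaps, with one extra crossing for each stretch of at least 4 gaps between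
bichromatic columns.
\<close>

section \<open>Minimum spanning trees\<close>

text \<open>With n = 2m there are m - 1 gaps between columns, and the bound equals (m - 1) + (m - 1)
  div 4. The obstacle is that in the exact grid unit horizontals tie with verticals, and parallel
  chords of the two rows tie with each other, so an arbitrary perturbation leaves the trees partly
  unknown. The colouring of the lower bound is therefore chosen after the perturbation: the edges it
  needs are forced by length gaps of the exact grid, except for one chord per block, and the block
  is coloured according to the row in which this chord is shorter. The trees are never computed as a
  whole. Edges that must be present come from the cut property. Edges that must be absent come from
  the cycle property, in the form that a tree edge cannot be bypassed by a walk with shorter steps.
  The point set of the upper bound arises in two stages: an explicit deformation settles the
  relevant ties by strict inequalities, and a generic perturbation, small enough to preserve them,
  then makes all distances distinct.\<close>

lemma edge_len_pair [simp]: "edge_len {a, b} = dist a b"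
proof -
  have "{dist x y | x y. x \<in> {a, b} \<and> y \<in> {a, b}} = {0, dist a b}"
    unfolding set_eq_iff mem_Collect_eq insert_iff
    by (metis dist_commute dist_self empty_iff)
  then show ?thesis
    unfolding edge_len_def by simp
qed

lemma finite_all_pairs: "finite X \<Longrightarrow> finite (all_pairs X)"
  by (rule finite_subset[of _ "Pow X"]) (auto simp: all_pairs_def)

lemma all_pairsI: "a \<in> X \<Longrightarrow> b \<in> X \<Longrightarrow> a \<noteq> b \<Longrightarrow> {a, b} \<in> all_pairs X"
  unfolding all_pairs_def by blast

lemma all_pairsD: "{a, b} \<in> all_pairs X \<Longrightarrow> a \<in> X \<and> b \<in> X \<and> a \<noteq> b"
  unfolding all_pairs_def mem_Collect_eq doubleton_eq_iff by blast

lemma finite_spanning_tree: "finite X \<Longrightarrow> spanning_tree X E \<Longrightarrow> finite E"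
  by (meson finite_all_pairs finite_subset spanning_tree_def)

lemma conn_sym: "(a, b) \<in> (adj E)\<^sup>* \<Longrightarrow> (b, a) \<in> (adj E)\<^sup>*"
proof -
  have "sym (adj E)"
    by (auto simp: sym_def adj_def insert_commute)
  then show "(a, b) \<in> (adj E)\<^sup>* \<Longrightarrow> (b, a) \<in> (adj E)\<^sup>*"
    by (meson sym_rtrancl symD)
qed

lemma conn_mono: "(a, b) \<in> (adj E)\<^sup>* \<Longrightarrow> E \<subseteq> F \<Longrightarrow> (a, b) \<in> (adj F)\<^sup>*"
proof -
  assume "(a, b) \<in> (adj E)\<^sup>*" "E \<subseteq> F"
  moreover have "adj E \<subseteq> adj F" if "E \<subseteq> F"
    using that by (auto simp: adj_def)
  ultimately show ?thesis
    using rtrancl_mono by blast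
qed

lemma conn_edge: "{a, b} \<in> E \<Longrightarrow> (a, b) \<in> (adj E)\<^sup>*"
  by (cases "a = b") (auto simp: adj_def)

text \<open>Graph distance from \<open>a\<close>. It provides neighbours one step closer to
  \<open>a\<close>, and it tells the vertices of a shortest path apart.\<close>

definition level :: "pt set set \<Rightarrow> pt \<Rightarrow> pt \<Rightarrow> nat" where
  "level E a x = (LEAST k. (a, x) \<in> adj E ^^ k)"

lemma level_le: "(a, x) \<in> adj E ^^ k \<Longrightarrow> level E a x \<le> k"
  unfolding level_def by (rule Least_le)

lemma level_path: "(a, x) \<in> (adj E)\<^sup>* \<Longrightarrow> (a, x) \<in> adj E ^^ level E a x"
  unfolding level_def by (rule LeastI_ex) (meson rtrancl_imp_relpow)

text \<open>Every vertex other than a root owns an edge to a neighbour of smaller level. Distinct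
  vertices own distinct edges, since a shared edge would make each of its ends the parent of the
  other.\<close>

lemma connected_card:
  assumes fin: "finite X" and E: "E \<subseteq> all_pairs X"
    and conn: "\<And>a b. a \<in> X \<Longrightarrow> b \<in> X \<Longrightarrow> (a, b) \<in> (adj E)\<^sup>*"
  shows "card X - 1 \<le> card E"
proof (cases "X = {}")
  case False
  then obtain a where a: "a \<in> X" by blast
  have "\<exists>y. {y, x} \<in> E \<and> level E a y < level E a x" if x: "x \<in> X - {a}" for x
  proof -
    have *: "(a, x) \<in> adj E ^^ level E a x"
      using conn a x level_path by blast
    then have "level E a x \<noteq> 0"
      using x by (metis DiffD2 insertI1 relpow_0_E)
    then obtain k where k: "level E a x = Suc k"
      using not0_implies_Suc by blast
    with * obtain y where "(a, y) \<in> adj E ^^ k" "(y, x) \<in> adj E"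
      by auto
    then have "{y, x} \<in> E \<and> level E a y < level E a x"
      using level_le[of a y k E] k by (auto simp: adj_def)
    then show ?thesis
      by blast
  qed
  then obtain par where par: "\<And>x. x \<in> X - {a} \<Longrightarrow> {par x, x} \<in> E \<and> level E a (par x) < level E a x"
    by metis
  have "inj_on (\<lambda>x. {par x, x}) (X - {a})"
    by (rule inj_onI) (metis doubleton_eq_iff less_asym par)
  moreover have "(\<lambda>x. {par x, x}) ` (X - {a}) \<subseteq> E"
    using par by blast
  moreover have "finite E"
    using E fin finite_all_pairs finite_subset by blast
  ultimately have "card (X - {a}) \<le> card E"
    using card_inj_on_le by blast
  then show ?thesis
    using a by simp
qed auto

text \<open>After its last use of \<open>{a, b}\<close>, a path from \<open>a\<close> to
  \<open>x\<close> continues from \<open>a\<close> or from \<open>b\<close>.\<close>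

lemma conn_remove_edge:
  assumes "(a, x) \<in> (adj E)\<^sup>*"
  shows "(a, x) \<in> (adj (E - {{a, b}}))\<^sup>* \<or> (b, x) \<in> (adj (E - {{a, b}}))\<^sup>*"
  using assms
proof (induction rule: rtrancl_induct)
  case (step y z)
  show ?case
  proof (cases "{y, z} = {a, b}")
    case True
    then show ?thesis
      by (auto simp: doubleton_eq_iff)
  next
    case False
    then have "(y, z) \<in> adj (E - {{a, b}})"
      using step.hyps(2) by (auto simp: adj_def)
    then show ?thesis
      using step.IH by (meson rtrancl.rtrancl_into_rtrancl)
  qed
qed auto

text \<open>Otherwise \<open>E - {{a, b}}\<close> would still connect \<open>X\<close> with fewer
  than \<open>card X - 1\<close> edges, against \<open>connected_card\<close>.\<close>

lemma spanning_tree_bridge: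
  assumes fin: "finite X" and st: "spanning_tree X E" and e: "{a, b} \<in> E"
  shows "(a, b) \<notin> (adj (E - {{a, b}}))\<^sup>*"
proof
  assume ab: "(a, b) \<in> (adj (E - {{a, b}}))\<^sup>*"
  have abX: "a \<in> X" "b \<in> X" "a \<noteq> b"
    using e st all_pairsD unfolding spanning_tree_def by blast+
  have from_a: "(a, x) \<in> (adj (E - {{a, b}}))\<^sup>*" if "x \<in> X" for x
  proof -
    have "(a, x) \<in> (adj E)\<^sup>*"
      using st that abX by (auto simp: spanning_tree_def)
    then show ?thesis
      using conn_remove_edge[of a x E b] ab by (auto intro: rtrancl_trans)
  qed
  have "card X - 1 \<le> card (E - {{a, b}})"
  proof (rule connected_card[OF fin])
    show "E - {{a, b}} \<subseteq> all_pairs X"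
      using st by (auto simp: spanning_tree_def)
  next
    fix x y assume "x \<in> X" "y \<in> X"
    then show "(x, y) \<in> (adj (E - {{a, b}}))\<^sup>*"
      by (meson conn_sym from_a rtrancl_trans)
  qed
  moreover have "card (E - {{a, b}}) < card E"
    using e finite_spanning_tree[OF fin st] by (meson card_Diff1_less)
  ultimately show False
    using st by (simp add: spanning_tree_def)
qed

text \<open>Without \<open>{c, d}\<close> the tree splits into the component of \<open>c\<close>,
  which contains \<open>a\<close>, and that of \<open>d\<close>, which contains \<open>b\<close>.
  The new edge reconnects them and the number of edges is kept.\<close>

lemma spanning_tree_swap:
  assumes fin: "finite X" and st: "spanning_tree X E" and e: "{c, d} \<in> E"
    and new: "{a, b} \<in> all_pairs X" "{a, b} \<notin> E - {{c, d}}"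
    and ca: "(c, a) \<in> (adj (E - {{c, d}}))\<^sup>*" and db: "(d, b) \<in> (adj (E - {{c, d}}))\<^sup>*"
  shows "spanning_tree X (insert {a, b} (E - {{c, d}}))"
    and "tree_weight (insert {a, b} (E - {{c, d}})) = tree_weight E - dist c d + dist a b"
proof -
  let ?F = "insert {a, b} (E - {{c, d}})"
  have finE: "finite E"
    using fin st finite_spanning_tree by blast
  have cX: "c \<in> X" 
    using e st all_pairsD unfolding spanning_tree_def by blast+
  have sub: "(x, y) \<in> (adj ?F)\<^sup>*" if "(x, y) \<in> (adj (E - {{c, d}}))\<^sup>*" for x y
    using that by (rule conn_mono) auto
  have "(a, b) \<in> (adj ?F)\<^sup>*"
    by (rule conn_edge) simp
  then have cd: "(c, d) \<in> (adj ?F)\<^sup>*"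
    using sub[OF ca] sub[OF db] conn_sym by (meson rtrancl_trans)
  have from_c: "(c, x) \<in> (adj ?F)\<^sup>*" if "x \<in> X" for x
  proof -
    have "(c, x) \<in> (adj E)\<^sup>*"
      using st that cX by (auto simp: spanning_tree_def)
    then show ?thesis
      using conn_remove_edge[of c x E d] cd sub by (meson rtrancl_trans)
  qed
  have "card E > 0"
    using e finE card_gt_0_iff by blast
  then have "card ?F = card E"
    using e new(2) finE by (simp add: card_Diff_singleton)
  moreover have "(x, y) \<in> (adj ?F)\<^sup>*" if "x \<in> X" "y \<in> X" for x y
    using rtrancl_trans[OF conn_sym[OF from_c[OF that(1)]] from_c[OF that(2)]] .
  moreover have "?F \<subseteq> all_pairs X"
    using st new(1) unfolding spanning_tree_def by blast
  ultimately show "spanning_tree X ?F"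
    using st unfolding spanning_tree_def by simp
  show "tree_weight ?F = tree_weight E - dist c d + dist a b"
    unfolding tree_weight_def using e new(2) finE
    by (simp add: sum_diff1)
qed

text \<open>The cycle property. The steps of the walk are arbitrary pairs of \<open>X\<close>, not
  edges of \<open>E\<close>: one of them leaves the component of \<open>a\<close> in
  \<open>E - {{a, b}}\<close>, and exchanging \<open>{a, b}\<close> for this shorter pair would
  reduce the weight.\<close>

lemma mst_no_bypass:
  assumes fin: "finite X" and mst: "is_mst X E"
    and path: "(a, b) \<in> {(x, y). x \<in> X \<and> y \<in> X \<and> dist x y < dist a b}\<^sup>*"
  shows "{a, b} \<notin> E"
proof
  assume e: "{a, b} \<in> E"
  let ?E = "E - {{a, b}}"
  have st: "spanning_tree X E"
    using mst by (simp add: is_mst_def)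
  have nb: "(a, b) \<notin> (adj ?E)\<^sup>*"
    using spanning_tree_bridge[OF fin st e] .
  have aX: "a \<in> X"
    using e st all_pairsD unfolding spanning_tree_def by blast+
  have "\<exists>c d. c \<in> X \<and> d \<in> X \<and> dist c d < dist a b \<and> (a, c) \<in> (adj ?E)\<^sup>* \<and> (a, d) \<notin> (adj ?E)\<^sup>*"
  proof -
    have "(a, x) \<in> (adj ?E)\<^sup>* \<or> (\<exists>c d. c \<in> X \<and> d \<in> X \<and> dist c d < dist a b \<and> (a, c) \<in> (adj ?E)\<^sup>* \<and> (a, d) \<notin> (adj ?E)\<^sup>*)"
      if "(a, x) \<in> {(x, y). x \<in> X \<and> y \<in> X \<and> dist x y < dist a b}\<^sup>*" for x
      using that by (induction rule: rtrancl_induct) blast+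
    then show ?thesis
      using path nb by blast
  qed
  then obtain c d where cd: "c \<in> X" "d \<in> X" "dist c d < dist a b"
      "(a, c) \<in> (adj ?E)\<^sup>*" "(a, d) \<notin> (adj ?E)\<^sup>*"
    by blast
  have "(a, d) \<in> (adj E)\<^sup>*"
    using st aX cd(2) by (auto simp: spanning_tree_def)
  then have bd: "(b, d) \<in> (adj ?E)\<^sup>*"
    using conn_remove_edge[of a d E b] cd(5) by auto
  have new: "{c, d} \<notin> ?E"
    using cd(4,5) conn_edge[of c d ?E] by (meson rtrancl_trans)
  have "{c, d} \<in> all_pairs X"
    using cd by (intro all_pairsI) auto
  from spanning_tree_swap[OF fin st e this new cd(4) bd] cd(3) mst
  show False
    unfolding is_mst_def by fastforce
qed

text \<open>The tree path from \<open>a\<close> to \<open>b\<close> leaves \<open>S\<close>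
  somewhere, and an edge where it does so can be exchanged for \<open>{a, b}\<close>. A shortest
  path is taken so that removing this edge leaves the rest of the path intact.\<close>

lemma spanning_tree_exchange:
  assumes fin: "finite X" and st: "spanning_tree X E"
    and a: "a \<in> X" "a \<in> S" and b: "b \<in> X" "b \<notin> S" and new: "{a, b} \<notin> E"
  shows "\<exists>c d. c \<in> X \<and> d \<in> X \<and> c \<in> S \<and> d \<notin> S \<and> {c, d} \<in> E
    \<and> spanning_tree X (insert {a, b} (E - {{c, d}}))
    \<and> tree_weight (insert {a, b} (E - {{c, d}})) = tree_weight E - dist c d + dist a b"
proof -
  let ?l = "level E a"
  have "(a, b) \<in> (adj E)\<^sup>*"
    using st a b by (auto simp: spanning_tree_def)
  then have "(a, b) \<in> adj E ^^ ?l b"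
    by (rule level_path)
  then obtain f where f: "f 0 = a" "f (?l b) = b" "\<And>i. i < ?l b \<Longrightarrow> (f i, f (Suc i)) \<in> adj E"
    unfolding relpow_fun_conv by blast
  have seg: "j \<le> k \<Longrightarrow> k \<le> ?l b \<Longrightarrow> (\<And>i. j \<le> i \<Longrightarrow> i < k \<Longrightarrow> (f i, f (Suc i)) \<in> R) \<Longrightarrow> (f j, f k) \<in> R ^^ (k - j)"
    for j k and R :: "(pt \<times> pt) set"
  proof -
    assume "j \<le> k" "k \<le> ?l b" and *: "\<And>i. j \<le> i \<Longrightarrow> i < k \<Longrightarrow> (f i, f (Suc i)) \<in> R"
    then show "(f j, f k) \<in> R ^^ (k - j)"
      unfolding relpow_fun_conv by (intro exI[of _ "\<lambda>i. f (j + i)"]) auto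
  qed
  \<comment> \<open>The k-th vertex of a shortest path has level k, so edges at different places of
    the path are different.\<close>
  have lev: "?l (f k) = k" if "k \<le> ?l b" for k
  proof -
    have "(f 0, f k) \<in> adj E ^^ k"
      using seg[of 0 k "adj E"] that f(3) by auto
    then have 1: "?l (f k) \<le> k"
      using f(1) level_le by auto
    have ak: "(a, f k) \<in> adj E ^^ ?l (f k)"
      using \<open>(f 0, f k) \<in> adj E ^^ k\<close> f(1) by (metis level_path relpow_imp_rtrancl)
    have "(f k, b) \<in> adj E ^^ (?l b - k)"
      using seg[of k "?l b" "adj E"] that f by auto
    with ak have "(a, b) \<in> adj E ^^ (?l (f k) + (?l b - k))"
      by (auto simp: relpow_add)
    then have "?l b \<le> ?l (f k) + (?l b - k)"
      by (rule level_le)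
    with 1 that show ?thesis by simp
  qed
  have "\<exists>i < ?l b. f i \<in> S \<and> f (Suc i) \<notin> S"
  proof (rule ccontr)
    assume neg: "\<not> ?thesis"
    have "k \<le> ?l b \<Longrightarrow> f k \<in> S" for k
      using neg f(1) a(2) by (induction k) auto
    from this[of "?l b"] show False
      using f(2) b(2) by auto
  qed
  then obtain i where i: "i < ?l b" "f i \<in> S" "f (Suc i) \<notin> S"
    by blast
  let ?c = "f i" and ?d = "f (Suc i)"
  have e: "{?c, ?d} \<in> E"
    using f(3)[OF i(1)] by (simp add: adj_def)
  have other: "(f j, f (Suc j)) \<in> adj (E - {{?c, ?d}})" if "j < ?l b" "j \<noteq> i" for j
  proof -
    have "{f j, f (Suc j)} \<noteq> {?c, ?d}"
    proof
      assume "{f j, f (Suc j)} = {?c, ?d}"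
      then have "?l (f j) = ?l ?c \<or> ?l (f j) = ?l ?d \<and> ?l (f (Suc j)) = ?l ?c"
        by (auto simp: doubleton_eq_iff)
      then show False
        using lev[of j] lev[of "Suc j"] lev[of i] lev[of "Suc i"] that i(1) by auto
    qed
    then show ?thesis
      using f(3)[OF that(1)] by (simp add: adj_def)
  qed
  have "(f 0, ?c) \<in> adj (E - {{?c, ?d}}) ^^ (i - 0)"
    by (rule seg) (use i(1) other in auto)
  then have ca: "(?c, a) \<in> (adj (E - {{?c, ?d}}))\<^sup>*"
    using f(1) by (auto intro: conn_sym relpow_imp_rtrancl)
  have "(?d, f (?l b)) \<in> adj (E - {{?c, ?d}}) ^^ (?l b - Suc i)"
    by (rule seg) (use i(1) other in auto)
  then have db: "(?d, b) \<in> (adj (E - {{?c, ?d}}))\<^sup>*"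
    using f(2) by (auto intro: relpow_imp_rtrancl)
  have "{a, b} \<in> all_pairs X"
    using a b by (intro all_pairsI) auto
  moreover have "{?c, ?d} \<in> all_pairs X"
    using e st by (auto simp: spanning_tree_def)
  moreover have "{a, b} \<notin> E - {{?c, ?d}}"
    using new by blast
  ultimately show ?thesis
    using spanning_tree_swap[OF fin st e _ _ ca db] i(2,3) e all_pairsD by blast
qed

text \<open>The cut property. Ties are allowed in \<open>min\<close>: if \<open>{a, b}\<close> were
  absent, an exchange would produce a second tree of at most the same weight, which
  \<open>uniq\<close> excludes.\<close>

lemma mst_cut_edge:
  assumes fin: "finite X" and mst: "is_mst X E" and uniq: "\<And>F. is_mst X F \<Longrightarrow> F = E"
    and a: "a \<in> X" "a \<in> S" and b: "b \<in> X" "b \<notin> S"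
    and min: "\<And>c d. c \<in> X \<Longrightarrow> d \<in> X \<Longrightarrow> c \<in> S \<Longrightarrow> d \<notin> S \<Longrightarrow> dist a b \<le> dist c d"
  shows "{a, b} \<in> E"
proof (rule ccontr)
  assume new: "{a, b} \<notin> E"
  have st: "spanning_tree X E"
    using mst by (simp add: is_mst_def)
  obtain c d where cd: "c \<in> X" "d \<in> X" "c \<in> S" "d \<notin> S"
      and F: "spanning_tree X (insert {a, b} (E - {{c, d}}))"
      "tree_weight (insert {a, b} (E - {{c, d}})) = tree_weight E - dist c d + dist a b"
    using spanning_tree_exchange[OF fin st a b new] by blast
  have "is_mst X (insert {a, b} (E - {{c, d}}))"
    using F min[OF cd] mst unfolding is_mst_def by fastforce
  then show False
    using uniq new by blast
qed

section \<open>Existence and uniqueness of minimum spanning trees\<close>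

lemma spanning_tree_exists:
  assumes fin: "finite X"
  shows "\<exists>E. spanning_tree X E"
proof (cases "X = {}")
  case True
  then show ?thesis
    by (auto simp: spanning_tree_def)
next
  case False
  then obtain a where a: "a \<in> X" by blast
  let ?E = "(\<lambda>x. {a, x}) ` (X - {a})"
  have "inj_on (\<lambda>x. {a, x}) (X - {a})"
    by (auto simp: inj_on_def doubleton_eq_iff)
  then have card: "card ?E = card X - 1"
    using a fin by (simp add: card_image)
  have "(a, x) \<in> (adj ?E)\<^sup>*" if "x \<in> X" for x
    using that conn_edge[of a x ?E] by (cases "x = a") auto
  then have "\<forall>x\<in>X. \<forall>y\<in>X. (x, y) \<in> (adj ?E)\<^sup>*"
    by (meson conn_sym rtrancl_trans)
  moreover have "?E \<subseteq> all_pairs X"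
    using a all_pairsI[of a X] by blast
  ultimately show ?thesis
    using card unfolding spanning_tree_def by blast
qed

lemma mst_exists:
  assumes fin: "finite X"
  shows "\<exists>E. is_mst X E"
proof -
  let ?T = "{E. spanning_tree X E}"
  have "finite ?T"
    by (rule finite_subset[of _ "Pow (all_pairs X)"])
       (auto simp: spanning_tree_def finite_all_pairs fin)
  moreover have "?T \<noteq> {}"
    using spanning_tree_exists[OF fin] by blast
  ultimately obtain E where "E \<in> ?T" "\<forall>F\<in>?T. tree_weight E \<le> tree_weight F"
    using ex_min_if_finite[of "tree_weight ` ?T"] by (auto simp: not_less)
  then show ?thesis
    by (auto simp: is_mst_def)
qed

text \<open>Deleting \<open>e\<close> cuts \<open>E\<close> in two, and \<open>F\<close> has an
  exchangeable edge across this cut. That edge is not in \<open>E\<close>, so it is at least as long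
  as \<open>e\<close>, and even longer because lengths are distinct. Exchanging it for
  \<open>e\<close> improves \<open>F\<close>.\<close>

lemma mst_le_imp_subset:
  assumes fin: "finite X" and mst: "is_mst X E" "is_mst X F"
    and inj: "inj_on edge_len (all_pairs X)"
    and e: "e \<in> E - F" and min: "\<And>f. f \<in> F - E \<Longrightarrow> edge_len e \<le> edge_len f"
  shows False
proof -
  have st: "spanning_tree X E" "spanning_tree X F"
    using mst by (auto simp: is_mst_def)
  have eX: "e \<in> all_pairs X"
    using st(1) e by (auto simp: spanning_tree_def)
  then obtain a b where ab: "e = {a, b}" "a \<in> X" "b \<in> X"
    unfolding all_pairs_def by blast
  let ?S = "{x. (a, x) \<in> (adj (E - {{a, b}}))\<^sup>*}"
  have "b \<notin> ?S"
    using spanning_tree_bridge[OF fin st(1)] e ab(1) by auto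
  then obtain c d where cd: "c \<in> X" "d \<in> X" "c \<in> ?S" "d \<notin> ?S" "{c, d} \<in> F"
      and F: "spanning_tree X (insert {a, b} (F - {{c, d}}))"
      "tree_weight (insert {a, b} (F - {{c, d}})) = tree_weight F - dist c d + dist a b"
    using spanning_tree_exchange[OF fin st(2), of a ?S b] e ab by blast
  have "{c, d} \<notin> E"
  proof
    assume "{c, d} \<in> E"
    then have "{c, d} \<in> E - {{a, b}}"
      using e ab(1) cd(5) by auto
    then have "(c, d) \<in> (adj (E - {{a, b}}))\<^sup>*"
      by (rule conn_edge)
    then show False
      using cd(3,4) by (auto intro: rtrancl_trans)
  qed
  then have "edge_len e \<le> edge_len {c, d}"
    using min cd(5) by blast
  moreover have "edge_len e \<noteq> edge_len {c, d}"
  proof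
    assume eq: "edge_len e = edge_len {c, d}"
    have "{c, d} \<in> all_pairs X"
      using cd(5) st(2) unfolding spanning_tree_def by blast
    then have "e = {c, d}"
      by (rule inj_onD[OF inj eq eX])
    then show False
      using e cd(5) by auto
  qed
  ultimately have "dist a b < dist c d"
    using ab(1) by simp
  then show False
    using F mst(2) unfolding is_mst_def by fastforce
qed

lemma unique_mst:
  assumes fin: "finite X" and inj: "inj_on edge_len (all_pairs X)"
  shows "\<exists>!E. is_mst X E"
proof (rule ex_ex1I)
  show "\<exists>E. is_mst X E"
    by (rule mst_exists[OF fin])
next
  fix E F assume mst: "is_mst X E" "is_mst X F"
  show "E = F"
  proof (rule ccontr)
    assume "E \<noteq> F"
    let ?D = "(E - F) \<union> (F - E)"
    have "finite ?D" "?D \<noteq> {}"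
      using mst finite_spanning_tree[OF fin] \<open>E \<noteq> F\<close> by (auto simp: is_mst_def)
    then obtain e where e: "e \<in> ?D" "\<forall>f\<in>?D. edge_len e \<le> edge_len f"
      using ex_min_if_finite[of "edge_len ` ?D"] by (auto simp: not_less)
    then show False
      using mst_le_imp_subset[OF fin mst inj, of e] mst_le_imp_subset[OF fin mst(2,1) inj, of e]
      by blast
  qed
qed

section \<open>Trees of subsets of a generic set\<close>

lemma is_mst_MST:
  assumes "generic P" and "X \<subseteq> P"
  shows "is_mst X (MST X)" and "is_mst X F \<Longrightarrow> F = MST X"
proof -
  have ex1: "\<exists>!E. is_mst X E"
    using assms by (auto simp: generic_def)
  show "is_mst X (MST X)"
    unfolding MST_def by (rule theI'[OF ex1])
  show "is_mst X F \<Longrightarrow> F = MST X"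
    unfolding MST_def using the1_equality[OF ex1] by metis
qed

lemma MST_subset: "generic P \<Longrightarrow> X \<subseteq> P \<Longrightarrow> MST X \<subseteq> all_pairs X"
  using is_mst_MST(1) by (auto simp: is_mst_def spanning_tree_def)

lemma finite_MST: "generic P \<Longrightarrow> X \<subseteq> P \<Longrightarrow> finite (MST X)"
  by (meson MST_subset finite_all_pairs finite_subset generic_def)

lemma MST_no_bypass:
  assumes "generic P" "X \<subseteq> P"
    and "(a, b) \<in> {(x, y). x \<in> X \<and> y \<in> X \<and> dist x y < dist a b}\<^sup>*"
  shows "{a, b} \<notin> MST X"
proof -
  have "finite X"
    using assms(1,2) finite_subset by (auto simp: generic_def)
  then show ?thesis
    using mst_no_bypass[OF _ is_mst_MST(1)[OF assms(1,2)] assms(3)] by blast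
qed

lemma MST_cut_edge:
  assumes "generic P" "X \<subseteq> P" "a \<in> X" "a \<in> S" "b \<in> X" "b \<notin> S"
    and "\<And>c d. c \<in> X \<Longrightarrow> d \<in> X \<Longrightarrow> c \<in> S \<Longrightarrow> d \<notin> S \<Longrightarrow> dist a b \<le> dist c d"
  shows "{a, b} \<in> MST X"
proof -
  have "finite X"
    using assms(1,2) finite_subset by (auto simp: generic_def)
  then show ?thesis
    using mst_cut_edge[OF _ is_mst_MST[OF assms(1,2)] assms(3-6)] assms(7) by blast
qed

lemma finite_crossings:
  assumes "generic P" "R \<subseteq> P" "B \<subseteq> P"
  shows "finite {(e, f). e \<in> MST R \<and> f \<in> MST B \<and> convex hull e \<inter> convex hull f \<noteq> {}}"
  by (rule finite_subset[of _ "MST R \<times> MST B"]) (use assms in \<open>auto intro: finite_MST\<close>)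

section \<open>Orientation and crossing segments\<close>

text \<open>Twice the signed area of the triangle \<open>a b c\<close>, positive for a
  counterclockwise triple.\<close>

definition orient :: "pt \<Rightarrow> pt \<Rightarrow> pt \<Rightarrow> real" where
  "orient a b c = (fst b - fst a) * (snd c - snd a) - (snd b - snd a) * (fst c - fst a)"

lemma orient_rotate: "orient b c a = orient a b c"
  by (simp add: orient_def algebra_simps)

lemma orient_swap: "orient b a c = - orient a b c"
  by (simp add: orient_def algebra_simps)

lemma orient_swap2: "orient a c b = - orient a b c"
  by (simp add: orient_def algebra_simps)

lemma orient_affine: "orient a b ((1 - t) *\<^sub>R c + t *\<^sub>R d) = (1 - t) * orient a b c + t * orient a b d"
  by (simp add: orient_def algebra_simps)

lemma orient_self [simp]: "orient a b a = 0" "orient a b b = 0"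
  by (simp_all add: orient_def)

lemma convex_orient_pos: "convex {q. \<sigma> * orient a b q > 0}"
proof (rule convexI)
  fix x y and u v :: real
  assume xy: "x \<in> {q. \<sigma> * orient a b q > 0}" "y \<in> {q. \<sigma> * orient a b q > 0}"
    and uv: "0 \<le> u" "0 \<le> v" "u + v = 1"
  have u: "u = 1 - v"
    using uv(3) by simp
  have "\<sigma> * orient a b (u *\<^sub>R x + v *\<^sub>R y) = u * (\<sigma> * orient a b x) + v * (\<sigma> * orient a b y)"
    unfolding u orient_affine by (simp only: distrib_left mult.left_commute)
  moreover have "u * (\<sigma> * orient a b x) + v * (\<sigma> * orient a b y) > 0"
  proof (cases "v = 0")
    case False
    then have "v * (\<sigma> * orient a b y) > 0" "u * (\<sigma> * orient a b x) \<ge> 0"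
      using xy uv by auto
    then show ?thesis by simp
  qed (use xy u in auto)
  ultimately show "u *\<^sub>R x + v *\<^sub>R y \<in> {q. \<sigma> * orient a b q > 0}"
    by simp
qed

lemma convex_orient_nonneg: "convex {q. orient a b q \<ge> 0}"
proof (rule convexI)
  fix x y and u v :: real
  assume xy: "x \<in> {q. orient a b q \<ge> 0}" "y \<in> {q. orient a b q \<ge> 0}"
    and uv: "0 \<le> u" "0 \<le> v" "u + v = 1"
  have u: "u = 1 - v"
    using uv(3) by simp
  have "orient a b (u *\<^sub>R x + v *\<^sub>R y) = u * orient a b x + v * orient a b y"
    unfolding u by (rule orient_affine)
  then show "u *\<^sub>R x + v *\<^sub>R y \<in> {q. orient a b q \<ge> 0}"
    using xy uv by simp
qed

lemma segments_disjoint: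
  assumes "\<sigma> * orient a b c > 0" "\<sigma> * orient a b d > 0"
  shows "convex hull {a, b} \<inter> convex hull {c, d} = {}"
proof -
  have "convex hull {c, d} \<subseteq> {q. \<sigma> * orient a b q > 0}"
    using assms by (intro hull_minimal convex_orient_pos) auto
  moreover have "orient a b q = 0" if "q \<in> convex hull {a, b}" for q
    using that unfolding segment_convex_hull[symmetric] in_segment by (auto simp: orient_affine)
  ultimately show ?thesis
    by fastforce
qed

lemma segments_cross:
  assumes ab: "orient a b c * orient a b d < 0" and cd: "orient c d a * orient c d b < 0"
  shows "convex hull {a, b} \<inter> convex hull {c, d} \<noteq> {}"
proof -
  \<comment> \<open>The function \<open>orient c d\<close> is affine along the first segment, and
    \<open>t\<close> is the parameter of its zero; \<open>s\<close> is the analogous parameter on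
    the second segment. The two denominators are opposite, so multiplying by \<open>?D\<close> turns
    the equality of the two points into polynomial identities.\<close>
  define t where "t = orient c d a / (orient c d a - orient c d b)"
  define s where "s = orient a b c / (orient a b c - orient a b d)"
  have frac: "0 \<le> x / (x - y) \<and> x / (x - y) \<le> 1" if "x * y < 0" for x y :: real
    using that by (cases "x > 0") (auto simp: mult_less_0_iff divide_simps)
  have ts: "0 \<le> t" "t \<le> 1" "0 \<le> s" "s \<le> 1"
    using frac[OF ab] frac[OF cd] by (auto simp: t_def s_def)
  have den: "orient c d a - orient c d b = - (orient a b c - orient a b d)"
    by (simp add: orient_def algebra_simps)
  let ?D = "orient a b c - orient a b d"
  have D: "?D \<noteq> 0"
    using ab by (auto simp: mult_less_0_iff)
  have t: "t * ?D = - orient c d a"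
    unfolding t_def den using D by (simp add: divide_simps algebra_simps)
  have s: "s * ?D = orient a b c"
    unfolding s_def using D by simp
  have lin: "D * x + y * (z - x) = D * ((1 - u) * x + u * z)" if "u * D = y" for D x y z u :: real
    unfolding that[symmetric] by (simp add: algebra_simps)
  have eq: "((1 - t) *\<^sub>R a + t *\<^sub>R b) = ((1 - s) *\<^sub>R c + s *\<^sub>R d)"
  proof (rule prod_eqI)
    have "?D * ((1 - t) * fst a + t * fst b) = ?D * fst a + - orient c d a * (fst b - fst a)"
      using lin[OF t] by simp
    also have "\<dots> = ?D * fst c + orient a b c * (fst d - fst c)"
      unfolding orient_def by algebra
    also have "\<dots> = ?D * ((1 - s) * fst c + s * fst d)"
      by (rule lin[OF s])
    finally show "fst ((1 - t) *\<^sub>R a + t *\<^sub>R b) = fst ((1 - s) *\<^sub>R c + s *\<^sub>R d)"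
      using D by simp
    have "?D * ((1 - t) * snd a + t * snd b) = ?D * snd a + - orient c d a * (snd b - snd a)"
      using lin[OF t] by simp
    also have "\<dots> = ?D * snd c + orient a b c * (snd d - snd c)"
      unfolding orient_def by algebra
    also have "\<dots> = ?D * ((1 - s) * snd c + s * snd d)"
      by (rule lin[OF s])
    finally show "snd ((1 - t) *\<^sub>R a + t *\<^sub>R b) = snd ((1 - s) *\<^sub>R c + s *\<^sub>R d)"
      using D by simp
  qed
  have "((1 - t) *\<^sub>R a + t *\<^sub>R b) \<in> convex hull {a, b}"
    using ts unfolding segment_convex_hull[symmetric] in_segment by blast
  moreover have "((1 - t) *\<^sub>R a + t *\<^sub>R b) \<in> convex hull {c, d}"
    using ts unfolding eq segment_convex_hull[symmetric] in_segment by blast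
  ultimately show ?thesis
    by blast
qed

text \<open>The barycentric coordinates of \<open>q\<close> are quotients of signed triangle
  areas.\<close>

lemma in_triangle:
  assumes "\<sigma> * orient a b c > 0" "\<sigma> * orient q b c \<ge> 0" "\<sigma> * orient a q c \<ge> 0" "\<sigma> * orient a b q \<ge> 0"
  shows "q \<in> convex hull {a, b, c}"
proof -
  let ?D = "orient a b c"
  have D: "?D \<noteq> 0" using assms(1) by auto
  have pos: "0 \<le> x / ?D" if "\<sigma> * x \<ge> 0" for x
    using that assms(1) by (auto simp: zero_le_mult_iff zero_less_mult_iff divide_nonneg_nonneg divide_nonpos_nonpos)
  have sum: "orient q b c + orient a q c + orient a b q = ?D"
    by (simp add: orient_def algebra_simps)
  have "q = (orient q b c / ?D) *\<^sub>R a + (orient a q c / ?D) *\<^sub>R b + (orient a b q / ?D) *\<^sub>R c"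
  proof (rule prod_eqI)
    have "?D * fst q = orient q b c * fst a + orient a q c * fst b + orient a b q * fst c"
      unfolding orient_def by algebra
    then show "fst q = fst ((orient q b c / ?D) *\<^sub>R a + (orient a q c / ?D) *\<^sub>R b + (orient a b q / ?D) *\<^sub>R c)"
      using D by (simp add: field_simps)
    have "?D * snd q = orient q b c * snd a + orient a q c * snd b + orient a b q * snd c"
      unfolding orient_def by algebra
    then show "snd q = snd ((orient q b c / ?D) *\<^sub>R a + (orient a q c / ?D) *\<^sub>R b + (orient a b q / ?D) *\<^sub>R c)"
      using D by (simp add: field_simps)
  qed
  moreover have "orient q b c / ?D + orient a q c / ?D + orient a b q / ?D = 1"
    using sum D by (simp flip: add_divide_distrib)
  ultimately show ?thesis
    unfolding convex_hull_3 using assms pos by blast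
qed

definition grid :: "bool \<Rightarrow> nat \<Rightarrow> pt" where
  "grid r i = (real i, if r then 1 else 0)"

lemma fst_grid [simp]: "fst (grid r i) = real i" and snd_grid: "snd (grid r i) = (if r then 1 else 0)"
  by (simp_all add: grid_def)

lemma dist_grid: "dist (grid r i) (grid s j) = sqrt ((real i - real j)\<^sup>2 + (if r = s then 0 else 1))"
  by (auto simp: grid_def dist_Pair_Pair dist_real_def)

text \<open>Meant for grid points \<open>a'\<close>, \<open>b'\<close>, \<open>c'\<close> within
  five consecutive columns. Their orientation is an integer, so an error of 1/2 cannot change a
  nonzero sign.\<close>

lemma orient_perturb:
  assumes "dist a a' \<le> 1/100" "dist b b' \<le> 1/100" "dist c c' \<le> 1/100"
    and "\<bar>fst b' - fst a'\<bar> \<le> 4" "\<bar>fst c' - fst a'\<bar> \<le> 4" "\<bar>snd b' - snd a'\<bar> \<le> 4" "\<bar>snd c' - snd a'\<bar> \<le> 4"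
  shows "\<bar>orient a b c - orient a' b' c'\<bar> \<le> 1/2"
proof -
  have coord: "\<bar>fst x - fst y\<bar> \<le> 1/100" "\<bar>snd x - snd y\<bar> \<le> 1/100" if "dist x y \<le> 1/100" for x y :: pt
    using that dist_fst_le[of x y] dist_snd_le[of x y] by (auto simp: dist_real_def)
  have prod: "\<bar>x * y - x' * y'\<bar> \<le> 1/4" if "\<bar>x - x'\<bar> \<le> 1/50" "\<bar>y - y'\<bar> \<le> 1/50" "\<bar>x'\<bar> \<le> 4" "\<bar>y'\<bar> \<le> 4"
    for x y x' y' :: real
  proof -
    have "x * y - x' * y' = (x - x') * (y - y') + (x - x') * y' + x' * (y - y')"
      by (simp add: algebra_simps)
    then have "\<bar>x * y - x' * y'\<bar> \<le> \<bar>x - x'\<bar> * \<bar>y - y'\<bar> + \<bar>x - x'\<bar> * \<bar>y'\<bar> + \<bar>x'\<bar> * \<bar>y - y'\<bar>"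
      by (simp flip: abs_mult)
    \<comment> \<open>The sum is 0.1604, below 1/4; \<open>orient\<close> is a difference of two
      such products.\<close>
    also have "\<dots> \<le> (1/50) * (1/50) + (1/50) * 4 + 4 * (1/50)"
      using that by (intro add_mono mult_mono) auto
    finally show ?thesis by simp
  qed
  have diff: "\<bar>(y - x) - (y' - x')\<bar> \<le> 1/50" if "\<bar>x - x'\<bar> \<le> 1/100" "\<bar>y - y'\<bar> \<le> 1/100" for x x' y y' :: real
    using that by linarith
  note a = coord[OF assms(1)] and b = coord[OF assms(2)] and c = coord[OF assms(3)]
  have "\<bar>(fst b - fst a) * (snd c - snd a) - (fst b' - fst a') * (snd c' - snd a')\<bar> \<le> 1/4"
    by (intro prod diff a b c assms)
  moreover have "\<bar>(snd b - snd a) * (fst c - fst a) - (snd b' - snd a') * (fst c' - fst a')\<bar> \<le> 1/4"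
    by (intro prod diff a b c assms)
  ultimately show ?thesis
    unfolding orient_def by linarith
qed

section \<open>Lower bound: blocks of five columns\<close>

text \<open>One tolerance serves all \<open>m\<close>: orientations are compared only within five
  consecutive columns, and pairs of distant columns need only a lower bound on their
  distance.\<close>

locale near_grid =
  fixes m :: nat and p :: "bool \<Rightarrow> nat \<Rightarrow> pt" and P :: "pt set"
  assumes near: "\<And>r i. 1 \<le> i \<Longrightarrow> i \<le> m \<Longrightarrow> dist (p r i) (grid r i) \<le> 1/100"
    and P_def: "P = {p r i | r i. 1 \<le> i \<and> i \<le> m}"
    and generic: "generic P"
    and convex: "convex_position P"
begin

section \<open>Distances in a near grid\<close>

lemma mem_P: "1 \<le> i \<Longrightarrow> i \<le> m \<Longrightarrow> p r i \<in> P"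
  by (auto simp: P_def)

lemma dist_near:
  assumes "1 \<le> i" "i \<le> m" "1 \<le> j" "j \<le> m"
  shows "dist (p r i) (p s j) \<le> dist (grid r i) (grid s j) + 1/50"
    and "dist (p r i) (p s j) \<ge> dist (grid r i) (grid s j) - 1/50"
  using near[OF assms(1,2), of r] near[OF assms(3,4), of s]
    dist_triangle[of "p r i" "p s j" "grid r i"] dist_triangle[of "grid r i" "p s j" "grid s j"]
    dist_triangle[of "grid r i" "grid s j" "p r i"] dist_triangle[of "p r i" "grid s j" "p s j"]
    dist_commute[of "p r i" "grid r i"] dist_commute[of "p s j" "grid s j"]
  by linarith+

lemma dist_lower:
  assumes "1 \<le> i" "i \<le> m" "1 \<le> j" "j \<le> m"
  shows "dist (p r i) (p s j) \<ge> \<bar>real i - real j\<bar> - 1/50"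
proof -
  have "dist (grid r i) (grid s j) \<ge> \<bar>real i - real j\<bar>"
    unfolding dist_grid by (rule real_le_rsqrt) auto
  then show ?thesis
    using dist_near[OF assms, of r s] by linarith
qed

lemma dist_row:
  assumes "1 \<le> i" "i \<le> m" "1 \<le> j" "j \<le> m"
  shows "dist (p r i) (p r j) \<le> \<bar>real i - real j\<bar> + 1/50"
proof -
  have "dist (grid r i) (grid r j) = \<bar>real i - real j\<bar>"
    by (simp add: dist_grid)
  then show ?thesis
    using dist_near[OF assms, of r r] by linarith
qed

lemma dist_rows_diff:
  assumes "1 \<le> i" "i \<le> m" "1 \<le> j" "j \<le> m" "r \<noteq> s"
  shows "dist (p r i) (p s j) \<le> sqrt ((real i - real j)\<^sup>2 + 1) + 1/50"
    and "dist (p r i) (p s j) \<ge> sqrt ((real i - real j)\<^sup>2 + 1) - 1/50"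
  using dist_near[OF assms(1-4), of r s] assms(5) by (simp_all add: dist_grid)

lemma dist_vertical:
  assumes "1 \<le> i" "i \<le> m"
  shows "dist (p r i) (p s i) \<le> 51/50"
proof -
  have "dist (grid r i) (grid s i) \<le> 1"
    by (simp add: dist_grid)
  then show ?thesis
    using dist_near(1)[OF assms assms, of r s] by linarith
qed

text \<open>The estimates here separate the lengths that will compete: at most 1.02 for a vertical,
  at least 1.3 for a change of row between different columns, at most 1.5 for the diagonal of a unit
  square, at least 1.98 over two gaps, at most 2.02 over two gaps within a row, at least 2.1 over
  two gaps with a change of row, at least 2.98 over three gaps.\<close>

lemma dist_diagonal:
  assumes "1 \<le> i" "Suc i \<le> m" "r \<noteq> s"
  shows "dist (p r i) (p s (Suc i)) \<le> 3/2"
proof -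
  have "sqrt 2 \<le> 1.45"
    by (rule real_le_lsqrt) (auto simp: power2_eq_square)
  moreover have "(real i - real (Suc i))\<^sup>2 + 1 = 2"
    by simp
  ultimately show ?thesis
    using dist_rows_diff(1)[of i "Suc i" r s] assms by simp
qed

lemma dist_diagonal_ge:
  assumes "1 \<le> i" "i \<le> m" "1 \<le> j" "j \<le> m" "r \<noteq> s" "i \<noteq> j"
  shows "dist (p r i) (p s j) \<ge> 1.3"
proof -
  have "1.35 \<le> sqrt 2"
    by (rule real_le_rsqrt) (auto simp: power2_eq_square)
  also have "sqrt 2 \<le> sqrt ((real i - real j)\<^sup>2 + 1)"
  proof -
    have "1 \<le> \<bar>real i - real j\<bar>" using assms by linarith
    then have "1 \<le> (real i - real j)\<^sup>2" by (metis abs_le_square_iff abs_1 power_one)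
    then show ?thesis by simp
  qed
  finally show ?thesis
    using dist_rows_diff(2)[OF assms(1-5)] by simp
qed

lemma dist_knight_ge:
  assumes "1 \<le> i" "Suc (Suc i) \<le> m" "r \<noteq> s"
  shows "dist (p r i) (p s (Suc (Suc i))) \<ge> 2.1"
proof -
  have "2.2 \<le> sqrt 5"
    by (rule real_le_rsqrt) (auto simp: power2_eq_square)
  moreover have "(real i - real (Suc (Suc i)))\<^sup>2 + 1 = 5"
    by simp
  ultimately show ?thesis
    using dist_rows_diff(2)[of i "Suc (Suc i)" r s] assms by simp
qed

lemma p_inj:
  assumes "1 \<le> i" "i \<le> m" "1 \<le> j" "j \<le> m"
  shows "p r i = p s j \<longleftrightarrow> r = s \<and> i = j"
proof
  assume eq: "p r i = p s j"
  then have "\<bar>real i - real j\<bar> \<le> 1/50"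
    using dist_lower[OF assms, of r s] by simp
  then have "i = j" by linarith
  moreover have "r = s"
  proof (rule ccontr)
    assume "r \<noteq> s"
    then show False
      using dist_rows_diff(2)[OF assms, of r s] eq \<open>i = j\<close> by simp
  qed
  ultimately show "r = s \<and> i = j" by simp
qed auto

section \<open>Orientations and crossings within five consecutive columns\<close>

lemma orient_near:
  assumes "1 \<le> i" "i \<le> m" "1 \<le> j" "j \<le> m" "1 \<le> k" "k \<le> m"
    and "\<bar>real j - real i\<bar> \<le> 4" "\<bar>real k - real i\<bar> \<le> 4"
  shows "\<bar>orient (p r i) (p s j) (p t k) - orient (grid r i) (grid s j) (grid t k)\<bar> \<le> 1/2"
  by (rule orient_perturb) (use assms near in \<open>auto simp: snd_grid\<close>)

lemma orient_near_sign:
  assumes grid: "h * orient (grid r i) (grid s j) (grid t k) \<ge> 1" and h: "h = 1 \<or> h = -1"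
    and "1 \<le> l" "l + 4 \<ge> u" "u \<le> m" "i \<in> {l..u}" "j \<in> {l..u}" "k \<in> {l..u}"
  shows "1/2 \<le> h * orient (p r i) (p s j) (p t k)"
proof -
  have "\<bar>orient (p r i) (p s j) (p t k) - orient (grid r i) (grid s j) (grid t k)\<bar> \<le> 1/2"
    by (rule orient_near) (use assms in auto)
  then show ?thesis
    unfolding abs_le_iff using grid h by (elim disjE) simp_all
qed

text \<open>In convex position a left-to-right triple turns left in the bottom row and right in the
  top row.\<close>

abbreviation sg :: "bool \<Rightarrow> real" where "sg r \<equiv> (if r then -1 else 1)"

text \<open>If the middle point were not strictly on the outer side of the line through the other
  two, it would lie in the triangle formed by these two and the point of column \<open>j\<close> in
  the opposite row, against convex position.\<close>

lemma row_chain: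
  assumes ijk: "1 \<le> i" "i < j" "j < k" "k \<le> m" "k \<le> i + 4"
  shows "sg r * orient (p r i) (p r j) (p r k) > 0"
proof (rule ccontr)
  assume neg: "\<not> ?thesis"
  have "orient (p r i) (p r k) (p r j) = - orient (p r i) (p r j) (p r k)"
    by (rule orient_swap2)
  then have 1: "sg r * orient (p r i) (p r k) (p r j) \<ge> 0"
    using neg by (simp split: if_splits)
  have 2: "sg r * orient (p r i) (p r k) (p (\<not> r) j) \<ge> 1/2"
    by (rule orient_near_sign[of _ _ _ _ _ _ _ i k]) (use ijk in \<open>auto simp: orient_def snd_grid\<close>)
  have 3: "sg r * orient (p r i) (p r j) (p (\<not> r) j) \<ge> 1/2"
    by (rule orient_near_sign[of _ _ _ _ _ _ _ i k]) (use ijk in \<open>auto simp: orient_def snd_grid\<close>)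
  have 4: "sg r * orient (p r j) (p r k) (p (\<not> r) j) \<ge> 1/2"
    by (rule orient_near_sign[of _ _ _ _ _ _ _ i k]) (use ijk in \<open>auto simp: orient_def snd_grid\<close>)
  have "p r j \<in> convex hull {p r i, p r k, p (\<not> r) j}"
    by (rule in_triangle[of "sg r"]) (use 1 2 3 4 in auto)
  also have "\<dots> \<subseteq> convex hull (P - {p r j})"
    by (rule hull_mono) (use ijk in \<open>auto simp: p_inj intro!: mem_P\<close>)
  finally show False
    using convex ijk mem_P[of j r] unfolding convex_position_def by simp
qed

lemma chords_cross:
  assumes i: "1 \<le> i" "i < j" "j < k" "k < l" "l \<le> m" "l \<le> i + 4"
  shows "convex hull {p r i, p r k} \<inter> convex hull {p r j, p r l} \<noteq> {}"
proof (rule segments_cross)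
  have c: "sg r * orient (p r i) (p r j) (p r k) > 0" "sg r * orient (p r i) (p r k) (p r l) > 0"
    "sg r * orient (p r i) (p r j) (p r l) > 0" "sg r * orient (p r j) (p r k) (p r l) > 0"
    by (rule row_chain; use i in linarith)+
  have e: "orient (p r i) (p r k) (p r j) = - orient (p r i) (p r j) (p r k)"
    "orient (p r j) (p r l) (p r i) = orient (p r i) (p r j) (p r l)"
    "orient (p r j) (p r l) (p r k) = - orient (p r j) (p r k) (p r l)"
    by (rule orient_swap2 orient_rotate)+
  show "orient (p r i) (p r k) (p r j) * orient (p r i) (p r k) (p r l) < 0"
    unfolding e using c by (auto simp: mult_less_0_iff zero_less_mult_iff split: if_splits)
  show "orient (p r j) (p r l) (p r i) * orient (p r j) (p r l) (p r k) < 0"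
    unfolding e using c by (auto simp: mult_less_0_iff zero_less_mult_iff split: if_splits)
qed

lemma chord_vertical_cross:
  assumes i: "1 \<le> i" "i < j" "j < k" "k \<le> m" "k \<le> i + 4"
  shows "convex hull {p r i, p r k} \<inter> convex hull {p r j, p (\<not> r) j} \<noteq> {}"
proof (rule segments_cross)
  have c: "sg r * orient (p r i) (p r j) (p r k) > 0"
    by (rule row_chain; use i in linarith)+
  have e: "orient (p r i) (p r k) (p r j) = - orient (p r i) (p r j) (p r k)"
    by (rule orient_swap2)
  have 1: "sg r * orient (p r i) (p r k) (p (\<not> r) j) \<ge> 1/2"
    by (rule orient_near_sign[of _ _ _ _ _ _ _ i k]) (use i in \<open>auto simp: orient_def snd_grid\<close>)
  have 2: "sg r * orient (p r j) (p (\<not> r) j) (p r i) \<ge> 1/2"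
    by (rule orient_near_sign[of _ _ _ _ _ _ _ i k]) (use i in \<open>auto simp: orient_def snd_grid\<close>)
  have 3: "sg (\<not> r) * orient (p r j) (p (\<not> r) j) (p r k) \<ge> 1/2"
    by (rule orient_near_sign[of _ _ _ _ _ _ _ i k]) (use i in \<open>auto simp: orient_def snd_grid\<close>)
  show "orient (p r i) (p r k) (p r j) * orient (p r i) (p r k) (p (\<not> r) j) < 0"
    unfolding e using c 1 by (auto simp: mult_less_0_iff zero_less_mult_iff split: if_splits)
  show "orient (p r j) (p (\<not> r) j) (p r i) * orient (p r j) (p (\<not> r) j) (p r k) < 0"
    using 2 3 by (auto simp: mult_less_0_iff zero_less_mult_iff split: if_splits)
qed

lemma diagonals_cross:
  assumes i: "1 \<le> i" "Suc i \<le> m"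
  shows "convex hull {p r i, p (\<not> r) (Suc i)} \<inter> convex hull {p (\<not> r) i, p r (Suc i)} \<noteq> {}"
proof (rule segments_cross)
  have 1: "sg r * orient (p r i) (p (\<not> r) (Suc i)) (p (\<not> r) i) \<ge> 1/2"
    by (rule orient_near_sign[of _ _ _ _ _ _ _ i "Suc i"]) (use i in \<open>auto simp: orient_def snd_grid\<close>)
  have 2: "sg (\<not> r) * orient (p r i) (p (\<not> r) (Suc i)) (p r (Suc i)) \<ge> 1/2"
    by (rule orient_near_sign[of _ _ _ _ _ _ _ i "Suc i"]) (use i in \<open>auto simp: orient_def snd_grid\<close>)
  have 3: "sg (\<not> r) * orient (p (\<not> r) i) (p r (Suc i)) (p r i) \<ge> 1/2"
    by (rule orient_near_sign[of _ _ _ _ _ _ _ i "Suc i"]) (use i in \<open>auto simp: orient_def snd_grid\<close>)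
  have 4: "sg r * orient (p (\<not> r) i) (p r (Suc i)) (p (\<not> r) (Suc i)) \<ge> 1/2"
    by (rule orient_near_sign[of _ _ _ _ _ _ _ i "Suc i"]) (use i in \<open>auto simp: orient_def snd_grid\<close>)
  show "orient (p r i) (p (\<not> r) (Suc i)) (p (\<not> r) i) * orient (p r i) (p (\<not> r) (Suc i)) (p r (Suc i)) < 0"
    using 1 2 by (auto simp: mult_less_0_iff zero_less_mult_iff split: if_splits)
  show "orient (p (\<not> r) i) (p r (Suc i)) (p r i) * orient (p (\<not> r) i) (p r (Suc i)) (p (\<not> r) (Suc i)) < 0"
    using 3 4 by (auto simp: mult_less_0_iff zero_less_mult_iff split: if_splits)
qed

section \<open>Colour classes and their crossings\<close>

definition cls :: "(bool \<Rightarrow> nat \<Rightarrow> bool) \<Rightarrow> pt set" where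
  "cls c = {p r i | r i. 1 \<le> i \<and> i \<le> m \<and> c r i}"

lemma cls_subset: "cls c \<subseteq> P"
  by (auto simp: cls_def P_def)

lemma cls_compl: "cls (\<lambda>r i. \<not> c r i) = P - cls c"
  by (auto simp: cls_def P_def p_inj) 

lemma cut_edge:
  assumes i: "1 \<le> i" "i \<le> m" "c r i" "Q r i" and j: "1 \<le> j" "j \<le> m" "c s j" "\<not> Q s j"
    and min: "\<And>r' i' s' j'. 1 \<le> i' \<Longrightarrow> i' \<le> m \<Longrightarrow> c r' i' \<Longrightarrow> Q r' i' \<Longrightarrow>
      1 \<le> j' \<Longrightarrow> j' \<le> m \<Longrightarrow> c s' j' \<Longrightarrow> \<not> Q s' j' \<Longrightarrow> dist (p r i) (p s j) \<le> dist (p r' i') (p s' j')"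
  shows "{p r i, p s j} \<in> MST (cls c)"
proof (rule MST_cut_edge[OF generic cls_subset])
  let ?S = "{p r i | r i. 1 \<le> i \<and> i \<le> m \<and> Q r i}"
  show "p r i \<in> cls c" "p r i \<in> ?S" "p s j \<in> cls c"
    using i j by (auto simp: cls_def)
  show "p s j \<notin> ?S"
  proof
    assume "p s j \<in> ?S"
    then obtain r' i' where "p s j = p r' i'" "1 \<le> i'" "i' \<le> m" "Q r' i'"
      by blast
    then show False
      using j p_inj[of j i' s r'] by auto
  qed
  show "dist (p r i) (p s j) \<le> dist x y" if "x \<in> cls c" "y \<in> cls c" "x \<in> ?S" "y \<notin> ?S" for x y
    using that min by (auto simp: cls_def p_inj)
qed

text \<open>The trees are those of the whole point set; only the counted edges are confined to the
  first \<open>k\<close> columns. This makes the counts of successive groups of columns additive,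
  through \<open>crossings_add\<close>.\<close>

definition crossings :: "(bool \<Rightarrow> nat \<Rightarrow> bool) \<Rightarrow> nat \<Rightarrow> (pt set \<times> pt set) set" where
  "crossings c k = {(e, f). e \<in> MST (cls c) \<and> f \<in> MST (cls (\<lambda>r i. \<not> c r i)) \<and>
     convex hull e \<inter> convex hull f \<noteq> {} \<and> e \<union> f \<subseteq> {p r i | r i. 1 \<le> i \<and> i \<le> k}}"

lemma finite_crossings_upto: "finite (crossings c k)"
  by (rule finite_subset[OF _ finite_crossings[OF generic cls_subset cls_subset]])
     (auto simp: crossings_def)

lemma crossings_swap: "card (crossings (\<lambda>r i. \<not> c r i) k) = card (crossings c k)"
proof -
  have "crossings (\<lambda>r i. \<not> c r i) k = prod.swap ` crossings c k"
    by (auto simp: crossings_def image_iff Int_commute)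
  then show ?thesis
    by (simp add: card_image)
qed

lemma crossings_mono: "k \<le> l \<Longrightarrow> crossings c k \<subseteq> crossings c l"
  by (fastforce simp: crossings_def)

lemma crossings_add:
  assumes "k \<le> l" "D \<subseteq> crossings c l" 
    and new: "\<And>e f. (e, f) \<in> D \<Longrightarrow> \<exists>r i. k < i \<and> i \<le> m \<and> p r i \<in> e \<union> f" and "k \<le> m"
  shows "card (crossings c k) + card D \<le> card (crossings c l)"
proof -
  have "crossings c k \<inter> D = {}"
  proof (safe; simp)
    fix e f assume ef: "(e, f) \<in> crossings c k" "(e, f) \<in> D"
    then obtain r i where i: "k < i" "i \<le> m" "p r i \<in> e \<union> f"
      using new by blast
    with ef(1) obtain s j where "p r i = p s j" "1 \<le> j" "j \<le> k"
      unfolding crossings_def by blast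
    then show False
      using p_inj[of i j r s] i \<open>k \<le> m\<close> by auto
  qed
  then have "card (crossings c k \<union> D) = card (crossings c k) + card D"
    using finite_crossings_upto assms(2) finite_subset by (metis card_Un_disjoint)
  then show ?thesis
    using crossings_mono[OF assms(1)] assms(2) finite_crossings_upto
    by (metis Un_least card_mono)
qed

text \<open>Each colour has one point in column \<open>i\<close> and one in column
  \<open>i + 1\<close>. Every other pair across the cut between these columns spans at least two
  gaps and is longer than the diagonal.\<close>

lemma diagonal_step:
  assumes i: "1 \<le> i" "Suc i \<le> m"
    and c: "c r i" "\<not> c (\<not> r) i" "c (\<not> r) (Suc i)" "\<not> c r (Suc i)"
  shows "card (crossings c i) + 1 \<le> card (crossings c (Suc i))"
proof -
  have gen: "{p r i, p (\<not> r) (Suc i)} \<in> MST (cls c)"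
    if c: "c r i" "\<not> c (\<not> r) i" "c (\<not> r) (Suc i)" "\<not> c r (Suc i)" for c r
  proof (rule cut_edge[where Q = "\<lambda>r j. j \<le> i"])
    fix r' i' s' j' assume *: "1 \<le> i'" "i' \<le> m" "c r' i'" "i' \<le> i" "1 \<le> j'" "j' \<le> m" "c s' j'" "\<not> j' \<le> i"
    show "dist (p r i) (p (\<not> r) (Suc i)) \<le> dist (p r' i') (p s' j')"
    proof (cases "i' = i \<and> j' = Suc i")
      case True
      then have "r' = r" "s' = (\<not> r)"
        using * c by (cases r; cases r'; cases s'; simp)+
      then show ?thesis using True by simp
    next
      case False
      then have "\<bar>real i' - real j'\<bar> \<ge> 2"
        using * by linarith
      then show ?thesis
        using dist_diagonal[of i r "\<not> r"] dist_lower[of i' j' r' s'] * i by auto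
    qed
  qed (use i c in auto)
  let ?e = "{p r i, p (\<not> r) (Suc i)}" and ?f = "{p (\<not> r) i, p r (Suc i)}"
  have "?e \<in> MST (cls c)"
    by (rule gen) (use c in auto)
  moreover have "?f \<in> MST (cls (\<lambda>r i. \<not> c r i))"
    using gen[of "\<lambda>r i. \<not> c r i" "\<not> r"] c by auto
  ultimately have "{(?e, ?f)} \<subseteq> crossings c (Suc i)"
    using diagonals_cross[of i r] i unfolding crossings_def by fastforce
  from crossings_add[OF _ this, of i] i show ?thesis
    by fastforce
qed

lemma block_step_aux:
  assumes s: "1 \<le> s" "s + 4 \<le> m"
    and c: "c r s" "\<not> c (\<not> r) s" "\<And>q. \<not> c q (s + 1)" "\<And>q. c q (s + 2)" "\<And>q. \<not> c q (s + 3)"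
      "c r (s + 4)" "\<not> c (\<not> r) (s + 4)"
    and le: "dist (p r (s + 1)) (p r (s + 3)) \<le> dist (p (\<not> r) (s + 1)) (p (\<not> r) (s + 3))"
  shows "card (crossings c s) + 5 \<le> card (crossings c (s + 4))"
proof -
  let ?d = "\<lambda>r i. \<not> c r i"
  let ?e1 = "{p r s, p r (s + 2)}" and ?e2 = "{p r (s + 2), p r (s + 4)}" and ?e3 = "{p r (s + 2), p (\<not> r) (s + 2)}"
  let ?f1 = "{p r (s + 1), p (\<not> r) (s + 1)}" and ?f2 = "{p r (s + 3), p (\<not> r) (s + 3)}" and ?f3 = "{p r (s + 1), p r (s + 3)}"
  \<comment> \<open>Column \<open>s\<close> has a single point of this colour, so a competitor
    between columns \<open>s\<close> and \<open>s + 2\<close> changes row and is longer by a safe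
    margin.\<close>
  have e1: "?e1 \<in> MST (cls c)"
  proof (rule cut_edge[where Q = "\<lambda>r j. j \<le> s"])
    fix r' i' s' j' assume *: "1 \<le> i'" "i' \<le> m" "c r' i'" "i' \<le> s" "1 \<le> j'" "j' \<le> m" "c s' j'" "\<not> j' \<le> s"
    have "j' \<noteq> s + 1" using * c by metis
    then consider "i' = s" "j' = s + 2" | "\<bar>real i' - real j'\<bar> \<ge> 3"
      using * by linarith
    then show "dist (p r s) (p r (s + 2)) \<le> dist (p r' i') (p s' j')"
    proof cases
      case 1
      then have "r' = r" using * c by (cases r; cases r') auto
      then show ?thesis
        using 1 dist_row[of s "s + 2" r] dist_knight_ge[of s r s'] s by (cases "s' = r") auto
    next
      case 2
      then show ?thesis
        using dist_row[of s "s + 2" r] dist_lower[of i' j' r' s'] * s by auto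
    qed
  qed (use s c in auto)
  have e2: "?e2 \<in> MST (cls c)"
  proof (rule cut_edge[where Q = "\<lambda>r j. j \<le> s + 2"])
    fix r' i' s' j' assume *: "1 \<le> i'" "i' \<le> m" "c r' i'" "i' \<le> s + 2" "1 \<le> j'" "j' \<le> m" "c s' j'" "\<not> j' \<le> s + 2"
    have "j' \<noteq> s + 3" using * c by metis
    then consider "i' = s + 2" "j' = s + 4" | "\<bar>real i' - real j'\<bar> \<ge> 3"
      using * by linarith
    then show "dist (p r (s + 2)) (p r (s + 4)) \<le> dist (p r' i') (p s' j')"
    proof cases
      case 1
      then have "s' = r" using * c by (cases r; cases s') auto
      then show ?thesis
        using 1 dist_row[of "s + 2" "s + 4" r] dist_knight_ge[of "s + 2" r' r] s by (cases "r' = r") (auto simp: eval_nat_numeral)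
    next
      case 2
      then show ?thesis
        using dist_row[of "s + 2" "s + 4" r] dist_lower[of i' j' r' s'] * s by auto
    qed
  qed (use s c in auto)
  \<comment> \<open>Both end columns are entirely of this colour, so the two row chords tie in the
    grid. This is the one tie that must be resolved, and \<open>le\<close> resolves it.\<close>
  have f3: "?f3 \<in> MST (cls ?d)"
  proof (rule cut_edge[where Q = "\<lambda>r j. j \<le> s + 1"])
    fix r' i' s' j' assume *: "1 \<le> i'" "i' \<le> m" "?d r' i'" "i' \<le> s + 1" "1 \<le> j'" "j' \<le> m" "?d s' j'" "\<not> j' \<le> s + 1"
    have "j' \<noteq> s + 2" using * c by metis
    then consider "i' = s + 1" "j' = s + 3" | "\<bar>real i' - real j'\<bar> \<ge> 3"
      using * by linarith
    then show "dist (p r (s + 1)) (p r (s + 3)) \<le> dist (p r' i') (p s' j')"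
    proof cases
      case 1
      show ?thesis
      proof (cases "r' = s'")
        case True
        then show ?thesis using 1 le by (cases "r' = r") auto
      next
        case False
        then show ?thesis
          using 1 dist_row[of "s + 1" "s + 3" r] dist_knight_ge[of "s + 1" r' s'] s by (auto simp: eval_nat_numeral)
      qed
    next
      case 2
      then show ?thesis
        using dist_row[of "s + 1" "s + 3" r] dist_lower[of i' j' r' s'] * s by auto
    qed
  qed (use s c in auto)
  \<comment> \<open>The cut isolates \<open>p r j\<close>. Its neighbours in row \<open>r\<close>
    have the other colour, so a competitor either changes row between different columns or spans at
    least two gaps.\<close>
  have vert: "{p r j, p (\<not> r) j} \<in> MST (cls b)"
    if j: "1 \<le> j" "j \<le> m" "b r j" "b (\<not> r) j" and nb: "\<not> b r (j - 1)" "\<not> b r (j + 1)" for b j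
  proof (rule cut_edge[where Q = "\<lambda>q i. q = r \<and> i = j"])
    fix r' i' s' j' assume *: "1 \<le> i'" "i' \<le> m" "b r' i'" "r' = r \<and> i' = j" "1 \<le> j'" "j' \<le> m" "b s' j'" "\<not> (s' = r \<and> j' = j)"
    consider "j' = j" "s' = (\<not> r)" | "s' = (\<not> r)" "j' \<noteq> j" | "\<bar>real i' - real j'\<bar> \<ge> 2"
    proof -
      have "\<bar>real i' - real j'\<bar> \<ge> 2" if "s' = r"
      proof -
        have "j' \<noteq> j - 1" "j' \<noteq> j + 1" "j' \<noteq> j" using that * nb by auto
        then show ?thesis using * j by linarith
      qed
      then show ?thesis using that by blast
    qed
    then show "dist (p r j) (p (\<not> r) j) \<le> dist (p r' i') (p s' j')"
    proof cases
      case 1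
      then show ?thesis using * by simp
    next
      case 2
      then show ?thesis
        using dist_vertical[of j r "\<not> r"] dist_diagonal_ge[of i' j' r' s'] * j by auto
    next
      case 3
      then show ?thesis
        using dist_vertical[of j r "\<not> r"] dist_lower[of i' j' r' s'] * j by auto
    qed
  qed (use j in auto)
  have e3: "?e3 \<in> MST (cls c)"
    by (rule vert) (use s c in \<open>auto simp: eval_nat_numeral\<close>)
  have f1: "?f1 \<in> MST (cls ?d)"
    by (rule vert) (use s c in \<open>auto simp: eval_nat_numeral\<close>)
  have f2: "?f2 \<in> MST (cls ?d)"
    by (rule vert) (use s c in \<open>auto simp: eval_nat_numeral\<close>)
  \<comment> \<open>Three crossings of a chord with a vertical and two crossings of consecutive
    chords.\<close>
  let ?D = "{(?e1, ?f1), (?e2, ?f2), (?e3, ?f3), (?e1, ?f3), (?e2, ?f3)}"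
  have x: "convex hull ?e1 \<inter> convex hull ?f1 \<noteq> {}" "convex hull ?e2 \<inter> convex hull ?f2 \<noteq> {}"
    "convex hull ?e3 \<inter> convex hull ?f3 \<noteq> {}" "convex hull ?e1 \<inter> convex hull ?f3 \<noteq> {}"
    "convex hull ?e2 \<inter> convex hull ?f3 \<noteq> {}"
    using chord_vertical_cross[of s "s + 1" "s + 2" r] chord_vertical_cross[of "s + 2" "s + 3" "s + 4" r]
      chord_vertical_cross[of "s + 1" "s + 2" "s + 3" r] chords_cross[of s "s + 1" "s + 2" "s + 3" r]
      chords_cross[of "s + 1" "s + 2" "s + 3" "s + 4" r] s by (auto simp: Int_commute)
  have in_upto: "p q j \<in> {p r i | r i. 1 \<le> i \<and> i \<le> s + 4}" if "1 \<le> j" "j \<le> s + 4" for q j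
    using that by blast
  have sub: "?D \<subseteq> crossings c (s + 4)"
    unfolding crossings_def using e1 e2 e3 f1 f2 f3 x s in_upto by simp
  have ne: "?e1 \<noteq> ?e2" "?e1 \<noteq> ?e3" "?e2 \<noteq> ?e3" "?f1 \<noteq> ?f3" "?f2 \<noteq> ?f3" "?f1 \<noteq> ?f2"
    using s by (auto simp: doubleton_eq_iff p_inj)
  have card: "card ?D = 5"
    using ne by auto
  have new: "\<exists>r i. s < i \<and> i \<le> m \<and> p r i \<in> e \<union> f" if "(e, f) \<in> ?D" for e f
  proof -
    have "p r (s + 1) \<in> e \<union> f \<or> p r (s + 2) \<in> e \<union> f"
      using that by auto
    then show ?thesis
    proof
      assume "p r (s + 1) \<in> e \<union> f"
      then show ?thesis
        using s by (intro exI[of _ r] exI[of _ "s + 1"]) auto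
    next
      assume "p r (s + 2) \<in> e \<union> f"
      then show ?thesis
        using s by (intro exI[of _ r] exI[of _ "s + 2"]) auto
    qed
  qed
  show ?thesis
    using crossings_add[OF _ sub new] s card by simp
qed

text \<open>The end columns of a block are shared with its neighbours and have a fixed colouring,
  while the shorter row \<open>r\<close> varies. The colour \<open>x\<close> of row \<open>r\<close>
  in these columns therefore decides which colour plays the role of red.\<close>

lemma block_step:
  assumes s: "1 \<le> s" "s + 4 \<le> m"
    and c: "c r s = x" "c (\<not> r) s = (\<not> x)" "\<And>q. c q (s + 1) = (\<not> x)" "\<And>q. c q (s + 2) = x" "\<And>q. c q (s + 3) = (\<not> x)"
      "c r (s + 4) = x" "c (\<not> r) (s + 4) = (\<not> x)"
    and le: "dist (p r (s + 1)) (p r (s + 3)) \<le> dist (p (\<not> r) (s + 1)) (p (\<not> r) (s + 3))"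
  shows "card (crossings c s) + 5 \<le> card (crossings c (s + 4))"
proof (cases x)
  case True
  then show ?thesis
    using block_step_aux[OF s _ _ _ _ _ _ _ le, of c] c by auto
next
  case False
  then show ?thesis
    using block_step_aux[OF s _ _ _ _ _ _ _ le, of "\<lambda>r i. \<not> c r i"] c by (auto simp: crossings_swap)
qed

section \<open>The colouring for the lower bound\<close>

definition short_row :: "nat \<Rightarrow> bool" where
  "short_row s \<longleftrightarrow> dist (p True (s + 1)) (p True (s + 3)) \<le> dist (p False (s + 1)) (p False (s + 3))"

text \<open>Here \<open>j\<close> is the offset in the block that starts in column \<open>s\<close>.
  For \<open>j = 0\<close> both branches give \<open>\<not> q\<close>, so shared columns are
  coloured alike whatever \<open>short_row\<close> is and whether or not a complete block follows.
  After the last complete block, the bichromatic columns alternate, which gives crossing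
  diagonals.\<close>

definition coloring :: "bool \<Rightarrow> nat \<Rightarrow> bool" where
  "coloring q i = (let j = (i - 1) mod 4; s = i - j; r = short_row s in
     if s + 4 \<le> m then (if j = 0 then \<not> q else if j = 2 then \<not> r else r)
     else q \<noteq> even j)"

lemma coloring_block:
  assumes "4 * a + 5 \<le> m"
  defines "s \<equiv> 4 * a + 1"
  shows "card (crossings coloring s) + 5 \<le> card (crossings coloring (s + 4))"
proof (rule block_step[where r = "short_row s" and x = "\<not> short_row s"])
  show "dist (p (short_row s) (s + 1)) (p (short_row s) (s + 3))
      \<le> dist (p (\<not> short_row s) (s + 1)) (p (\<not> short_row s) (s + 3))"
    by (cases "short_row s") (auto simp: short_row_def)
  have *: "coloring q (s + j) = (if j = 0 then \<not> q else if j = 2 then \<not> short_row s else short_row s)" if "j < 4" for q j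
    using that assms(1) by (simp add: coloring_def s_def Let_def)
  have **: "coloring q (s + 4) = (\<not> q)" for q
    by (simp add: coloring_def s_def Let_def)
  show "coloring (short_row s) s = (\<not> short_row s)" "coloring (\<not> short_row s) s = (\<not> \<not> short_row s)"
    using *[of 0] by auto
  show "coloring q (s + 1) = (\<not> \<not> short_row s)" "coloring q (s + 2) = (\<not> short_row s)"
    "coloring q (s + 3) = (\<not> \<not> short_row s)" for q
    using *[of 1 q] *[of 2 q] *[of 3 q] by auto
  show "coloring (short_row s) (s + 4) = (\<not> short_row s)" "coloring (\<not> short_row s) (s + 4) = (\<not> \<not> short_row s)"
    using ** by auto
qed (use assms in auto)

lemma coloring_blocks: "4 * a + 1 \<le> m \<Longrightarrow> 5 * a \<le> card (crossings coloring (4 * a + 1))"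
proof (induction a)
  case (Suc a)
  then show ?case
    using coloring_block[of a] by simp
qed simp

lemma coloring_rest:
  assumes "4 * a + 1 \<le> m" "m < 4 * a + 5"
  shows "4 * a + 1 + b \<le> m \<Longrightarrow> 5 * a + b \<le> card (crossings coloring (4 * a + 1 + b))"
proof (induction b)
  case 0
  then show ?case
    using coloring_blocks assms by simp
next
  case (Suc b)
  let ?i = "4 * a + 1 + b"
  have *: "coloring q (4 * a + 1 + j) = (q \<noteq> even j)" if "j < 4" for q j
    using that assms by (simp add: coloring_def Let_def)
  have b: "Suc b < 4"
    using Suc.prems assms by simp
  have "card (crossings coloring ?i) + 1 \<le> card (crossings coloring (Suc ?i))"
    \<comment> \<open>At offset \<open>b\<close> the point coloured \<open>True\<close> lies in row
      \<open>odd b\<close>.\<close>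
    by (rule diagonal_step[where r = "odd b"]) (use Suc.prems *[of b] *[of "Suc b"] b in auto)
  then show ?case
    using Suc by simp
qed

lemma cr_lower:
  assumes "1 \<le> m"
  shows "(m - 1) + (m - 1) div 4 \<le> cr P"
proof -
  let ?R = "cls coloring"
  define a where "a = (m - 1) div 4"
  define b where "b = (m - 1) mod 4"
  have m: "m = 4 * a + 1 + b" "b < 4"
    using assms by (simp_all add: a_def b_def)
  then have "5 * a + b \<le> card (crossings coloring m)"
    using coloring_rest[of a b] by simp
  also have "\<dots> \<le> cr_pair ?R (P - ?R)"
    unfolding cr_pair_def
    by (rule card_mono[OF finite_crossings[OF generic]])
       (auto simp: cls_subset crossings_def cls_compl)
  also have "\<dots> \<le> cr P"
    unfolding cr_def
  proof (rule Max_ge)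
    have "finite P"
      using generic by (simp add: generic_def)
    then have "finite ((\<lambda>R. cr_pair R (P - R)) ` Pow P)"
      by simp
    moreover have "{cr_pair R (P - R) | R. R \<subseteq> P} = (\<lambda>R. cr_pair R (P - R)) ` Pow P"
      by auto
    ultimately show "finite {cr_pair R (P - R) | R. R \<subseteq> P}"
      by simp
    show "cr_pair ?R (P - ?R) \<in> {cr_pair R (P - R) | R. R \<subseteq> P}"
      using cls_subset[of coloring] unfolding mem_Collect_eq by (intro exI[of _ ?R]) simp
  qed
  finally show ?thesis
    using m(1) unfolding a_def[symmetric] by linarith
qed

end

section \<open>Upper bound: spanning trees in a tied grid\<close>

text \<open>Here ty is 0 on bichromatic columns and the colour (1 or 2) on monochromatic ones. A key (g, t) is a
  charge to the gap between columns g and g + 1: for two diagonals (t = 0), for a chord from column g and the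
  vertical it crosses (t = 1), and for two consecutive chords which end in monochromatic columns (t = 2),
  whose second one ends in the bichromatic column g + 1 (t = 3), or whose first one starts in the bichromatic column g
  (t = 4, the extra charge).\<close>

definition crossing_keys :: "nat \<Rightarrow> (nat \<Rightarrow> nat) \<Rightarrow> (nat \<times> nat) set" where
  "crossing_keys m ty = {(g, t). 1 \<le> g \<and> g < m \<and>
     (t = 0 \<and> ty g = 0 \<and> ty (g + 1) = 0 \<or>
      t = 1 \<and> ty (g + 1) \<noteq> 0 \<and> ty g \<noteq> ty (g + 1) \<and> (\<exists>b. g + 1 < b \<and> b \<le> m \<and> ty b \<noteq> ty (g + 1)) \<or>
      t = 2 \<and> ty g \<noteq> 0 \<and> ty g = ty (g + 1) \<or>
      t = 3 \<and> ty g \<noteq> 0 \<and> ty (g + 1) = 0 \<or>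
      t = 4 \<and> ty g = 0 \<and> g + 3 \<le> m \<and> ty (g + 1) \<noteq> 0 \<and> ty (g + 2) \<noteq> 0 \<and> ty (g + 3) \<noteq> 0)}"

lemma finite_crossing_keys: "finite (crossing_keys m ty)"
  by (rule finite_subset[of _ "{..m} \<times> {..4}"]) (auto simp: crossing_keys_def)

text \<open>Keys with t < 4 lie on distinct gaps. If the last extra charge is not followed by a bichromatic
  column, then the gap entering the last monochromatic run is free and pays for it.\<close>

lemma card_crossing_keys: "card (crossing_keys m ty) \<le> (m - 1) + (m - 1) div 4"
proof -
  let ?low = "{k \<in> crossing_keys m ty. snd k \<noteq> 4}"
  let ?long = "{g. (g, 4) \<in> crossing_keys m ty}"
  \<comment> \<open>The starts of extra charges whose monochromatic stretch is ended by a later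
    bichromatic column.\<close>
  let ?closed = "{g \<in> ?long. \<exists>z>g. z \<le> m \<and> ty z = 0}"
  have fin: "finite ?low" "finite ?long" "finite ?closed"
    using finite_crossing_keys[of m ty] finite_subset[of ?long "{..m}"]
    by (auto simp: crossing_keys_def)
  have card: "card (crossing_keys m ty) = card ?low + card ?long"
  proof -
    have split: "crossing_keys m ty = ?low \<union> (\<lambda>g. (g, 4)) ` ?long"
      by force
    have "card (crossing_keys m ty) = card (?low \<union> (\<lambda>g. (g, 4::nat)) ` ?long)"
      by (rule arg_cong[OF split])
    also have "\<dots> = card ?low + card ((\<lambda>g. (g, 4::nat)) ` ?long)"
      using fin by (intro card_Un_disjoint) auto
    finally show ?thesis
      by (simp add: card_image inj_on_def)
  qed
  have "inj_on fst ?low"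
    by (auto simp: inj_on_def crossing_keys_def)
  then have low: "card ?low = card (fst ` ?low)"
    by (simp add: card_image)
  have sub: "fst ` ?low \<subseteq> {1..<m}"
    by (auto simp: crossing_keys_def)
  \<comment> \<open>Closed starts are at least four apart, so the gaps g, ..., g + 3 belonging to
    different starts are disjoint, and all of them lie in \<open>{1..<m}\<close>.\<close>
  have closed: "4 * card ?closed \<le> m - 1"
  proof -
    have far: "ty (g + k) \<noteq> 0 \<and> g + 4 \<le> m" if "g \<in> ?closed" "k \<in> {1, 2, 3}" for g k
    proof -
      from that obtain z where z: "g < z" "z \<le> m" "ty z = 0" by auto
      have *: "ty (g + 1) \<noteq> 0" "ty (g + 2) \<noteq> 0" "ty (g + 3) \<noteq> 0"
        using that by (auto simp: crossing_keys_def)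
      then have "z \<noteq> g + 1" "z \<noteq> g + 2" "z \<noteq> g + 3"
        using z by metis+
      then show ?thesis using z * that(2) by auto
    qed
    have apart: "g + 4 \<le> h" if "g \<in> ?closed" "h \<in> ?closed" "g < h" for g h
    proof -
      have "ty h = 0" using that(2) by (auto simp: crossing_keys_def)
      then have "h \<noteq> g + 1" "h \<noteq> g + 2" "h \<noteq> g + 3"
        using far[OF that(1), of 1] far[OF that(1), of 2] far[OF that(1), of 3] by auto
      then show ?thesis using that(3) by simp
    qed
    have "inj_on (\<lambda>(g, k). g + k) (?closed \<times> {..<4})"
    proof (rule inj_onI)
      fix x y
      assume xy: "x \<in> ?closed \<times> {..<4::nat}" "y \<in> ?closed \<times> {..<4::nat}"
        and eq: "(case x of (g, k) \<Rightarrow> g + k) = (case y of (g, k) \<Rightarrow> g + k)"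
      obtain g k h l where gh: "x = (g, k)" "y = (h, l)"
        by (cases x, cases y)
      have *: "g \<in> ?closed" "h \<in> ?closed" "k < 4" "l < 4" "g + k = h + l"
        using xy eq unfolding gh mem_Times_iff by simp_all
      have "\<not> g < h" "\<not> h < g"
        using apart[of g h] apart[of h g] * by linarith+
      then show "x = y" using * gh by simp
    qed
    moreover have "(\<lambda>(g, k). g + k) ` (?closed \<times> {..<4}) \<subseteq> {1..<m}"
    proof (rule image_subsetI)
      fix x assume x: "x \<in> ?closed \<times> {..<4::nat}"
      obtain g k where gk: "x = (g, k)"
        by (cases x)
      have g: "g \<in> ?closed" "k < 4"
        using x unfolding gk by blast+
      then have "1 \<le> g" by (auto simp: crossing_keys_def)
      then show "(case x of (g, k) \<Rightarrow> g + k) \<in> {1..<m}"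
        using far[OF g(1), of 1] g(2) gk by auto
    qed
    ultimately have "card (?closed \<times> {..<4::nat}) \<le> card {1..<m}"
      by (intro card_inj_on_le) auto
    then show ?thesis by (simp add: card_cartesian_product)
  qed
  show ?thesis
  proof (cases "?long = ?closed")
    case True
    have "card (fst ` ?low) \<le> m - 1"
      using card_mono[OF _ sub] by simp
    moreover have "card ?long \<le> (m - 1) div 4"
      using closed arg_cong[OF True, of card] by linarith
    ultimately show ?thesis using card low by linarith
  next
    case False
    then obtain a where a: "a \<in> ?long" "a \<notin> ?closed" by blast
    then have nz: "ty z \<noteq> 0" if "a < z" "z \<le> m" for z
      using that by auto
    have am: "1 \<le> a" "a < m" "ty a = 0"
      using a by (auto simp: crossing_keys_def)
    \<comment> \<open>Of two unclosed starts, the smaller would be closed by the larger, which is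
      itself a bichromatic column.\<close>
    have uniq: "g = a" if "g \<in> ?long" "g \<notin> ?closed" for g
    proof -
      have "ty g = 0" "g < m" "\<And>z. g < z \<Longrightarrow> z \<le> m \<Longrightarrow> ty z \<noteq> 0"
        using that by (auto simp: crossing_keys_def)
      then show ?thesis using nz am by (metis linorder_neqE_nat less_imp_le)
    qed
      have "card ?long \<le> card (insert a ?closed)"
      by (rule card_mono) (use fin uniq in blast)+
    also have "\<dots> \<le> Suc (card ?closed)"
      using fin(3) by (simp add: card_insert_if)
    finally have long: "card ?long \<le> Suc (card ?closed)" .
    let ?S = "{g. a \<le> g \<and> g < m \<and> ty g \<noteq> ty (g + 1)}"
    have S: "finite ?S" "a \<in> ?S"
      using am nz[of "a + 1"] by (auto intro: finite_subset[of _ "{..m}"])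
    \<comment> \<open>Gap \<open>q\<close> enters the last run, which is monochromatic and extends
      to column \<open>m\<close>. No chord of the other colour can span that run, so
      \<open>q\<close> carries no key of kind below 4, and this saving pays for the unclosed
      start.\<close>
    define q where "q = Max ?S"
    have "q \<in> ?S"
      unfolding q_def using S by (intro Max_in) auto
    then have q: "a \<le> q" "q < m" "ty q \<noteq> ty (q + 1)" by auto
    have last: "ty (g + 1) = ty g" if "q < g" "g < m" for g
    proof (rule ccontr)
      assume "ty (g + 1) \<noteq> ty g"
      then have "g \<in> ?S" using that q by auto
      then have "g \<le> q" unfolding q_def using S by (intro Max_ge) auto
      then show False using that by simp
    qed
    have const: "ty b = ty (q + 1)" if "q + 1 \<le> b" "b \<le> m" for b
      using that
    proof (induction b rule: dec_induct)
      case (step b)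
      then show ?case using last[of b] by simp
    qed simp
    have "ty (q + 1) \<noteq> 0" using nz q by simp
    have "q \<notin> fst ` ?low"
    proof
      assume "q \<in> fst ` ?low"
      then obtain t where "(q, t) \<in> crossing_keys m ty" "t \<noteq> 4" by auto
      moreover have "\<not> (\<exists>b. q + 1 < b \<and> b \<le> m \<and> ty b \<noteq> ty (q + 1))"
        using const less_imp_le by blast
      ultimately show False
        using \<open>ty (q + 1) \<noteq> 0\<close> q(3) unfolding crossing_keys_def by blast
    qed
    then have "fst ` ?low \<subseteq> {1..<m} - {q}"
      using sub by blast
    then have "card (fst ` ?low) \<le> card ({1..<m} - {q})"
      by (intro card_mono) auto
    also have "\<dots> = m - 2"
      using q am by (subst card_Diff_singleton) auto
    finally have "card (fst ` ?low) \<le> m - 2" .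
    moreover have "m \<ge> 2" using am by simp
    ultimately show ?thesis
      using card low long closed by linarith
  qed
qed

text \<open>A crossing may admit several keys, but a key fits at most one crossing, so any choice of
  keys is injective.\<close>

lemma card_le_keys:
  assumes "finite K" and "\<And>c. c \<in> C \<Longrightarrow> \<exists>k\<in>K. R k c"
    and "\<And>k c c'. R k c \<Longrightarrow> R k c' \<Longrightarrow> c = c'"
  shows "card C \<le> card K"
proof -
  obtain h where h: "\<And>c. c \<in> C \<Longrightarrow> h c \<in> K \<and> R (h c) c"
    using assms(2) by metis
  have "inj_on h C"
    using h assms(3) by (metis inj_onI)
  then show ?thesis
    using h assms(1) by (intro card_inj_on_le[of h]) auto
qed

text \<open>For four distinct positions on a circle: the pairs \<open>{x, y}\<close> and
  \<open>{u, v}\<close> separate each other.\<close>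

definition interleaved :: "nat \<Rightarrow> nat \<Rightarrow> nat \<Rightarrow> nat \<Rightarrow> bool" where
  "interleaved x y u v \<longleftrightarrow> (min x y < u \<and> u < max x y) \<noteq> (min x y < v \<and> v < max x y)"

text \<open>The points in counterclockwise order: bottom row from left to right, then top row from right to left.\<close>

definition ring_point :: "nat \<Rightarrow> (bool \<Rightarrow> nat \<Rightarrow> pt) \<Rightarrow> nat \<Rightarrow> pt" where
  "ring_point m p k = (if k \<le> m then p False k else p True (2 * m + 1 - k))"

text \<open>Unit horizontals are shorter than verticals, and verticals are shorter than longer
  horizontals and than diagonals. By \<open>through\<close>, no tree edge skips a column containing
  a point of its colour. By \<open>tie\<close>, the parity of the left column alone decides which of
  two parallel chords is shorter.\<close>

locale tied_grid =
  fixes m :: nat and p :: "bool \<Rightarrow> nat \<Rightarrow> pt"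
  assumes oriented: "\<And>i j k. 1 \<le> i \<Longrightarrow> i < j \<Longrightarrow> j < k \<Longrightarrow> k \<le> 2 * m \<Longrightarrow>
      orient (ring_point m p i) (ring_point m p j) (ring_point m p k) > 0"
    and through: "\<And>r s t i j k. 1 \<le> i \<Longrightarrow> i < j \<Longrightarrow> j < k \<Longrightarrow> k \<le> m \<Longrightarrow>
      dist (p r i) (p s j) < dist (p r i) (p t k) \<and> dist (p s j) (p t k) < dist (p r i) (p t k)"
    and diagonal: "\<And>r s i j k. 1 \<le> i \<Longrightarrow> i < j \<Longrightarrow> j \<le> m \<Longrightarrow> 1 \<le> k \<Longrightarrow> k \<le> m \<Longrightarrow>
      dist (p r i) (p r j) < dist (p s i) (p (\<not> s) j) \<and> dist (p False k) (p True k) < dist (p s i) (p (\<not> s) j)"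
    and vertical_long: "\<And>r i k. 1 \<le> i \<Longrightarrow> i < m \<Longrightarrow> 1 \<le> k \<Longrightarrow> k \<le> m \<Longrightarrow>
      dist (p r i) (p r (i + 1)) < dist (p False k) (p True k)"
    and vertical_short: "\<And>r i j k. 1 \<le> i \<Longrightarrow> i + 1 < j \<Longrightarrow> j \<le> m \<Longrightarrow> 1 \<le> k \<Longrightarrow> k \<le> m \<Longrightarrow>
      dist (p False k) (p True k) < dist (p r i) (p r j)"
    and tie: "\<And>i j. 1 \<le> i \<Longrightarrow> i + 1 < j \<Longrightarrow> j \<le> m \<Longrightarrow>
      dist (p (even i) i) (p (even i) j) < dist (p (odd i) i) (p (odd i) j)"
    and verticals_distinct: "\<And>i j. 1 \<le> i \<Longrightarrow> i < j \<Longrightarrow> j \<le> m \<Longrightarrow>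
      dist (p False i) (p True i) \<noteq> dist (p False j) (p True j)"
    and points_distinct: "\<And>r s i j. 1 \<le> i \<Longrightarrow> i \<le> m \<Longrightarrow> 1 \<le> j \<Longrightarrow> j \<le> m \<Longrightarrow>
      p r i = p s j \<longleftrightarrow> r = s \<and> i = j"
    and generic: "generic {p r i | r i. 1 \<le> i \<and> i \<le> m}"
begin

section \<open>Ring positions and disjoint segments\<close>

definition P :: "pt set" where "P = {p r i | r i. 1 \<le> i \<and> i \<le> m}"

lemma mem_P: "1 \<le> i \<Longrightarrow> i \<le> m \<Longrightarrow> p r i \<in> P"
  by (auto simp: P_def)

lemma generic_P: "generic P"
  using generic by (simp add: P_def)

definition pos :: "bool \<Rightarrow> nat \<Rightarrow> nat" where
  "pos r i = (if r then 2 * m + 1 - i else i)"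

lemma ring_pos: "1 \<le> i \<Longrightarrow> i \<le> m \<Longrightarrow> ring_point m p (pos r i) = p r i"
  by (auto simp: ring_point_def pos_def)

lemma pos_range: "1 \<le> i \<Longrightarrow> i \<le> m \<Longrightarrow> 1 \<le> pos r i \<and> pos r i \<le> 2 * m"
  by (auto simp: pos_def)

text \<open>The points strictly between \<open>x\<close> and \<open>y\<close> in the ring order lie
  on one side of the line through these two points, and all remaining points lie on the other
  side.\<close>

lemma ring_disjoint:
  assumes "1 \<le> x" "x < y" "y \<le> 2 * m" "u \<in> {1..2 * m} - {x, y}" "v \<in> {1..2 * m} - {x, y}"
    and "(x < u \<and> u < y) = (x < v \<and> v < y)"
  shows "convex hull {ring_point m p x, ring_point m p y} \<inter> convex hull {ring_point m p u, ring_point m p v} = {}"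
proof -
  let ?o = "\<lambda>u. orient (ring_point m p x) (ring_point m p y) (ring_point m p u)"
  have inside: "?o u < 0" if "x < u" "u < y" for u
    using oriented[of x u y] that assms(1-3) orient_swap2[of "ring_point m p x" "ring_point m p y" "ring_point m p u"] by simp
  have outside: "?o u > 0" if "\<not> (x < u \<and> u < y)" "u \<in> {1..2 * m} - {x, y}" for u
  proof (cases "u < x")
    case True
    then show ?thesis
      using oriented[of u x y] that assms(1-3) orient_rotate[of "ring_point m p x" "ring_point m p y" "ring_point m p u"] by simp
  next
    case False
    then show ?thesis
      using oriented[of x y u] that assms(1-3) by force
  qed
  show ?thesis
  proof (cases "x < u \<and> u < y")
    case True
    then show ?thesis
      using assms(6) inside by (intro segments_disjoint[of "-1"]) auto
  next
    case False
    then show ?thesis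
      using assms(4-6) outside by (intro segments_disjoint[of 1]) auto
  qed
qed

lemma cross_interleaved:
  assumes col: "1 \<le> i" "i \<le> m" "1 \<le> j" "j \<le> m" "1 \<le> k" "k \<le> m" "1 \<le> l" "l \<le> m"
    and ne: "(r, i) \<noteq> (s, j)" "(q, k) \<noteq> (r, i)" "(q, k) \<noteq> (s, j)" "(t, l) \<noteq> (r, i)" "(t, l) \<noteq> (s, j)"
    and meet: "convex hull {p r i, p s j} \<inter> convex hull {p q k, p t l} \<noteq> {}"
  shows "interleaved (pos r i) (pos s j) (pos q k) (pos t l)"
proof (rule ccontr)
  assume neg: "\<not> ?thesis"
  let ?x = "pos r i" and ?y = "pos s j" and ?u = "pos q k" and ?v = "pos t l"
  have pos_eq: "pos r i = pos s j \<longleftrightarrow> (r, i) = (s, j)"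
    if "1 \<le> i" "i \<le> m" "1 \<le> j" "j \<le> m" for r i s j
    using that by (auto simp: pos_def)
  have rng: "?x \<in> {1..2*m}" "?y \<in> {1..2*m}" "?u \<in> {1..2*m} - {?x, ?y}" "?v \<in> {1..2*m} - {?x, ?y}" "?x \<noteq> ?y"
    using pos_range col ne pos_eq by auto
  have "convex hull {ring_point m p ?x, ring_point m p ?y} \<inter> convex hull {ring_point m p ?u, ring_point m p ?v} = {}"
  proof (cases "?x < ?y")
    case True
    then show ?thesis
      using ring_disjoint[of ?x ?y ?u ?v] rng neg by (auto simp: interleaved_def)
  next
    case False
    then show ?thesis
      using ring_disjoint[of ?y ?x ?u ?v] rng neg by (auto simp: interleaved_def insert_commute)
  qed
  then show False
    using meet ring_pos col by simp
qed

section \<open>Edges of the tree of one colour\<close>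

definition full :: "pt set \<Rightarrow> nat \<Rightarrow> bool" where
  "full Z i \<longleftrightarrow> (\<forall>r. p r i \<in> Z)"

definition chord :: "pt set \<Rightarrow> bool \<Rightarrow> bool \<Rightarrow> nat \<Rightarrow> nat \<Rightarrow> bool" where
  "chord Z r s i j \<longleftrightarrow> 1 \<le> i \<and> i < j \<and> j \<le> m \<and> {p r i, p s j} \<in> MST Z"

lemma chord_mem: "Z \<subseteq> P \<Longrightarrow> chord Z r s i j \<Longrightarrow> p r i \<in> Z \<and> p s j \<in> Z"
  using MST_subset[OF generic_P, of Z] all_pairsD unfolding chord_def by blast

lemma edge_cases:
  assumes Z: "Z \<subseteq> P" and e: "e \<in> MST Z"
  obtains i where "1 \<le> i" "i \<le> m" "full Z i" "e = {p False i, p True i}"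
  | r s i j where "chord Z r s i j" "e = {p r i, p s j}"
proof -
  have "e \<in> all_pairs Z"
    using MST_subset[OF generic_P Z] e by blast
  then obtain a b where ab: "e = {a, b}" "a \<in> Z" "b \<in> Z" "a \<noteq> b"
    unfolding all_pairs_def by blast
  have "a \<in> P" "b \<in> P"
    using Z ab by auto
  then obtain r i s j where "a = p r i" "1 \<le> i" "i \<le> m" "b = p s j" "1 \<le> j" "j \<le> m"
    unfolding P_def by auto
  with ab have ij: "e = {p r i, p s j}" "p r i \<in> Z" "p s j \<in> Z" "p r i \<noteq> p s j"
      "1 \<le> i" "i \<le> m" "1 \<le> j" "j \<le> m"
    by auto
  consider "i = j" | "i < j" | "j < i" by linarith
  then show thesis
  proof cases
    case 1
    then have "s = (\<not> r)" using ij by (cases r; cases s) auto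
    then have "full Z i" "e = {p False i, p True i}"
      using 1 ij by (cases r; auto simp: full_def all_bool_eq insert_commute)+
    then show thesis using that(1) ij by blast
  next
    case 2
    then show thesis using that(2)[of r s i j] ij e by (auto simp: chord_def)
  next
    case 3
    then show thesis using that(2)[of s r j i] ij e by (auto simp: chord_def insert_commute)
  qed
qed

text \<open>By \<open>through\<close>, a point in an intermediate column would give a bypass in two
  steps.\<close>

lemma chord_gap:
  assumes Z: "Z \<subseteq> P" and c: "chord Z r s i j" and k: "i < k" "k < j"
  shows "p q k \<notin> Z"
proof
  assume q: "p q k \<in> Z"
  let ?R = "{(x, y). x \<in> Z \<and> y \<in> Z \<and> dist x y < dist (p r i) (p s j)}"
  have "(p r i, p q k) \<in> ?R" "(p q k, p s j) \<in> ?R"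
    using through[of i k j r q s] q chord_mem[OF Z c] c k by (auto simp: chord_def)
  then have "(p r i, p s j) \<in> ?R\<^sup>*"
    by (meson r_into_rtrancl rtrancl.rtrancl_into_rtrancl)
  then show False
    using MST_no_bypass[OF generic_P Z] c unfolding chord_def by blast
qed

lemma dist_column: "dist (p r i) (p (\<not> r) i) = dist (p False i) (p True i)"
  by (cases r) (auto simp: dist_commute)

text \<open>If \<open>Z\<close> contained another corner of the rectangle, the two sides through
  that corner would bypass the diagonal.\<close>

lemma chord_diagonal:
  assumes Z: "Z \<subseteq> P" and c: "chord Z r s i j" and rs: "r \<noteq> s"
  shows "p s i \<notin> Z \<and> p r j \<notin> Z"
proof -
  let ?R = "{(x, y). x \<in> Z \<and> y \<in> Z \<and> dist x y < dist (p r i) (p s j)}"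
  have s: "s = (\<not> r)" using rs by (cases r; cases s) auto
  have no: "(p r i, p s j) \<notin> ?R\<^sup>*"
    using MST_no_bypass[OF generic_P Z] c unfolding chord_def by blast
  have ij: "1 \<le> i" "i < j" "j \<le> m" using c by (auto simp: chord_def)
  have 1: "dist (p r i) (p s i) < dist (p r i) (p s j)" "dist (p s i) (p s j) < dist (p r i) (p s j)"
      "dist (p r i) (p r j) < dist (p r i) (p s j)" "dist (p r j) (p s j) < dist (p r i) (p s j)"
    using diagonal[of i j i s r] diagonal[of i j j r r] ij dist_column[of r i] dist_column[of r j] unfolding s by auto
  have "(p r i, p s i) \<in> ?R \<and> (p s i, p s j) \<in> ?R" if "p s i \<in> Z"
    using that chord_mem[OF Z c] 1 by auto
  moreover have "(p r i, p r j) \<in> ?R \<and> (p r j, p s j) \<in> ?R" if "p r j \<in> Z"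
    using that chord_mem[OF Z c] 1 by auto
  ultimately show ?thesis
    using no by (meson r_into_rtrancl rtrancl.rtrancl_into_rtrancl)
qed

text \<open>In the wrong row the chord is bypassed by two verticals and the parallel chord, all of
  them shorter.\<close>

lemma chord_tie:
  assumes Z: "Z \<subseteq> P" and c: "chord Z r r i j" and "i + 1 < j" "full Z i" "full Z j"
  shows "r = even i"
proof (rule ccontr)
  assume r: "r \<noteq> even i"
  let ?R = "{(x, y). x \<in> Z \<and> y \<in> Z \<and> dist x y < dist (p r i) (p r j)}"
  have ij: "1 \<le> i" "i < j" "j \<le> m" using c by (auto simp: chord_def)
  have "dist (p (\<not> r) i) (p (\<not> r) j) < dist (p r i) (p r j)"
    using tie[of i j] assms(3) ij r by (cases r) auto
  moreover have "dist (p r i) (p (\<not> r) i) < dist (p r i) (p r j)" "dist (p r j) (p (\<not> r) j) < dist (p r i) (p r j)"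
    using vertical_short[of i j i r] vertical_short[of i j j r] assms(3) ij dist_column by auto
  ultimately have "(p r i, p (\<not> r) i) \<in> ?R" "(p (\<not> r) i, p (\<not> r) j) \<in> ?R" "(p (\<not> r) j, p r j) \<in> ?R"
    using assms(4,5) by (auto simp: full_def dist_commute)
  then have "(p r i, p r j) \<in> ?R\<^sup>*"
    by (meson r_into_rtrancl rtrancl.rtrancl_into_rtrancl)
  then show False
    using MST_no_bypass[OF generic_P Z] c unfolding chord_def by blast
qed

lemma row_path:
  assumes "i \<le> j" "1 \<le> i" "j \<le> m" "\<And>k. i \<le> k \<Longrightarrow> k \<le> j \<Longrightarrow> full Z k" 
    and "\<And>k. i \<le> k \<Longrightarrow> k < j \<Longrightarrow> dist (p r k) (p r (k + 1)) < D"
  shows "(p r i, p r j) \<in> {(x, y). x \<in> Z \<and> y \<in> Z \<and> dist x y < D}\<^sup>*"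
  using assms
proof (induction j rule: dec_induct)
  case (step j)
  let ?R = "{(x, y). x \<in> Z \<and> y \<in> Z \<and> dist x y < D}"
  have "(p r i, p r j) \<in> ?R\<^sup>*"
    using step by simp
  moreover have "(p r j, p r (Suc j)) \<in> ?R"
    using step.prems(3)[of j] step.prems(3)[of "Suc j"] step.prems(4)[of j] step.hyps by (auto simp: full_def)
  ultimately show ?case
    by (rule rtrancl.rtrancl_into_rtrancl)
qed simp

text \<open>The longer vertical is bypassed: follow one row to the shorter vertical, and return
  along the other row. The unit horizontals used are shorter than any vertical.\<close>

lemma vertical_unique:
  assumes Z: "Z \<subseteq> P" and kl: "1 \<le> k" "k < l" "l \<le> m"
    and full: "\<And>i. k \<le> i \<Longrightarrow> i \<le> l \<Longrightarrow> full Z i"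
    and mst: "{p False k, p True k} \<in> MST Z" "{p False l, p True l} \<in> MST Z"
  shows False
proof -
  have path: "(p r i, p r j) \<in> {(x, y). x \<in> Z \<and> y \<in> Z \<and> dist x y < dist (p False h) (p True h)}\<^sup>*"
    if "i = k \<and> j = l \<or> i = l \<and> j = k" "h = k \<or> h = l" for r h i j
  proof -
    let ?R = "{(x, y). x \<in> Z \<and> y \<in> Z \<and> dist x y < dist (p False h) (p True h)}"
    have kl_path: "(p r k, p r l) \<in> ?R\<^sup>*"
      by (rule row_path) (use kl full that vertical_long in auto)
    have "sym ?R"
      by (auto simp: sym_def dist_commute)
    then have "(p r l, p r k) \<in> ?R\<^sup>*"
      using kl_path sym_rtrancl symD by fast
    with kl_path show ?thesis
      using that(1) by (elim disjE conjE) (simp_all only:)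
  qed
  have short: "(p False h', p True h') \<in> {(x, y). x \<in> Z \<and> y \<in> Z \<and> dist x y < dist (p False h) (p True h)}"
    if "dist (p False h') (p True h') < dist (p False h) (p True h)" "h' \<in> {k, l}" for h h'
    using that full[of h'] kl by (auto simp: full_def)
  have bad: False if "dist (p False h') (p True h') < dist (p False h) (p True h)"
    "h = k \<and> h' = l \<or> h = l \<and> h' = k" "{p False h, p True h} \<in> MST Z" for h h'
  proof -
    let ?R = "{(x, y). x \<in> Z \<and> y \<in> Z \<and> dist x y < dist (p False h) (p True h)}"
    have "(p False h, p False h') \<in> ?R\<^sup>*" "(p False h', p True h') \<in> ?R" "(p True h', p True h) \<in> ?R\<^sup>*"
      using path[of h h' h False] path[of h' h h True] short[OF that(1)] that(2) by auto
    then have "(p False h, p True h) \<in> ?R\<^sup>*"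
      by (meson rtrancl.rtrancl_into_rtrancl rtrancl_trans)
    then show False
      using MST_no_bypass[OF generic_P Z] that(3) by auto
  qed
  show False
    using bad[of k l] bad[of l k] mst verticals_distinct[of k l] kl by linarith
qed

lemma chord_right_unique:
  assumes "Z \<subseteq> P" "chord Z r s i j" "chord Z r' s' i j'"
  shows "j = j'"
  using chord_gap[OF assms(1,2), of j' s'] chord_gap[OF assms(1,3), of j s] chord_mem[OF assms(1,2)] chord_mem[OF assms(1,3)]
    assms(2,3) by (meson chord_def linorder_neqE_nat)

lemma chord_left_unique:
  assumes "Z \<subseteq> P" "chord Z r s i j" "chord Z r' s' i' j"
  shows "i = i'"
  using chord_gap[OF assms(1,2), of i' r'] chord_gap[OF assms(1,3), of i r] chord_mem[OF assms(1,2)] chord_mem[OF assms(1,3)]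
    assms(2,3) by (meson chord_def linorder_neqE_nat)

text \<open>The gap matters: adjacent full columns may be joined by both unit horizontals. For
  longer chords in different rows both end columns are full, and then the tie rule admits one row
  only.\<close>

lemma chord_unique:
  assumes Z: "Z \<subseteq> P" and c: "chord Z r s i j" "chord Z r' s' i j" and gap: "i + 1 < j"
  shows "r = r' \<and> s = s'"
proof -
  note d = chord_diagonal[OF Z c(1)] chord_diagonal[OF Z c(2)]
  note mem = chord_mem[OF Z c(1)] chord_mem[OF Z c(2)]
  show ?thesis
  proof (cases "r = r'")
    case True
    have "s = s'"
      using d mem True by (cases s; cases s'; cases r) auto
    then show ?thesis using True by simp
  next
    case False
    then have full: "full Z i"
      using mem by (cases r; cases r') (auto simp: full_def all_bool_eq)
    then have rs: "r = s" "r' = s'"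
      using d by (auto simp: full_def)
    then have "full Z j"
      using mem False by (cases r; cases r') (auto simp: full_def all_bool_eq)
    then have "r = even i" "r' = even i"
      using chord_tie[OF Z _ gap full] c rs by auto
    then show ?thesis using False by simp
  qed
qed

end

section \<open>Upper bound: charging crossings to gaps\<close>

lemma interleaved_iff: "interleaved x y u v \<longleftrightarrow>
   ((x < u \<and> u < y \<or> y < u \<and> u < x) \<noteq> (x < v \<and> v < y \<or> y < v \<and> v < x))"
  unfolding interleaved_def by (cases "x \<le> y") auto

context tied_grid
begin

section \<open>Which pairs of edges can cross\<close>

lemma less_pos:
  assumes "1 \<le> i \<and> i \<le> m" "1 \<le> j \<and> j \<le> m"
  shows "pos r i < pos s j \<longleftrightarrow> (if r then s \<and> j < i else s \<or> i < j)"
  using assms by (auto simp: pos_def)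

text \<open>In this form a case distinction on the rows leaves only comparisons of columns.\<close>

lemma interleaved_pos:
  assumes "1 \<le> a \<and> a \<le> m" "1 \<le> b \<and> b \<le> m" "1 \<le> c \<and> c \<le> m" "1 \<le> d \<and> d \<le> m"
  shows "interleaved (pos r a) (pos s b) (pos q c) (pos t d) \<longleftrightarrow>
    (let lt = (\<lambda>r i s j. if r then s \<and> j < i else s \<or> i < j) in
      (lt r a q c \<and> lt q c s b \<or> lt s b q c \<and> lt q c r a) \<noteq>
      (lt r a t d \<and> lt t d s b \<or> lt s b t d \<and> lt t d r a))"
  using assms by (simp only: interleaved_iff less_pos Let_def)

text \<open>The two chords overlap in a single gap, between \<open>b - 1\<close>, the last of the
  columns of \<open>Y\<close> under the first chord, and \<open>b\<close>, the first of the columns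
  of \<open>X\<close> under the second chord.\<close>

definition adjacent_chords :: "pt set \<Rightarrow> pt set \<Rightarrow> bool \<Rightarrow> nat \<Rightarrow> nat \<Rightarrow> nat \<Rightarrow> bool" where
  "adjacent_chords X Y r a b d \<longleftrightarrow> chord X r r a b \<and> chord Y r r (b - 1) d \<and> a + 1 < b \<and>
     (\<forall>k. a < k \<and> k < b \<longrightarrow> full Y k) \<and> (\<forall>k. b \<le> k \<and> k < d \<longrightarrow> full X k)"

lemma full_between:
  assumes "X \<union> Y = P" "chord X r s a b" "a < k" "k < b" "X \<inter> Y = {}"
  shows "full Y k"
proof -
  have "X \<subseteq> P" using assms(1) by blast
  then have "p q k \<notin> X" for q
    using chord_gap assms by blast
  moreover have "p q k \<in> P" for q
    using assms by (intro mem_P) (auto simp: chord_def)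
  ultimately show ?thesis
    using assms(1) by (auto simp: full_def)
qed

lemma chord_row_left:
  assumes "Z \<subseteq> P" "chord Z r s i j" "full Z i"
  shows "s = r"
  using chord_diagonal[OF assms(1,2)] assms(3) by (auto simp: full_def)

lemma chord_row_right:
  assumes "Z \<subseteq> P" "chord Z r s i j" "full Z j"
  shows "s = r"
  using chord_diagonal[OF assms(1,2)] assms(3) by (auto simp: full_def)

text \<open>A column strictly inside both chords would be full in both colours, so two overlapping
  chords share only one gap. Interleaving of the ends in the ring order then fixes their rows:
  either they are the diagonals of a unit square, or they lie in the same row with the second chord
  starting just before the first one ends.\<close>

lemma chords_meet:
  assumes XY: "X \<union> Y = P" "X \<inter> Y = {}"
    and e: "chord X r s a b" and f: "chord Y q t c d" and ac: "a \<le> c"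
    and meet: "convex hull {p r a, p s b} \<inter> convex hull {p q c, p t d} \<noteq> {}"
  shows "(a = c \<and> b = a + 1 \<and> d = a + 1 \<and> s = (\<not> r) \<and> q = (\<not> r) \<and> t = r) \<or>
    (r = s \<and> q = s \<and> t = s \<and> c = b - 1 \<and> adjacent_chords X Y r a b d)"
proof -
  have XP: "X \<subseteq> P" "Y \<subseteq> P" using XY by auto
  have mem: "p r a \<in> X" "p s b \<in> X" "p q c \<in> Y" "p t d \<in> Y"
    using chord_mem[OF XP(1) e] chord_mem[OF XP(2) f] by auto
  have ab: "1 \<le> a" "a < b" "b \<le> m" and cd: "1 \<le> c" "c < d" "d \<le> m"
    using e f by (auto simp: chord_def)
  have ne: "(q, c) \<noteq> (r, a)" "(q, c) \<noteq> (s, b)" "(t, d) \<noteq> (r, a)" "(t, d) \<noteq> (s, b)"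
    using mem XY(2) by auto
  have "interleaved (pos r a) (pos s b) (pos q c) (pos t d)"
    by (rule cross_interleaved) (use ab cd ne meet in auto)
  moreover have "1 \<le> a \<and> a \<le> m" "1 \<le> b \<and> b \<le> m" "1 \<le> c \<and> c \<le> m" "1 \<le> d \<and> d \<le> m"
    using ab cd by auto
  ultimately have il: "(let lt = (\<lambda>r i s j. if r then s \<and> j < i else s \<or> i < j) in
      (lt r a q c \<and> lt q c s b \<or> lt s b q c \<and> lt q c r a) \<noteq>
      (lt r a t d \<and> lt t d s b \<or> lt s b t d \<and> lt t d r a))"
    by (simp only: interleaved_pos)
  have Yk: "full Y k" if "a < k" "k < b" for k
    using full_between[OF XY(1) e that XY(2)] .
  have Xk: "full X k" if "c < k" "k < d" for k
    using full_between[of Y X q t c d k] f that XY by (simp add: Un_commute Int_commute)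
  have no: "\<not> (full X k \<and> full Y k)" for k
  proof
    assume "full X k \<and> full Y k"
    then have "p True k \<in> X \<inter> Y"
      unfolding full_def by simp
    then show False
      using XY(2) by simp
  qed
  have "c < b"
  proof (rule ccontr)
    assume "\<not> c < b"
    then show False
      using il ab cd ne
      by (cases r; cases s; cases q; cases t; simp)
  qed
  show ?thesis
  proof (cases "a = c")
    case True
    then have q: "q = (\<not> r)" using ne by auto
    consider "b < d" | "d < b" | "b = d" by linarith
    then show ?thesis
    proof cases
      case 1
      then have "full X b" using Xk \<open>c < b\<close> by simp
      then have s: "s = r" using chord_row_right[OF XP(1) e] by simp
      have "b = a + 1"
      proof (rule ccontr)
        assume "b \<noteq> a + 1"
        then show False using Yk[of "a + 1"] Xk[of "a + 1"] no ab 1 True by auto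
      qed
      then have False
        using il ab cd q s True 1
        by (cases r; cases t; simp)
      then show ?thesis ..
    next
      case 2
      then have "full Y d" using Yk True cd by simp
      then have t: "t = q" using chord_row_right[OF XP(2) f] by simp
      have "d = a + 1"
      proof (rule ccontr)
        assume "d \<noteq> a + 1"
        then show False using Yk[of "a + 1"] Xk[of "a + 1"] no cd 2 True by auto
      qed
      then have False
        using il ab cd q t True 2
        by (cases r; cases s; simp)
      then show ?thesis ..
    next
      case 3
      have b: "b = a + 1"
      proof (rule ccontr)
        assume "b \<noteq> a + 1"
        then show False using Yk[of "a + 1"] Xk[of "a + 1"] no ab 3 True by auto
      qed
      have t: "t = (\<not> s)" using ne 3 by auto
      have "s \<noteq> r"
      proof
        assume "s = r"
        then show False
          using il ab q t b True 3
          by (cases r; simp)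
      qed
      then show ?thesis using True 3 b q t by (cases r; cases s) auto
    qed
  next
    case False
    then have "a < c" using ac by simp
    then have Yc: "full Y c" using Yk \<open>c < b\<close> by simp
    then have t: "t = q" using chord_row_left[OF XP(2) f] by simp
    consider "d < b" | "d = b" | "b < d" by linarith
    then show ?thesis
    proof cases
      case 1
      have "d = c + 1"
      proof (rule ccontr)
        assume "d \<noteq> c + 1"
        then show False using Yk[of "c + 1"] Xk[of "c + 1"] no cd 1 \<open>a < c\<close> by auto
      qed
      then have False
        using il ab cd t 1 \<open>a < c\<close>
        by (cases r; cases s; cases q; simp)
      then show ?thesis ..
    next
      case 2
      have "d = c + 1"
      proof (rule ccontr)
        assume "d \<noteq> c + 1"
        then show False using Yk[of "c + 1"] Xk[of "c + 1"] no cd 2 \<open>a < c\<close> by auto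
      qed
      moreover have "s = (\<not> t)" using ne 2 by auto
      ultimately have False
        using il ab cd t 2 \<open>a < c\<close>
        by (cases r; cases q; simp)
      then show ?thesis ..
    next
      case 3
      have "full X b" using Xk 3 \<open>c < b\<close> by simp
      then have s: "s = r" using chord_row_right[OF XP(1) e] by simp
      have c: "c = b - 1"
      proof (rule ccontr)
        assume "c \<noteq> b - 1"
        then have "c + 1 < b" using \<open>c < b\<close> by linarith
        then show False
          using Yk[of "c + 1"] Xk[of "c + 1"] no[of "c + 1"] 3 \<open>a < c\<close> by simp
      qed
      have "q = r"
      proof (rule ccontr)
        assume "q \<noteq> r"
        then show False
          using il ab cd t s c 3 \<open>a < c\<close>
          by (cases r; cases q; simp)
      qed
      moreover have "adjacent_chords X Y r a b d"
        unfolding adjacent_chords_def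
        using e f s t c \<open>q = r\<close> \<open>a < c\<close> Yk Xk \<open>full X b\<close> by auto
      ultimately show ?thesis using s t c by auto
    qed
  qed
qed

definition crossed_vertical :: "pt set \<Rightarrow> pt set \<Rightarrow> nat \<Rightarrow> pt set \<Rightarrow> pt set \<Rightarrow> bool" where
  "crossed_vertical X Y g e f \<longleftrightarrow> (\<exists>k r s b. g < k \<and> k < b \<and> e = {p False k, p True k} \<and> e \<in> MST X \<and>
     f = {p r g, p s b} \<and> chord Y r s g b \<and> (\<forall>i. g < i \<and> i < b \<longrightarrow> full X i))"

lemma vertical_chord_meet:
  assumes XY: "X \<union> Y = P" "X \<inter> Y = {}"
    and k: "1 \<le> k" "k \<le> m" "full X k" "{p False k, p True k} \<in> MST X" and f: "chord Y q t c d"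
    and meet: "convex hull {p False k, p True k} \<inter> convex hull {p q c, p t d} \<noteq> {}"
  shows "crossed_vertical X Y c {p False k, p True k} {p q c, p t d}"
proof -
  have YP: "Y \<subseteq> P" using XY by auto
  have mem: "p q c \<in> Y" "p t d \<in> Y"
    using chord_mem[OF YP f] by auto
  have cd: "1 \<le> c" "c < d" "d \<le> m"
    using f by (auto simp: chord_def)
  have ne: "c \<noteq> k" "d \<noteq> k"
    using mem k(3) XY(2) by (auto simp: full_def)
  have "interleaved (pos False k) (pos True k) (pos q c) (pos t d)"
    by (rule cross_interleaved) (use k cd ne meet in auto)
  moreover have "1 \<le> k \<and> k \<le> m" "1 \<le> c \<and> c \<le> m" "1 \<le> d \<and> d \<le> m"
    using k cd by auto
  ultimately have "(k < c) \<noteq> (k < d)"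
    using ne by (cases q; cases t) (auto simp: interleaved_pos)
  then have "c < k" "k < d"
    using cd ne by auto
  moreover have "full X i" if "c < i" "i < d" for i
    using full_between[of Y X q t c d i] f that XY by (simp add: Un_commute Int_commute)
  ultimately show ?thesis
    unfolding crossed_vertical_def using k f by blast
qed

lemma verticals_disjoint:
  assumes "1 \<le> k" "k \<le> m" "1 \<le> l" "l \<le> m" "k \<noteq> l"
  shows "convex hull {p False k, p True k} \<inter> convex hull {p False l, p True l} = {}"
proof (rule ccontr)
  assume "\<not> ?thesis"
  then have "interleaved (pos False k) (pos True k) (pos False l) (pos True l)"
    by (intro cross_interleaved) (use assms in auto)
  moreover have "1 \<le> k \<and> k \<le> m" "1 \<le> l \<and> l \<le> m"
    using assms by auto
  ultimately show False
    using assms by (auto simp: interleaved_pos)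
qed

section \<open>Keys of crossings and their uniqueness\<close>

definition column_type :: "pt set \<Rightarrow> pt set \<Rightarrow> nat \<Rightarrow> nat" where
  "column_type X Y i = (if full X i then 1 else if full Y i then 2 else 0)"

text \<open>The pair is ordered: \<open>X\<close> owns the vertical, the chord further left, or the
  diagonal starting in the bottom row. The other order is covered by \<open>charge Y X\<close>. For
  adjacent chords, \<open>b = g + 2\<close> charges the gap just before column
  \<open>b - 1\<close>.\<close>

definition charge :: "pt set \<Rightarrow> pt set \<Rightarrow> nat \<times> nat \<Rightarrow> pt set \<Rightarrow> pt set \<Rightarrow> bool" where
  "charge X Y k e f \<longleftrightarrow> (case k of (g, t) \<Rightarrow>
     (t = 0 \<and> p False g \<in> X \<and> e = {p False g, p True (g + 1)} \<and> f = {p True g, p False (g + 1)}) \<or>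
     (t = 1 \<and> crossed_vertical X Y g e f) \<or>
     (\<exists>r a b d. adjacent_chords X Y r a b d \<and> e = {p r a, p r b} \<and> f = {p r (b - 1), p r d} \<and>
       (t = 2 \<and> b = g + 2 \<or> t = 3 \<and> d = g + 1 \<or> t = 4 \<and> a = g)))"

lemma adjacent_chords_cols:
  assumes XY: "X \<union> Y = P" "X \<inter> Y = {}" and adj: "adjacent_chords X Y r a b d"
  shows "1 \<le> a" "a + 1 < b" "b < d" "d \<le> m" "full Y (a + 1)" "full Y (b - 1)" "full X b" "full X (d - 1)"
    "p r a \<in> X" "p r d \<in> Y"
proof -
  have c: "chord X r r a b" "chord Y r r (b - 1) d"
    using adj by (auto simp: adjacent_chords_def)
  have mem: "p r a \<in> X" "p r b \<in> X" "p r d \<in> Y"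
    using chord_mem[OF _ c(1)] chord_mem[OF _ c(2)] XY(1) by auto
  then show "p r a \<in> X" "p r d \<in> Y" by auto
  show "1 \<le> a" "a + 1 < b" "d \<le> m" "full Y (b - 1)" "full Y (a + 1)"
    using adj by (auto simp: adjacent_chords_def chord_def)
  have "b \<noteq> d" using mem XY(2) by auto
  moreover have "b - 1 < d" using c(2) by (auto simp: chord_def)
  ultimately show "b < d" by simp
  then show "full X (d - 1)" "full X b"
    using adj by (auto simp: adjacent_chords_def)
qed

text \<open>A column has chords to at most one column on its right and at most one on its left, so
  each of \<open>a\<close>, \<open>b\<close>, \<open>d\<close> determines the other two;
  \<open>chord_unique\<close> then fixes the row.\<close>

lemma adjacent_chords_unique:
  assumes XY: "X \<union> Y = P" "X \<inter> Y = {}"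
    and 1: "adjacent_chords X Y r a b d" and 2: "adjacent_chords X Y r' a' b' d'"
    and same: "b = b' \<or> d = d' \<or> a = a'"
  shows "r = r' \<and> a = a' \<and> b = b' \<and> d = d'"
proof -
  have P: "X \<subseteq> P" "Y \<subseteq> P" using XY by auto
  have c: "chord X r r a b" "chord Y r r (b - 1) d" "chord X r' r' a' b'" "chord Y r' r' (b' - 1) d'"
    using 1 2 by (auto simp: adjacent_chords_def)
  note cols = adjacent_chords_cols[OF XY 1] adjacent_chords_cols[OF XY 2]
  have b: "b = b'"
    using same
  proof (elim disjE)
    assume "d = d'"
    then have "b - 1 = b' - 1"
      using chord_left_unique[OF P(2) c(2)] c(4) by simp
    then show ?thesis using cols by linarith
  next
    assume "a = a'"
    then show ?thesis
      using chord_right_unique[OF P(1) c(1)] c(3) by simp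
  qed
  have a: "a = a'"
    using chord_left_unique[OF P(1) c(1)] c(3) b by simp
  have "d = d'"
    using chord_right_unique[OF P(2) c(2)] c(4) b by simp
  moreover have "r = r'"
    using chord_unique[OF P(1) c(1), of r' r'] c(3) a b cols by simp
  ultimately show ?thesis using a b by simp
qed

text \<open>The left column determines the chord, and the run under it contains at most one
  vertical.\<close>

lemma crossed_vertical_unique:
  assumes XY: "X \<union> Y = P" "X \<inter> Y = {}"
    and 1: "crossed_vertical X Y g e f" and 2: "crossed_vertical X Y g e' f'"
  shows "e = e' \<and> f = f'"
proof -
  have P: "X \<subseteq> P" "Y \<subseteq> P" using XY by auto
  obtain k r s b where k: "g < k" "k < b" "e = {p False k, p True k}" "e \<in> MST X"
     "f = {p r g, p s b}" "chord Y r s g b" "\<And>i. g < i \<Longrightarrow> i < b \<Longrightarrow> full X i"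
    using 1 unfolding crossed_vertical_def by blast
  obtain k' r' s' b' where k': "g < k'" "k' < b'" "e' = {p False k', p True k'}" "e' \<in> MST X"
     "f' = {p r' g, p s' b'}" "chord Y r' s' g b'" "\<And>i. g < i \<Longrightarrow> i < b' \<Longrightarrow> full X i"
    using 2 unfolding crossed_vertical_def by blast
  have b: "b = b'"
    using chord_right_unique[OF P(2) k(6) k'(6)] .
  have "r = r' \<and> s = s'"
    using chord_unique[OF P(2) k(6), of r' s'] k'(6) b k by simp
  moreover have "b \<le> m"
    using k(6) by (simp add: chord_def)
  then have "\<not> k < k'" "\<not> k' < k"
    using vertical_unique[OF P(1), of k k'] vertical_unique[OF P(1), of k' k] k k' b by force+
  ultimately show ?thesis
    using k k' b by simp
qed

lemma charge_unique:
  assumes XY: "X \<union> Y = P" "X \<inter> Y = {}" and 1: "charge X Y k e f" and 2: "charge X Y k e' f'"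
  shows "e = e' \<and> f = f'"
proof -
  obtain g t where k: "k = (g, t)" by (cases k)
  consider "t = 0" | "t = 1" | "t \<ge> 2" by linarith
  then show ?thesis
  proof cases
    case 1
    then show ?thesis using assms(3,4) by (auto simp: charge_def k)
  next
    case 2
    then show ?thesis
      using crossed_vertical_unique[OF XY, of g e f e' f'] assms(3,4) by (auto simp: charge_def k)
  next
    case 3
    obtain r a b d where c: "adjacent_chords X Y r a b d" "e = {p r a, p r b}" "f = {p r (b - 1), p r d}"
       "t = 2 \<and> b = g + 2 \<or> t = 3 \<and> d = g + 1 \<or> t = 4 \<and> a = g"
      using 1 3 unfolding charge_def k by auto
    obtain r' a' b' d' where c': "adjacent_chords X Y r' a' b' d'" "e' = {p r' a', p r' b'}" "f' = {p r' (b' - 1), p r' d'}"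
       "t = 2 \<and> b' = g + 2 \<or> t = 3 \<and> d' = g + 1 \<or> t = 4 \<and> a' = g"
      using 2 3 unfolding charge_def k by auto
    have "b = b' \<or> d = d' \<or> a = a'"
      using c(4) c'(4) by auto
    then have "r = r' \<and> a = a' \<and> b = b' \<and> d = d'"
      by (rule adjacent_chords_unique[OF XY c(1) c'(1)])
    then show ?thesis
      using c(2,3) c'(2,3) by simp
  qed
qed

text \<open>For two diagonals the key tells the colour of \<open>p False g\<close>. For each other
  kind it names a column that is full in the first colour: \<open>g + 1\<close>, \<open>b\<close>,
  \<open>d - 1\<close> or \<open>a + 1\<close>.\<close>

lemma charge_not_swapped:
  assumes XY: "X \<union> Y = P" "X \<inter> Y = {}" and 1: "charge X Y k e f" and 2: "charge Y X k e' f'"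
  shows False
proof -
  obtain g t where k: "k = (g, t)" by (cases k)
  have no: "\<not> (full X i \<and> full Y i)" for i
    using XY(2) unfolding full_def by blast
  have YX: "Y \<union> X = P" "Y \<inter> X = {}" using XY by auto
  consider "t = 0" | "t = 1" | "t \<ge> 2" by linarith
  then show ?thesis
  proof cases
    case 1
    then show ?thesis using assms by (auto simp: charge_def k)
  next
    case 2
    then have "crossed_vertical X Y g e f" "crossed_vertical Y X g e' f'"
      using assms(3,4) by (auto simp: charge_def k)
    then have "full X (g + 1)" "full Y (g + 1)"
      unfolding crossed_vertical_def by force+
    then show ?thesis using no by blast
  next
    case 3
    obtain r a b d where c: "adjacent_chords X Y r a b d"
       "t = 2 \<and> b = g + 2 \<or> t = 3 \<and> d = g + 1 \<or> t = 4 \<and> a = g"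
      using 1 3 unfolding charge_def k by auto
    obtain r' a' b' d' where c': "adjacent_chords Y X r' a' b' d'"
       "t = 2 \<and> b' = g + 2 \<or> t = 3 \<and> d' = g + 1 \<or> t = 4 \<and> a' = g"
      using 2 3 unfolding charge_def k by auto
    note cols = adjacent_chords_cols[OF XY c(1)] and cols' = adjacent_chords_cols[OF YX c'(1)]
    from c(2) show ?thesis
    proof (elim disjE conjE)
      assume "t = 2" "b = g + 2"
      then have "b = b'" using c'(2) by simp
      then show ?thesis using cols(7) cols'(7) no[of b] by simp
    next
      assume "t = 3" "d = g + 1"
      then have "d = d'" using c'(2) by simp
      then show ?thesis using cols(8) cols'(8) no[of "d - 1"] by simp
    next
      assume "t = 4" "a = g"
      then have "a = a'" using c'(2) by simp
      then show ?thesis using cols(5) cols'(5) no[of "a + 1"] by simp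
    qed
  qed
qed

abbreviation keys :: "pt set \<Rightarrow> pt set \<Rightarrow> (nat \<times> nat) set" where
  "keys X Y \<equiv> crossing_keys m (column_type X Y)"

text \<open>Exchanging the colours swaps types 1 and 2, and keys depend only on type 0 and on
  equality of types.\<close>

lemma keys_swap: "X \<inter> Y = {} \<Longrightarrow> keys Y X = keys X Y"
proof -
  assume "X \<inter> Y = {}"
  then have "\<not> (full X i \<and> full Y i)" for i
    by (auto simp: full_def)
  then have *: "column_type Y X i = 0 \<longleftrightarrow> column_type X Y i = 0"
    "column_type Y X i = column_type Y X j \<longleftrightarrow> column_type X Y i = column_type X Y j" for i j
    by (auto simp: column_type_def)
  show ?thesis
    unfolding crossing_keys_def by (simp only: *)
qed

text \<open>If column \<open>d\<close> is bichromatic, the gap before it takes the charge. If not,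
  but \<open>a\<close> is bichromatic, then columns \<open>a + 1\<close> to \<open>d\<close> are
  monochromatic and include \<open>a + 3\<close>, which permits the extra charge. Otherwise both
  chords obey the tie rule.\<close>

lemma adjacent_chords_charge:
  assumes XY: "X \<union> Y = P" "X \<inter> Y = {}" and adj: "adjacent_chords X Y r a b d"
  shows "\<exists>k\<in>keys X Y. charge X Y k {p r a, p r b} {p r (b - 1), p r d}"
proof -
  note cols = adjacent_chords_cols[OF XY adj]
  have no: "\<not> (full X i \<and> full Y i)" for i
    using XY(2) unfolding full_def by blast
  have Yk: "full Y k" if "a < k" "k < b" for k
    using that adj by (auto simp: adjacent_chords_def)
  have Xk: "full X k" if "b \<le> k" "k < d" for k
    using that adj by (auto simp: adjacent_chords_def)
  have a: "\<not> full Y a" and d: "\<not> full X d"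
    using cols(9,10) XY(2) by (auto simp: full_def)
  consider "\<not> full Y d" | "\<not> full X a" "full Y d" | "full X a" "full Y d" by blast
  then show ?thesis
  proof cases
    case 1
    have "(d - 1, 3) \<in> keys X Y"
      using 1 d cols by (auto simp: crossing_keys_def column_type_def)
    moreover have "charge X Y (d - 1, 3) {p r a, p r b} {p r (b - 1), p r d}"
      unfolding charge_def using adj cols by auto
    ultimately show ?thesis by blast
  next
    case 2
    have "column_type X Y k \<noteq> 0" if "a < k" "k \<le> d" for k
      using that Yk[of k] Xk[of k] 2 unfolding column_type_def by (cases "k < b"; cases "k = d") auto
    then have "(a, 4) \<in> keys X Y"
      using 2 a cols by (auto simp: crossing_keys_def) (auto simp: column_type_def)
    moreover have "charge X Y (a, 4) {p r a, p r b} {p r (b - 1), p r d}"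
      unfolding charge_def using adj cols by auto
    ultimately show ?thesis by blast
  next
    case 3
    have P: "X \<subseteq> P" "Y \<subseteq> P" using XY by auto
    have "r = even a"
      using chord_tie[OF P(1), of r a b] adj cols 3 by (auto simp: adjacent_chords_def)
    moreover have "r = even (b - 1)"
      using chord_tie[OF P(2), of r "b - 1" d] adj cols 3 by (auto simp: adjacent_chords_def)
    \<comment> \<open>The columns \<open>a\<close> and \<open>b - 1\<close> have equal parity, so at
      least two columns lie strictly between \<open>a\<close> and \<open>b\<close>, and the gap
      after column \<open>b - 2\<close> is inside their run.\<close>
    ultimately have "b \<noteq> a + 2" by auto
    then have "full Y (b - 2)" "full Y (b - 1)" "1 \<le> b - 2" "Suc (b - 2) = b - 1" "b - 2 < m"
      using Yk[of "b - 2"] cols by auto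
    then have "(b - 2, 2) \<in> keys X Y"
      using no by (auto simp: crossing_keys_def column_type_def)
    moreover have "charge X Y (b - 2, 2) {p r a, p r b} {p r (b - 1), p r d}"
    proof -
      have "b = b - 2 + 2" using cols(2) by linarith
      then have "adjacent_chords X Y r a b d \<and> {p r a, p r b} = {p r a, p r b} \<and>
          {p r (b - 1), p r d} = {p r (b - 1), p r d} \<and> ((2::nat) = 2 \<and> b = b - 2 + 2 \<or> (2::nat) = 3 \<and> d = b - 2 + 1 \<or> (2::nat) = 4 \<and> a = b - 2)"
        using adj by simp
      then show ?thesis
        unfolding charge_def prod.case by blast
    qed
    ultimately show ?thesis by blast
  qed
qed

lemma crossed_vertical_charge:
  assumes XY: "X \<union> Y = P" "X \<inter> Y = {}" and cv: "crossed_vertical X Y g e f"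
  shows "\<exists>k\<in>keys X Y. charge X Y k e f"
proof -
  obtain k r s b where k: "g < k" "k < b" "chord Y r s g b" "\<And>i. g < i \<Longrightarrow> i < b \<Longrightarrow> full X i"
    using cv unfolding crossed_vertical_def by blast
  have "\<not> full X g" "\<not> full X b"
    using chord_mem[OF _ k(3)] XY by (auto simp: full_def)
  moreover have "full X (g + 1)" using k by simp
  ultimately have "column_type X Y (g + 1) = 1" "column_type X Y g \<noteq> 1" "column_type X Y b \<noteq> 1"
    by (simp_all add: column_type_def)
  moreover have "1 \<le> g" "g < m" "g + 1 < b" "b \<le> m"
    using k(1,2,3) by (auto simp: chord_def)
  ultimately have "(g, 1) \<in> keys X Y"
    unfolding crossing_keys_def by auto
  then show ?thesis
    using cv unfolding charge_def by (intro bexI[of _ "(g, 1)"]) auto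
qed

lemma diagonals_charge:
  assumes XY: "X \<union> Y = P" "X \<inter> Y = {}" and a: "1 \<le> a" "a < m"
    and mem: "p r a \<in> X" "p (\<not> r) (a + 1) \<in> X" "p (\<not> r) a \<in> Y" "p r (a + 1) \<in> Y"
    and e: "e = {p r a, p (\<not> r) (a + 1)}" "f = {p (\<not> r) a, p r (a + 1)}"
  shows "\<exists>k\<in>keys X Y. charge X Y k e f \<or> charge Y X k f e"
proof
  have "\<not> full X a" "\<not> full Y a" "\<not> full X (a + 1)" "\<not> full Y (a + 1)"
    using mem XY(2) by (auto simp: full_def)
  then show "(a, 0) \<in> keys X Y"
    using a by (auto simp: crossing_keys_def column_type_def)
  show "charge X Y (a, 0) e f \<or> charge Y X (a, 0) f e"
    using mem unfolding charge_def e by (cases r) auto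
qed

lemma chords_charge:
  assumes XY: "X \<union> Y = P" "X \<inter> Y = {}"
    and e: "chord X r s a b" and f: "chord Y q t c d" and ac: "a \<le> c"
    and meet: "convex hull {p r a, p s b} \<inter> convex hull {p q c, p t d} \<noteq> {}"
  shows "\<exists>k\<in>keys X Y. charge X Y k {p r a, p s b} {p q c, p t d} \<or> charge Y X k {p q c, p t d} {p r a, p s b}"
  using chords_meet[OF assms]
proof (elim disjE conjE)
  assume "a = c" "b = a + 1" "d = a + 1" "s = (\<not> r)" "q = (\<not> r)" "t = r"
  then show ?thesis
    using chord_mem[OF _ e] chord_mem[OF _ f] XY e
    by (intro diagonals_charge[OF XY, of a r]) (auto simp: chord_def)
next
  assume "r = s" "q = s" "t = s" "c = b - 1" "adjacent_chords X Y r a b d"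
  then show ?thesis
    using adjacent_chords_charge[OF XY, of r a b d] by auto
qed

lemma crossing_charge:
  assumes XY: "X \<union> Y = P" "X \<inter> Y = {}" and e: "e \<in> MST X" and f: "f \<in> MST Y"
    and meet: "convex hull e \<inter> convex hull f \<noteq> {}"
  shows "\<exists>k\<in>keys X Y. charge X Y k e f \<or> charge Y X k f e"
proof -
  have P: "X \<subseteq> P" "Y \<subseteq> P" and YX: "Y \<union> X = P" "Y \<inter> X = {}"
    using XY by auto
  have meet': "convex hull f \<inter> convex hull e \<noteq> {}"
    using meet by (simp add: Int_commute)
  show ?thesis
  proof (rule edge_cases[OF P(1) e])
    fix i assume i: "1 \<le> i" "i \<le> m" "full X i" "e = {p False i, p True i}"
    show ?thesis
    proof (rule edge_cases[OF P(2) f])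
      fix j assume j: "1 \<le> j" "j \<le> m" "full Y j" "f = {p False j, p True j}"
      have "i \<noteq> j" using i j XY(2) by (auto simp: full_def)
      then show ?thesis using verticals_disjoint[of i j] i j meet by simp
    next
      fix r s a b assume c: "chord Y r s a b" "f = {p r a, p s b}"
      have "crossed_vertical X Y a e f"
        unfolding i(4) c(2)
        by (rule vertical_chord_meet[OF XY i(1,2,3) _ c(1)]) (use e meet i(4) c(2) in auto)
      then show ?thesis using crossed_vertical_charge[OF XY] by blast
    qed
  next
    fix r s a b assume c: "chord X r s a b" "e = {p r a, p s b}"
    show ?thesis
    proof (rule edge_cases[OF P(2) f])
      fix i assume i: "1 \<le> i" "i \<le> m" "full Y i" "f = {p False i, p True i}"
      have "crossed_vertical Y X a f e"
        unfolding i(4) c(2)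
        by (rule vertical_chord_meet[OF YX i(1,2,3) _ c(1)]) (use f meet' i(4) c(2) in auto)
      then show ?thesis using crossed_vertical_charge[OF YX] keys_swap[OF XY(2)] by blast
    next
      fix r' s' a' b' assume c': "chord Y r' s' a' b'" "f = {p r' a', p s' b'}"
      show ?thesis
      proof (cases "a \<le> a'")
        case True
        then show ?thesis
          using chords_charge[OF XY c(1) c'(1)] meet unfolding c(2) c'(2) by blast
      next
        case False
        then have "a' \<le> a" by simp
        then show ?thesis
          using chords_charge[OF YX c'(1) c(1)] meet' keys_swap[OF XY(2)] unfolding c(2) c'(2) by blast
      qed
    qed
  qed
qed

lemma cr_pair_upper:
  assumes X: "X \<subseteq> P"
  shows "cr_pair X (P - X) \<le> (m - 1) + (m - 1) div 4"
proof -
  have XY: "X \<union> (P - X) = P" "X \<inter> (P - X) = {}" and YX: "(P - X) \<union> X = P" "(P - X) \<inter> X = {}"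
    using X by auto
  let ?R = "\<lambda>k (e, f). charge X (P - X) k e f \<or> charge (P - X) X k f e"
  have "cr_pair X (P - X) \<le> card (keys X (P - X))"
    unfolding cr_pair_def
  proof (rule card_le_keys[OF finite_crossing_keys, where R = ?R])
    fix c assume "c \<in> {(e, f). e \<in> MST X \<and> f \<in> MST (P - X) \<and> convex hull e \<inter> convex hull f \<noteq> {}}"
    then show "\<exists>k\<in>keys X (P - X). ?R k c"
      using crossing_charge[OF XY] by (cases c) blast
  next
    fix k c c' assume R: "?R k c" "?R k c'"
    obtain e f e' f' where c: "c = (e, f)" "c' = (e', f')"
      by (cases c, cases c')
    consider "charge X (P - X) k e f" "charge X (P - X) k e' f'"
      | "charge (P - X) X k f e" "charge (P - X) X k f' e'"
      | "charge X (P - X) k e f" "charge (P - X) X k f' e'"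
      | "charge (P - X) X k f e" "charge X (P - X) k e' f'"
      using R unfolding c prod.case by blast
    then show "c = c'"
    proof cases
      case 1
      then show ?thesis using charge_unique[OF XY 1] c by simp
    next
      case 2
      then show ?thesis using charge_unique[OF YX 2] c by simp
    next
      case 3
      then show ?thesis using charge_not_swapped[OF XY 3] by simp
    next
      case 4
      then show ?thesis using charge_not_swapped[OF YX 4] by simp
    qed
  qed
  also have "\<dots> \<le> (m - 1) + (m - 1) div 4"
    by (rule card_crossing_keys)
  finally show ?thesis .
qed

lemma cr_upper: "cr P \<le> (m - 1) + (m - 1) div 4"
proof -
  have "finite P"
    using generic_P by (simp add: generic_def)
  moreover have "{cr_pair R (P - R) | R. R \<subseteq> P} = (\<lambda>R. cr_pair R (P - R)) ` Pow P"
    by auto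
  ultimately show ?thesis
    unfolding cr_def using cr_pair_upper by (subst Max_le_iff) auto
qed

end

section \<open>Oriented point sets and perturbations\<close>

text \<open>With at least three points, the line through the two cyclic neighbours of a point has
  that point strictly on one side and all others on the other side or on the line. The three cases
  below account for the wrap-around at the indices 1 and \<open>N\<close>.\<close>

lemma convex_position_oriented:
  fixes x :: "nat \<Rightarrow> pt"
  assumes pos: "\<And>i j k. 1 \<le> i \<Longrightarrow> i < j \<Longrightarrow> j < k \<Longrightarrow> k \<le> N \<Longrightarrow> orient (x i) (x j) (x k) > 0"
    and inj: "inj_on x {1..N}"
  shows "convex_position (x ` {1..N})"
  unfolding convex_position_def
proof
  fix p assume "p \<in> x ` {1..N}"
  then obtain i where i: "1 \<le> i" "i \<le> N" "p = x i" by auto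
  have others: "x ` {1..N} - {p} \<subseteq> x ` ({1..N} - {i})"
    using i by auto
  show "p \<notin> convex hull (x ` {1..N} - {p})"
  proof (cases "N \<le> 2")
    case True
    then have "{1..N} - {i} \<subseteq> {3 - i}" using i by auto
    then have "x ` {1..N} - {p} \<subseteq> {x (3 - i)}"
      using others by blast
    then have sub: "x ` {1..N} - {p} \<subseteq> {x (3 - i)} - {p}"
      by blast
    show ?thesis
    proof (cases "x (3 - i) = p")
      case True
      then have "x ` {1..N} - {p} = {}" using sub by blast
      then show ?thesis by (simp only: convex_hull_empty empty_iff not_False_eq_True)
    next
      case False
      have "convex hull (x ` {1..N} - {p}) \<subseteq> {x (3 - i)}"
        by (intro hull_minimal) (use sub in auto)
      then show ?thesis using False by auto
    qed
  next
    case False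
    have "\<exists>a b. orient a b p < 0 \<and> (\<forall>j\<in>{1..N} - {i}. orient a b (x j) \<ge> 0)"
    proof -
      consider "i = 1" | "1 < i" "i < N" | "i = N" "1 < i" using i by linarith
      then show ?thesis
      proof cases
        case 1
        have "orient (x N) (x 2) p < 0"
          using pos[of 1 2 N] False i 1 orient_swap[of "x N" "x 2" p] orient_rotate[of "x 2" "x N" p] by simp
        moreover have "orient (x N) (x 2) (x j) \<ge> 0" if j: "j \<in> {1..N} - {i}" for j
        proof -
          consider "j = 2" | "j = N" | "2 < j" "j < N" using j 1 False by force
          then show ?thesis
            using pos[of 2 j N] orient_rotate[of "x 2" "x j" "x N"] by cases auto
        qed
        ultimately show ?thesis by blast
      next
        case 2
        have "orient (x (i - 1)) (x (i + 1)) p < 0"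
          using pos[of "i - 1" i "i + 1"] 2 i orient_swap2[of "x (i - 1)" "x (i + 1)" p] by simp
        moreover have "orient (x (i - 1)) (x (i + 1)) (x j) \<ge> 0" if j: "j \<in> {1..N} - {i}" for j
        proof -
          consider "j = i - 1" | "j = i + 1" | "j < i - 1" | "i + 1 < j" using j 2 by force
          then show ?thesis
          proof cases
            case 3
            then have "orient (x j) (x (i - 1)) (x (i + 1)) > 0"
              using 2 j by (intro pos) auto
            then show ?thesis
              using orient_rotate[of "x (i - 1)" "x (i + 1)" "x j"] by linarith
          next
            case 4
            then have "orient (x (i - 1)) (x (i + 1)) (x j) > 0"
              using \<open>1 < i\<close> j by (intro pos) auto
            then show ?thesis by linarith
          qed simp_all
        qed
        ultimately show ?thesis by blast
      next
        case 3
        have "orient (x (N - 1)) (x 1) p < 0"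
          using pos[of 1 "N - 1" N] False i 3 orient_swap[of "x (N - 1)" "x 1" p] by simp
        moreover have "orient (x (N - 1)) (x 1) (x j) \<ge> 0" if j: "j \<in> {1..N} - {i}" for j
        proof -
          consider "j = 1" | "j = N - 1" | "1 < j" "j < N - 1" using j 3 False by force
          then show ?thesis
            using pos[of 1 j "N - 1"] orient_rotate[of "x 1" "x j" "x (N - 1)"] by cases auto
        qed
        ultimately show ?thesis by blast
      qed
    qed
    then obtain a b where ab: "orient a b p < 0" "\<forall>j\<in>{1..N} - {i}. orient a b (x j) \<ge> 0"
      by blast
    have "x ` ({1..N} - {i}) \<subseteq> {q. orient a b q \<ge> 0}"
      using ab(2) by (simp add: image_subset_iff)
    then have "convex hull (x ` {1..N} - {p}) \<subseteq> {q. orient a b q \<ge> 0}"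
      by (intro hull_minimal convex_orient_nonneg subset_trans[OF others])
    then show ?thesis using ab(1) by auto
  qed
qed

lemma collinear_orient: "collinear {a, b, c} \<Longrightarrow> orient a b c = 0"
proof -
  assume "collinear {a, b, c}"
  then obtain u where u: "\<And>x y. x \<in> {a, b, c} \<Longrightarrow> y \<in> {a, b, c} \<Longrightarrow> \<exists>k. x - y = k *\<^sub>R u"
    unfolding collinear_def by blast
  obtain k l where "b - a = k *\<^sub>R u" "c - a = l *\<^sub>R u"
    using u[of b a] u[of c a] by blast
  then have "fst b - fst a = k * fst u" "snd b - snd a = k * snd u" "fst c - fst a = l * fst u" "snd c - snd a = l * snd u"
    by (metis fst_diff fst_scaleR real_scaleR_def, metis snd_diff snd_scaleR real_scaleR_def,
        metis fst_diff fst_scaleR real_scaleR_def, metis snd_diff snd_scaleR real_scaleR_def)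
  then show ?thesis
    by (simp add: orient_def)
qed

lemma general_position_oriented:
  fixes x :: "nat \<Rightarrow> pt"
  assumes pos: "\<And>i j k. 1 \<le> i \<Longrightarrow> i < j \<Longrightarrow> j < k \<Longrightarrow> k \<le> N \<Longrightarrow> orient (x i) (x j) (x k) > 0"
  shows "general_position (x ` {1..N})"
  unfolding general_position_def
proof (intro ballI impI)
  fix a b c assume abc: "a \<in> x ` {1..N}" "b \<in> x ` {1..N}" "c \<in> x ` {1..N}" "a \<noteq> b \<and> a \<noteq> c \<and> b \<noteq> c"
  obtain i where i: "1 \<le> i" "i \<le> N" "a = x i" using abc(1) by auto
  obtain j where j: "1 \<le> j" "j \<le> N" "b = x j" using abc(2) by auto
  obtain k where k: "1 \<le> k" "k \<le> N" "c = x k" using abc(3) by auto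
  have ne: "i \<noteq> j" "i \<noteq> k" "j \<noteq> k" using abc(4) i j k by auto
  have "orient a b c \<noteq> 0"
  proof -
    have e: "orient b c a = orient a b c" "orient c a b = orient a b c" "orient b a c = - orient a b c"
      "orient a c b = - orient a b c" "orient c b a = - orient a b c"
      by (simp_all add: orient_def algebra_simps)
    have "i < j \<and> j < k \<or> i < k \<and> k < j \<or> j < i \<and> i < k \<or> j < k \<and> k < i \<or> k < i \<and> i < j \<or> k < j \<and> j < i"
      using ne by arith
    then consider "i < j" "j < k" | "i < k" "k < j" | "j < i" "i < k" | "j < k" "k < i" | "k < i" "i < j" | "k < j" "j < i"
      by blast
    then show ?thesis
    proof cases
      case 1 then show ?thesis using pos[of i j k] i j k by simp
    next
      case 2 then show ?thesis using pos[of i k j] i j k e by simp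
    next
      case 3 then show ?thesis using pos[of j i k] i j k e by simp
    next
      case 4 then show ?thesis using pos[of j k i] i j k e by simp
    next
      case 5 then show ?thesis using pos[of k i j] i j k e by simp
    next
      case 6 then show ?thesis using pos[of k j i] i j k e by simp
    qed
  qed
  then show "\<not> collinear {a, b, c}"
    using collinear_orient by blast
qed

section \<open>Generic perturbation through distinct distances\<close>

definition distinct_dists :: "nat \<Rightarrow> (nat \<Rightarrow> pt) \<Rightarrow> bool" where
  "distinct_dists N q \<longleftrightarrow> (\<forall>i j k l. i < j \<longrightarrow> j < N \<longrightarrow> k < l \<longrightarrow> l < N \<longrightarrow>
      dist (q i) (q j) = dist (q k) (q l) \<longrightarrow> i = k \<and> j = l) \<and> inj_on q {..<N}"

lemma negligible_UN_finite:
  "finite A \<Longrightarrow> (\<And>i. i \<in> A \<Longrightarrow> negligible (S i)) \<Longrightarrow> negligible (\<Union>i\<in>A. S i)"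
  by (intro negligible_Union) auto

text \<open>Points are placed one at a time. The forbidden positions of the next point lie on
  finitely many perpendicular bisectors and spheres, a negligible set, which cannot cover a
  ball.\<close>

lemma distinct_dists_perturbation:
  fixes f :: "nat \<Rightarrow> pt"
  assumes "\<rho> > 0"
  shows "\<exists>q. distinct_dists N q \<and> (\<forall>k<N. dist (q k) (f k) < \<rho>)"
proof (induction N)
  case 0
  then show ?case by (auto simp: distinct_dists_def)
next
  case (Suc N)
  then obtain q where q: "distinct_dists N q" "\<And>k. k < N \<Longrightarrow> dist (q k) (f k) < \<rho>"
    by blast
  let ?B = "\<Union>i<N. \<Union>k<N. {x. i \<noteq> k \<and> dist x (q i) = dist x (q k)}"
  \<comment> \<open>The case \<open>k = l\<close> is included on purpose: a sphere of radius 0 keeps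
    the new point away from the old ones.\<close>
  let ?C = "\<Union>i<N. \<Union>k<N. \<Union>l<N. {x. dist x (q i) = dist (q k) (q l)}"
  have "negligible {x. i \<noteq> k \<and> dist x (q i) = dist x (q k)}" if "i < N" "k < N" for i k
  proof (cases "i = k")
    case False
    then have ne: "q k - q i \<noteq> 0"
      using q(1) that by (auto simp: distinct_dists_def inj_on_def)
    have "{x. i \<noteq> k \<and> dist x (q i) = dist x (q k)} \<subseteq> {x. (2 *\<^sub>R (q k - q i)) \<bullet> x = q k \<bullet> q k - q i \<bullet> q i}"
    proof clarify
      fix x assume "dist x (q i) = dist x (q k)"
      then have "(x - q i) \<bullet> (x - q i) = (x - q k) \<bullet> (x - q k)"
        by (simp add: dist_norm norm_eq)
      then show "(2 *\<^sub>R (q k - q i)) \<bullet> x = q k \<bullet> q k - q i \<bullet> q i"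
        by (simp add: inner_diff_left inner_diff_right inner_commute algebra_simps)
    qed
    moreover have "negligible {x. (2 *\<^sub>R (q k - q i)) \<bullet> x = q k \<bullet> q k - q i \<bullet> q i}"
      using ne by (intro negligible_hyperplane) auto
    ultimately show ?thesis
      using negligible_subset by blast
  qed simp
  then have B: "negligible ?B"
    by (intro negligible_UN_finite) auto
  have "negligible {x. dist x (q i) = dist (q k) (q l)}" for i k l
  proof -
    have "{x. dist x (q i) = dist (q k) (q l)} = sphere (q i) (dist (q k) (q l))"
      by (auto simp: dist_commute)
    then show ?thesis
      by (simp add: negligible_sphere)
  qed
  then have C: "negligible ?C"
    by (intro negligible_UN_finite) auto
  have "\<not> negligible (ball (f N) \<rho>)"
    using assms by (intro open_not_negligible) auto
  then have "\<not> ball (f N) \<rho> \<subseteq> ?B \<union> ?C"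
    using B C negligible_Un negligible_subset by blast
  then obtain x where "x \<in> ball (f N) \<rho>" and x: "x \<notin> ?B" "x \<notin> ?C"
    by blast
  then have x_near: "dist x (f N) < \<rho>"
    by (simp add: dist_commute)
  have xB: "dist x (q i) \<noteq> dist x (q k)" if "i < N" "k < N" "i \<noteq> k" for i k
    using x(1) that by blast
  have xC: "dist x (q i) \<noteq> dist (q k) (q l)" if "i < N" "k < N" "l < N" for i k l
    using x(2) that by blast
  let ?q = "q(N := x)"
  have "i = k \<and> j = l" if ij: "i < j" "j < Suc N" "k < l" "l < Suc N" "dist (?q i) (?q j) = dist (?q k) (?q l)" for i j k l
  proof -
    have ik: "i < N" "k < N" using ij by auto
    consider "j = N" "l = N" | "j = N" "l < N" | "j < N" "l = N" | "j < N" "l < N"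
      using ij by linarith
    then show ?thesis
    proof cases
      case 1
      then have "dist x (q i) = dist x (q k)" using ij(5) ik by (simp add: dist_commute)
      then show ?thesis using xB[OF ik] 1 by blast
    next
      case 2
      then have "dist x (q i) = dist (q k) (q l)" using ij(5) ik by (simp add: dist_commute)
      then show ?thesis using xC ik 2 by blast
    next
      case 3
      then have "dist x (q k) = dist (q i) (q j)" using ij(5) ik by (simp add: dist_commute)
      then show ?thesis using xC ik 3 by blast
    next
      case 4
      then have "dist (q i) (q j) = dist (q k) (q l)" using ij(5) ik by simp
      then show ?thesis using q(1) ij(1,3) 4 unfolding distinct_dists_def by blast
    qed
  qed
  moreover have "inj_on ?q {..<Suc N}"
  proof -
    have "x \<notin> q ` {..<N}"
      using xC by fastforce
    then show ?thesis
      using q(1) unfolding distinct_dists_def lessThan_Suc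
      by (auto simp: inj_on_def)
  qed
  ultimately have "distinct_dists (Suc N) ?q"
    unfolding distinct_dists_def by blast
  moreover have "\<forall>k<Suc N. dist (?q k) (f k) < \<rho>"
    using q(2) x_near by (auto simp: less_Suc_eq)
  ultimately show ?case by blast
qed

lemma generic_distinct_dists:
  assumes q: "distinct_dists (Suc N) q"
    and pos: "\<And>i j k. 1 \<le> i \<Longrightarrow> i < j \<Longrightarrow> j < k \<Longrightarrow> k \<le> N \<Longrightarrow> orient (q i) (q j) (q k) > 0"
  shows "generic (q ` {1..N})"
  unfolding generic_def
proof (intro conjI allI impI)
  show "general_position (q ` {1..N})"
    by (rule general_position_oriented[OF pos])
  fix X assume X: "X \<subseteq> q ` {1..N}"
  have pair: "\<exists>i j. i < j \<and> j < Suc N \<and> e = {q i, q j}" if e: "e \<in> all_pairs X" for e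
  proof -
    obtain a b where "e = {a, b}" "a \<in> X" "b \<in> X" "a \<noteq> b"
      using e unfolding all_pairs_def by blast
    then obtain i j where "e = {q i, q j}" "i \<in> {1..N}" "j \<in> {1..N}" "i \<noteq> j"
      using X by blast
    then show ?thesis
    proof (cases "i < j")
      case True
      then show ?thesis
        using \<open>e = {q i, q j}\<close> \<open>j \<in> {1..N}\<close> by (intro exI[of _ i] exI[of _ j]) auto
    next
      case False
      then show ?thesis
        using \<open>e = {q i, q j}\<close> \<open>i \<in> {1..N}\<close> \<open>i \<noteq> j\<close>
        by (intro exI[of _ j] exI[of _ i]) (auto simp: insert_commute)
    qed
  qed
  have "inj_on edge_len (all_pairs X)"
  proof (rule inj_onI)
    fix e f assume ef: "e \<in> all_pairs X" "f \<in> all_pairs X" "edge_len e = edge_len f"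
    obtain i j where ij: "i < j" "j < Suc N" "e = {q i, q j}" using pair[OF ef(1)] by blast
    obtain k l where kl: "k < l" "l < Suc N" "f = {q k, q l}" using pair[OF ef(2)] by blast
    have "dist (q i) (q j) = dist (q k) (q l)" using ef(3) ij kl by simp
    then have "i = k \<and> j = l"
      using q ij kl unfolding distinct_dists_def by blast
    then show "e = f" using ij kl by simp
  qed
  then show "\<exists>!E. is_mst X E"
    using X by (intro unique_mst) (auto intro: finite_subset)
qed simp

section \<open>A tied grid close to the integer grid\<close>

text \<open>Finitely many strict inequalities, hence a condition that survives small perturbations
  (\<open>strict_tied_grid_limit\<close>). Genericity and distinct verticals are supplied later by
  the perturbation.\<close>

definition strict_tied_grid :: "nat \<Rightarrow> (bool \<Rightarrow> nat \<Rightarrow> pt) \<Rightarrow> bool" where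
  "strict_tied_grid m p \<longleftrightarrow>
    (\<forall>i\<in>{1..2*m}. \<forall>j\<in>{1..2*m}. \<forall>k\<in>{1..2*m}. i < j \<longrightarrow> j < k \<longrightarrow>
      0 < orient (ring_point m p i) (ring_point m p j) (ring_point m p k)) \<and>
    (\<forall>i\<in>{1..m}. \<forall>j\<in>{1..m}. \<forall>k\<in>{1..m}. \<forall>r s t. i < j \<longrightarrow> j < k \<longrightarrow>
      dist (p r i) (p s j) < dist (p r i) (p t k) \<and> dist (p s j) (p t k) < dist (p r i) (p t k)) \<and>
    (\<forall>i\<in>{1..m}. \<forall>j\<in>{1..m}. \<forall>k\<in>{1..m}. \<forall>r s. i < j \<longrightarrow>
      dist (p r i) (p r j) < dist (p s i) (p (\<not> s) j) \<and> dist (p False k) (p True k) < dist (p s i) (p (\<not> s) j)) \<and>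
    (\<forall>i\<in>{1..m}. \<forall>j\<in>{1..m}. \<forall>k\<in>{1..m}. \<forall>r. i + 1 < j \<longrightarrow> dist (p False k) (p True k) < dist (p r i) (p r j)) \<and>
    (\<forall>i\<in>{1..m}. \<forall>k\<in>{1..m}. \<forall>r. i < m \<longrightarrow> dist (p r i) (p r (i + 1)) < dist (p False k) (p True k)) \<and>
    (\<forall>i\<in>{1..m}. \<forall>j\<in>{1..m}. i + 1 < j \<longrightarrow>
      dist (p (even i) i) (p (even i) j) < dist (p (odd i) i) (p (odd i) j))"

lemma eventually_imp_const: "(C \<Longrightarrow> eventually P F) \<Longrightarrow> eventually (\<lambda>x. C \<longrightarrow> P x) F"
  by (cases C) auto

lemma eventually_less_limit:
  fixes f g :: "'a \<Rightarrow> real"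
  assumes "(f \<longlongrightarrow> a) F" "(g \<longlongrightarrow> b) F" "a < b"
  shows "eventually (\<lambda>x. f x < g x) F"
proof -
  have "((\<lambda>x. g x - f x) \<longlongrightarrow> b - a) F"
    by (intro tendsto_diff assms)
  then have "eventually (\<lambda>x. 0 < g x - f x) F"
    using assms(3) by (intro order_tendstoD(1)) auto
  then show ?thesis
    by (rule eventually_mono) simp
qed

lemma tendsto_orient:
  "(f \<longlongrightarrow> a) F \<Longrightarrow> (g \<longlongrightarrow> b) F \<Longrightarrow> (h \<longlongrightarrow> c) F \<Longrightarrow> ((\<lambda>x. orient (f x) (g x) (h x)) \<longlongrightarrow> orient a b c) F"
  unfolding orient_def by (intro tendsto_intros)

lemma tendsto_ring_point:
  assumes "\<And>r i. i \<in> {1..m} \<Longrightarrow> ((\<lambda>x. Q x r i) \<longlongrightarrow> p r i) F" "k \<in> {1..2*m}"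
  shows "((\<lambda>x. ring_point m (Q x) k) \<longlongrightarrow> ring_point m p k) F"
proof (cases "k \<le> m")
  case True
  then show ?thesis
    using assms(1)[of k False] assms(2) by (simp add: ring_point_def)
next
  case False
  then have "2 * m + 1 - k \<in> {1..m}"
    using assms(2) unfolding atLeastAtMost_iff by linarith
  then show ?thesis
    using assms(1)[of "2 * m + 1 - k" True] False by (simp add: ring_point_def)
qed

lemmas eventually_quantifiers = eventually_conj eventually_ball_finite ballI finite_atLeastAtMost
  eventually_all_finite eventually_imp_const

lemma strict_tied_grid_limit:
  fixes Q :: "'x \<Rightarrow> bool \<Rightarrow> nat \<Rightarrow> pt"
  assumes lim: "\<And>r i. i \<in> {1..m} \<Longrightarrow> ((\<lambda>x. Q x r i) \<longlongrightarrow> p r i) F" and p: "strict_tied_grid m p"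
  shows "eventually (\<lambda>x. strict_tied_grid m (Q x)) F"
  unfolding strict_tied_grid_def
  apply (intro eventually_quantifiers)
  subgoal
    by (rule eventually_less_limit[OF tendsto_const
          tendsto_orient[OF tendsto_ring_point tendsto_ring_point tendsto_ring_point]])
      (use p lim in \<open>auto simp: strict_tied_grid_def\<close>)
  subgoal by (rule eventually_less_limit, (rule tendsto_dist lim; simp)+)
     (use p in \<open>auto simp: strict_tied_grid_def\<close>)
  subgoal by (rule eventually_less_limit, (rule tendsto_dist lim; simp)+)
     (use p in \<open>auto simp: strict_tied_grid_def\<close>)
  subgoal by (rule eventually_less_limit, (rule tendsto_dist lim; simp)+)
     (use p in \<open>auto simp: strict_tied_grid_def\<close>)
  subgoal by (rule eventually_less_limit, (rule tendsto_dist lim; simp)+)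
     (use p in \<open>auto simp: strict_tied_grid_def\<close>)
  subgoal by (rule eventually_less_limit, (rule tendsto_dist lim; simp)+)
     (use p in \<open>auto simp: strict_tied_grid_def\<close>)
  subgoal by (rule eventually_less_limit, (rule tendsto_dist lim; simp)+)
     (use p in \<open>auto simp: strict_tied_grid_def\<close>)
  subgoal by (rule eventually_less_limit, (rule tendsto_dist lim; simp)+)
     (use p in \<open>auto simp: strict_tied_grid_def\<close>)
  done

lemma dist_grid_through:
  assumes "i < j" "j < k"
  shows "dist (grid r i) (grid s j) < dist (grid r i) (grid t k)"
    and "dist (grid s j) (grid t k) < dist (grid r i) (grid t k)"
proof -
  \<comment> \<open>The extreme case compares a diagonal over x gaps with a horizontal over at least
    x + 1 gaps.\<close>
  have sq: "x\<^sup>2 + 1 < y\<^sup>2" if "1 \<le> x" "x + 1 \<le> y" for x y :: real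
  proof -
    have "(x + 1)\<^sup>2 \<le> y\<^sup>2" using that by (intro power_mono) auto
    moreover have "(x + 1)\<^sup>2 = x\<^sup>2 + 1 + 2 * x" by (simp add: power2_eq_square algebra_simps)
    ultimately show ?thesis using that by linarith
  qed
  have "(real j - real i)\<^sup>2 + 1 < (real k - real i)\<^sup>2" "(real k - real j)\<^sup>2 + 1 < (real k - real i)\<^sup>2"
    using assms by (intro sq; linarith)+
  then show "dist (grid r i) (grid s j) < dist (grid r i) (grid t k)"
    "dist (grid s j) (grid t k) < dist (grid r i) (grid t k)"
    unfolding dist_grid by (auto simp: power2_commute)
qed

lemma dist_grid_diagonal:
  assumes "i < j"
  shows "dist (grid r i) (grid r j) < dist (grid s i) (grid (\<not> s) j)"
    and "dist (grid False k) (grid True k) < dist (grid s i) (grid (\<not> s) j)"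
  unfolding dist_grid by (rule real_sqrt_less_mono; use assms in simp)+

lemma dist_grid_vertical:
  assumes "i + 1 < j"
  shows "dist (grid False k) (grid True k) < dist (grid r i) (grid r j)"
proof -
  have "1 < \<bar>real i - real j\<bar>" using assms by linarith
  then show ?thesis unfolding dist_grid by simp
qed

text \<open>The vertical shift of order t bends both rows outwards and makes the verticals longer than the
  unit horizontals; the horizontal shift of order t^2 only breaks ties between the two rows.\<close>

definition shift :: "nat \<Rightarrow> nat \<Rightarrow> real" where
  "shift m i = (if even i then -1 else 1) * (real m + 1 - real i)"

text \<open>A strictly concave parabola with zeros at 0 and m + 1. Concavity bends the rows into
  convex chains, and positivity on the columns 1 to m lengthens the verticals.\<close>

definition bend :: "nat \<Rightarrow> nat \<Rightarrow> real" where
  "bend m i = real i * (real m + 1 - real i)"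

definition bent_grid :: "nat \<Rightarrow> real \<Rightarrow> bool \<Rightarrow> nat \<Rightarrow> pt" where
  "bent_grid m t r i = (let \<sigma> = (if r then 1 else -1) in
     (real i - \<sigma> * t\<^sup>2 * shift m i, (if r then 1 else 0) + \<sigma> * t * bend m i))"

lemma tendsto_bent_grid: "((\<lambda>t. bent_grid m t r i) \<longlongrightarrow> grid r i) (at_right 0)"
proof -
  have "((\<lambda>t. bent_grid m t r i) \<longlongrightarrow> bent_grid m 0 r i) (at_right 0)"
    unfolding bent_grid_def Let_def by (intro tendsto_intros)
  then show ?thesis by (simp add: bent_grid_def grid_def)
qed

text \<open>For quantities that vanish at t = 0 and take their sign from the linear
  coefficient.\<close>

lemma eventually_pos_times_limit:
  fixes g :: "real \<Rightarrow> real"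
  assumes "\<And>t. f t = t * g t" "isCont g 0" "g 0 > 0"
  shows "eventually (\<lambda>t. 0 < f t) (at_right 0)"
proof -
  have "(g \<longlongrightarrow> g 0) (at_right 0)"
    using assms(2) unfolding isCont_def by (rule filterlim_mono) (auto simp: at_le)
  then have "eventually (\<lambda>t. 0 < g t) (at_right 0)"
    using assms(3) by (rule order_tendstoD(1))
  moreover have "eventually (\<lambda>t::real. 0 < t) (at_right 0)"
    by (rule eventually_at_right_less)
  ultimately show ?thesis
    by eventually_elim (simp add: assms(1))
qed

text \<open>The three points are collinear at t = 0. The linear coefficient comes from the parabola
  \<open>bend\<close>; the horizontal shift enters only at order t^3.\<close>

lemma bent_row_orient:
  assumes "(if r then 1 else -1) * ((real b - real a) * (real c - real a) * (real b - real c)) > 0"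
  shows "eventually (\<lambda>t. 0 < orient (bent_grid m t r a) (bent_grid m t r b) (bent_grid m t r c)) (at_right 0)"
proof -
  let ?\<sigma> = "if r then 1 else -1 :: real"
  let ?g = "\<lambda>t. ?\<sigma> * ((real b - real a) * (real c - real a) * (real b - real c)) +
     t\<^sup>2 * ((bend m b - bend m a) * (shift m c - shift m a) - (shift m b - shift m a) * (bend m c - bend m a))"
  show ?thesis
  proof (rule eventually_pos_times_limit[where g = ?g])
    fix t
    have "(real b - real a) * (bend m c - bend m a) - (bend m b - bend m a) * (real c - real a)
        = (real b - real a) * (real c - real a) * (real b - real c)"
      unfolding bend_def by algebra
    then show "orient (bent_grid m t r a) (bent_grid m t r b) (bent_grid m t r c) = t * ?g t"
      unfolding orient_def bent_grid_def Let_def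
      by (cases r; simp; algebra)
  next
    show "isCont ?g 0" by (intro continuous_intros)
  qed (use assms in simp)
qed

lemma ring_point_obtain:
  assumes "k \<in> {1..2*m}"
  obtains r i where "i \<in> {1..m}" "k = (if r then 2 * m + 1 - i else i)" "\<And>p. ring_point m p k = p r i"
proof (cases "k \<le> m")
  case True
  then show thesis using that[of k False] assms by (auto simp: ring_point_def)
next
  case False
  then have "2 * m + 1 - k \<in> {1..m}" "k = 2 * m + 1 - (2 * m + 1 - k)"
    using assms unfolding atLeastAtMost_iff by linarith+
  then show thesis using that[of "2 * m + 1 - k" True] False by (simp add: ring_point_def)
qed

text \<open>Triples meeting both rows are correctly oriented already in the grid; only triples
  within one row need the bending.\<close>

lemma bent_ring_orient:
  assumes ijk: "i \<in> {1..2*m}" "j \<in> {1..2*m}" "k \<in> {1..2*m}" "i < j" "j < k"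
  shows "eventually (\<lambda>t. 0 < orient (ring_point m (bent_grid m t) i) (ring_point m (bent_grid m t) j)
    (ring_point m (bent_grid m t) k)) (at_right 0)"
proof -
  obtain r a where a: "a \<in> {1..m}" "i = (if r then 2 * m + 1 - a else a)" "\<And>p. ring_point m p i = p r a"
    by (rule ring_point_obtain[OF ijk(1)], rule that)
  obtain s b where b: "b \<in> {1..m}" "j = (if s then 2 * m + 1 - b else b)" "\<And>p. ring_point m p j = p s b"
    by (rule ring_point_obtain[OF ijk(2)], rule that)
  obtain q c where c: "c \<in> {1..m}" "k = (if q then 2 * m + 1 - c else c)" "\<And>p. ring_point m p k = p q c"
    by (rule ring_point_obtain[OF ijk(3)], rule that)
  have eqs: "if r then i + a = 2 * m + 1 else i = a" "if s then j + b = 2 * m + 1 else j = b"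
    "if q then k + c = 2 * m + 1 else k = c" and le: "a \<le> m" "b \<le> m" "c \<le> m"
    using a(1,2) b(1,2) c(1,2) by auto
  have rows: "r \<longrightarrow> s" "s \<longrightarrow> q"
    using eqs le \<open>i < j\<close> \<open>j < k\<close> by (cases r; cases s; cases q; simp only: if_True if_False simp_thms; linarith)+
  have ab: "r = s \<Longrightarrow> (if r then b < a else a < b)" and bc: "s = q \<Longrightarrow> (if q then c < b else b < c)"
    using eqs le \<open>i < j\<close> \<open>j < k\<close> by (cases s; simp only: if_True if_False simp_thms; linarith)+
  show ?thesis
  proof (cases "r = s \<and> s = q")
    case True
    then have "(if r then 1 else -1) * ((real b - real a) * (real c - real a) * (real b - real c)) > 0"
      using ab bc by (auto simp: mult_less_0_iff zero_less_mult_iff split: if_splits)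
    then show ?thesis
      unfolding a(3) b(3) c(3) using bent_row_orient True by auto
  next
    case False
    then have "0 < orient (grid r a) (grid s b) (grid q c)"
      using rows ab bc by (cases r; cases s; cases q) (auto simp: orient_def grid_def)
    then show ?thesis
      unfolding a(3) b(3) c(3)
      by (intro eventually_less_limit[OF tendsto_const tendsto_orient[OF tendsto_bent_grid tendsto_bent_grid tendsto_bent_grid]])
  qed
qed

lemma dist_pt: "dist a b = sqrt ((fst a - fst b)\<^sup>2 + (snd a - snd b)\<^sup>2)" for a b :: pt
  by (simp add: dist_prod_def dist_real_def)

text \<open>Both lengths tend to 1. The squared vertical grows linearly in t, with coefficient
  \<open>4 * bend m k\<close>, whereas the squared horizontal changes only at order t^2.\<close>

lemma bent_verticals_long:
  assumes "k \<in> {1..m}"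
  shows "eventually (\<lambda>t. dist (bent_grid m t r i) (bent_grid m t r (i + 1)) <
    dist (bent_grid m t False k) (bent_grid m t True k)) (at_right 0)"
proof -
  let ?sq = "\<lambda>a b. (fst a - fst b)\<^sup>2 + (snd a - snd b)\<^sup>2"
  let ?\<sigma> = "if r then 1 else -1 :: real"
  let ?q = "bend m k" and ?D = "shift m (i + 1) - shift m i" and ?E = "bend m (i + 1) - bend m i"
  let ?g = "\<lambda>t. 4 * ?q + t * (4 * ?q\<^sup>2 + 2 * ?\<sigma> * ?D - ?E\<^sup>2 + t\<^sup>2 * (4 * (shift m k)\<^sup>2 - ?D\<^sup>2))"
  have "eventually (\<lambda>t. 0 < ?sq (bent_grid m t False k) (bent_grid m t True k) -
      ?sq (bent_grid m t r i) (bent_grid m t r (i + 1))) (at_right 0)"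
  proof (rule eventually_pos_times_limit[where g = ?g])
    fix t
    show "?sq (bent_grid m t False k) (bent_grid m t True k) -
      ?sq (bent_grid m t r i) (bent_grid m t r (i + 1)) = t * ?g t"
      unfolding bent_grid_def Let_def by (cases r; simp; algebra)
  next
    show "isCont ?g 0" by (intro continuous_intros)
    show "?g 0 > 0" using assms by (simp add: bend_def)
  qed
  then show ?thesis
    by (rule eventually_mono) (simp add: dist_pt)
qed

text \<open>The vertical displacements contribute equally in both rows and cancel. Since
  \<open>shift\<close> decreases in absolute value, the sign of \<open>shift m j - shift m i\<close>
  for \<open>i < j\<close> depends only on the parity of \<open>i\<close>, and it decides which row
  is shorter.\<close>

lemma bent_tie:
  assumes "i < j" "j \<le> m"
  shows "eventually (\<lambda>t. dist (bent_grid m t (even i) i) (bent_grid m t (even i) j) <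
    dist (bent_grid m t (odd i) i) (bent_grid m t (odd i) j)) (at_right 0)"
proof -
  let ?sq = "\<lambda>a b. (fst a - fst b)\<^sup>2 + (snd a - snd b)\<^sup>2"
  let ?\<sigma> = "if even i then 1 else -1 :: real"
  let ?D = "?\<sigma> * (shift m j - shift m i)"
  have D: "?D > 0"
    using assms by (auto simp: shift_def)
  have sq: "?sq (bent_grid m t (\<not> r) i) (bent_grid m t (\<not> r) j) -
      ?sq (bent_grid m t r i) (bent_grid m t r j) =
      4 * (real j - real i) * t\<^sup>2 * ((if r then 1 else -1) * (shift m j - shift m i))" for t r
    unfolding bent_grid_def Let_def by (cases r; simp; algebra)
  have eq: "?sq (bent_grid m t (odd i) i) (bent_grid m t (odd i) j) -
      ?sq (bent_grid m t (even i) i) (bent_grid m t (even i) j) = 4 * (real j - real i) * t\<^sup>2 * ?D" for t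
    by (rule sq)
  have "eventually (\<lambda>t::real. 0 < t) (at_right 0)"
    by (rule eventually_at_right_less)
  then show ?thesis
  proof (rule eventually_mono)
    fix t :: real assume "0 < t"
    then have "4 * (real j - real i) * t\<^sup>2 > 0"
      using assms by simp
    then have "4 * (real j - real i) * t\<^sup>2 * ?D > 0"
      using D by (rule mult_pos_pos)
    then show "dist (bent_grid m t (even i) i) (bent_grid m t (even i) j) <
      dist (bent_grid m t (odd i) i) (bent_grid m t (odd i) j)"
      unfolding dist_pt using eq[of t] by (intro real_sqrt_less_mono) linarith
  qed
qed

lemma strict_tied_grid_bent: "eventually (\<lambda>t. strict_tied_grid m (bent_grid m t)) (at_right 0)"
proof -
  note lim = eventually_less_limit[OF tendsto_dist[OF tendsto_bent_grid tendsto_bent_grid]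
    tendsto_dist[OF tendsto_bent_grid tendsto_bent_grid]]
  show ?thesis
    unfolding strict_tied_grid_def
    apply (intro eventually_quantifiers)
    subgoal by (rule bent_ring_orient)
    subgoal by (rule lim[OF dist_grid_through(1)])
    subgoal by (rule lim[OF dist_grid_through(2)])
    subgoal by (rule lim[OF dist_grid_diagonal(1)])
    subgoal by (rule lim[OF dist_grid_diagonal(2)])
    subgoal by (rule lim[OF dist_grid_vertical])
    subgoal by (rule bent_verticals_long)
    subgoal by (rule bent_tie) auto
    done
qed

lemma tied_grid_exists:
  assumes "\<epsilon> > 0"
  obtains p where "tied_grid m p" "\<And>r i. i \<in> {1..m} \<Longrightarrow> dist (p r i) (grid r i) < \<epsilon>"
    "convex_position {p r i | r i. 1 \<le> i \<and> i \<le> m}" "card {p r i | r i. 1 \<le> i \<and> i \<le> m} = 2 * m"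
proof -
  have "eventually (\<lambda>t. \<forall>i\<in>{1..m}. \<forall>r. dist (bent_grid m t r i) (grid r i) < \<epsilon>) (at_right 0)"
    using assms tendstoD[OF tendsto_bent_grid] by (intro eventually_quantifiers) auto
  then have "eventually (\<lambda>t. strict_tied_grid m (bent_grid m t) \<and>
      (\<forall>i\<in>{1..m}. \<forall>r. dist (bent_grid m t r i) (grid r i) < \<epsilon>)) (at_right 0)"
    by (intro eventually_conj strict_tied_grid_bent)
  then obtain t where t: "strict_tied_grid m (bent_grid m t)"
      "\<And>i r. i \<in> {1..m} \<Longrightarrow> dist (bent_grid m t r i) (grid r i) < \<epsilon>"
    using eventually_happens'[OF trivial_limit_at_right_real] by blast
  \<comment> \<open>With t fixed, generic configurations converge to the bent grid, so one of them
    satisfies all the strict inequalities and stays within the tolerance.\<close>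
  have "\<exists>q. distinct_dists (Suc (2 * m)) q \<and>
      (\<forall>k<Suc (2 * m). dist (q k) (ring_point m (bent_grid m t) k) < inverse (real (Suc n)))" for n
    by (rule distinct_dists_perturbation) simp
  then obtain q where q: "\<And>n. distinct_dists (Suc (2 * m)) (q n)"
      "\<And>n k. k < Suc (2 * m) \<Longrightarrow> dist (q n k) (ring_point m (bent_grid m t) k) < inverse (real (Suc n))"
    by metis
  define Q where "Q = (\<lambda>n r i. q n (if r then 2 * m + 1 - i else i))"
  have lim: "(\<lambda>n. Q n r i) \<longlonglongrightarrow> bent_grid m t r i" if "i \<in> {1..m}" for r i
  proof -
    let ?k = "if r then 2 * m + 1 - i else i"
    have "ring_point m (bent_grid m t) ?k = bent_grid m t r i"
      using that by (auto simp: ring_point_def)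
    then have "dist (Q n r i) (bent_grid m t r i) \<le> inverse (real (Suc n))" for n
      using q(2)[of ?k n] that by (simp add: Q_def less_imp_le)
    then have "(\<lambda>n. dist (Q n r i) (bent_grid m t r i)) \<longlonglongrightarrow> 0"
      by (intro tendsto_sandwich[OF _ _ tendsto_const LIMSEQ_inverse_real_of_nat]) auto
    then show ?thesis
      by (simp add: tendsto_dist_iff[symmetric])
  qed
  have "eventually (\<lambda>n. dist (Q n r i) (grid r i) < \<epsilon>) sequentially" if "i \<in> {1..m}" for r i
    using that t(2) by (intro order_tendstoD(2)[OF tendsto_dist[OF lim tendsto_const]]) auto
  then have "eventually (\<lambda>n. \<forall>i\<in>{1..m}. \<forall>r. dist (Q n r i) (grid r i) < \<epsilon>) sequentially"
    by (intro eventually_quantifiers)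
  then have "eventually (\<lambda>n. strict_tied_grid m (Q n) \<and>
      (\<forall>i\<in>{1..m}. \<forall>r. dist (Q n r i) (grid r i) < \<epsilon>)) sequentially"
    by (intro eventually_conj strict_tied_grid_limit[OF lim t(1)])
  then obtain n where n: "strict_tied_grid m (Q n)"
      "\<And>i r. i \<in> {1..m} \<Longrightarrow> dist (Q n r i) (grid r i) < \<epsilon>"
    using eventually_happens'[OF sequentially_bot] by blast
  let ?p = "Q n" and ?q = "q n"
  have ring: "ring_point m ?p k = ?q k" if "1 \<le> k" "k \<le> 2 * m" for k
    using that by (auto simp: ring_point_def Q_def)
  have oriented: "orient (ring_point m ?p i) (ring_point m ?p j) (ring_point m ?p k) > 0"
    if "1 \<le> i" "i < j" "j < k" "k \<le> 2 * m" for i j k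
    using n(1) that unfolding strict_tied_grid_def by auto
  have pos: "orient (?q i) (?q j) (?q k) > 0" if ijk: "1 \<le> i" "i < j" "j < k" "k \<le> 2 * m" for i j k
  proof -
    have "ring_point m ?p i = ?q i" "ring_point m ?p j = ?q j" "ring_point m ?p k = ?q k"
      by (rule ring; use ijk in linarith)+
    then show ?thesis
      using oriented[OF ijk] by (simp only:)
  qed
  have inj: "inj_on ?q {..2 * m}"
    using q(1)[of n] by (simp add: distinct_dists_def lessThan_Suc_atMost)
  have P: "{?p r i | r i. 1 \<le> i \<and> i \<le> m} = ?q ` {1..2 * m}"
  proof
    show "{?p r i | r i. 1 \<le> i \<and> i \<le> m} \<subseteq> ?q ` {1..2 * m}"
    proof
      fix x assume "x \<in> {?p r i | r i. 1 \<le> i \<and> i \<le> m}"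
      then obtain r i where x: "x = ?p r i" and i: "1 \<le> i" "i \<le> m"
        by blast
      have "(if r then 2 * m + 1 - i else i) \<in> {1..2 * m}"
        using i by auto
      then show "x \<in> ?q ` {1..2 * m}"
        unfolding x Q_def by (rule imageI)
    qed
    show "?q ` {1..2 * m} \<subseteq> {?p r i | r i. 1 \<le> i \<and> i \<le> m}"
    proof (rule image_subsetI)
      fix k assume k: "k \<in> {1..2 * m}"
      obtain r i where i: "i \<in> {1..m}" "\<And>p. ring_point m p k = p r i"
        by (rule ring_point_obtain[OF k], rule that)
      then show "?q k \<in> {?p r i | r i. 1 \<le> i \<and> i \<le> m}"
        using ring[of k] k i unfolding mem_Collect_eq by (intro exI[of _ r] exI[of _ i]) simp
    qed
  qed
  have "tied_grid m ?p"
  proof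
    show "generic {?p r i | r i. 1 \<le> i \<and> i \<le> m}"
      unfolding P by (rule generic_distinct_dists[OF q(1) pos])
    show "?p r i = ?p s j \<longleftrightarrow> r = s \<and> i = j" if "1 \<le> i" "i \<le> m" "1 \<le> j" "j \<le> m" for r s i j
    proof -
      have "?p r i = ?p s j \<longleftrightarrow> (if r then 2 * m + 1 - i else i) = (if s then 2 * m + 1 - j else j)"
        unfolding Q_def by (rule inj_on_eq_iff[OF inj]) (use that in auto)
      also have "\<dots> \<longleftrightarrow> r = s \<and> i = j"
        using that by auto
      finally show ?thesis .
    qed
    show "dist (?p False i) (?p True i) \<noteq> dist (?p False j) (?p True j)" if "1 \<le> i" "i < j" "j \<le> m" for i j
    proof
      assume "dist (?p False i) (?p True i) = dist (?p False j) (?p True j)"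
      then have "dist (?q i) (?q (2 * m + 1 - i)) = dist (?q j) (?q (2 * m + 1 - j))"
        by (simp add: Q_def)
      moreover have "i < 2 * m + 1 - i" "2 * m + 1 - i < Suc (2 * m)" "j < 2 * m + 1 - j" "2 * m + 1 - j < Suc (2 * m)"
        using that by linarith+
      ultimately have "i = j"
        using q(1)[of n] unfolding distinct_dists_def by blast
      then show False using that by simp
    qed
  qed (use oriented n(1) in \<open>simp_all add: strict_tied_grid_def\<close>)
  moreover have "convex_position {?p r i | r i. 1 \<le> i \<and> i \<le> m}"
    unfolding P by (rule convex_position_oriented[OF pos inj_on_subset[OF inj]]) auto
  moreover have "card {?p r i | r i. 1 \<le> i \<and> i \<le> m} = 2 * m"
    unfolding P using card_image[OF inj_on_subset[OF inj]] by auto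
  ultimately show thesis
    using that n(2) by blast
qed


section \<open>The two bounds in terms of n\<close>

lemma five_eighths: "\<lfloor>5 / 8 * (real (2 * m) - 2)\<rfloor> = int ((m - 1) + (m - 1) div 4)" if "1 \<le> m"
proof -
  have "5 / 8 * (real (2 * m) - 2) = real (5 * (m - 1)) / real 4"
    using that by (simp add: of_nat_diff field_simps)
  then have "\<lfloor>5 / 8 * (real (2 * m) - 2)\<rfloor> = int (5 * (m - 1) div 4)"
    by (simp only: floor_divide_of_nat_eq)
  also have "5 * (m - 1) div 4 = (m - 1) + (m - 1) div 4"
    by linarith
  finally show ?thesis .
qed

lemma rows_union: "v ` {1..m} \<union> w ` {1..m} = {(if r then w i else v i) | r i. 1 \<le> i \<and> i \<le> m}"
  for m :: nat
proof
  show "v ` {1..m} \<union> w ` {1..m} \<subseteq> {(if r then w i else v i) | r i. 1 \<le> i \<and> i \<le> m}"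
  proof
    fix x assume "x \<in> v ` {1..m} \<union> w ` {1..m}"
    then obtain i where i: "1 \<le> i" "i \<le> m" "x = v i \<or> x = w i" by auto
    then have "x = (if False then w i else v i) \<or> x = (if True then w i else v i)" by simp
    then show "x \<in> {(if r then w i else v i) | r i. 1 \<le> i \<and> i \<le> m}"
      using i(1,2) unfolding mem_Collect_eq by metis
  qed
qed auto

theorem theorem5:
  fixes n :: nat
  assumes "even n" and "n \<ge> 2"
  shows "(\<exists>\<epsilon>>0. \<forall>v w :: nat \<Rightarrow> real \<times> real.
            (\<forall>i\<in>{1..n div 2}. dist (v i) (real i, 0) \<le> \<epsilon> \<and> dist (w i) (real i, 1) \<le> \<epsilon>)
            \<and> card (v ` {1..n div 2} \<union> w ` {1..n div 2}) = n
            \<and> generic (v ` {1..n div 2} \<union> w ` {1..n div 2})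
            \<and> convex_position (v ` {1..n div 2} \<union> w ` {1..n div 2})
            \<longrightarrow> \<lfloor>5 / 8 * (real n - 2)\<rfloor> \<le> int (cr (v ` {1..n div 2} \<union> w ` {1..n div 2})))
       \<and> (\<forall>\<epsilon>>0. \<exists>v w :: nat \<Rightarrow> real \<times> real.
            (\<forall>i\<in>{1..n div 2}. dist (v i) (real i, 0) \<le> \<epsilon> \<and> dist (w i) (real i, 1) \<le> \<epsilon>)
            \<and> card (v ` {1..n div 2} \<union> w ` {1..n div 2}) = n
            \<and> generic (v ` {1..n div 2} \<union> w ` {1..n div 2})
            \<and> convex_position (v ` {1..n div 2} \<union> w ` {1..n div 2})
            \<and> int (cr (v ` {1..n div 2} \<union> w ` {1..n div 2})) \<le> \<lfloor>5 / 8 * (real n - 2)\<rfloor>)"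
proof (intro conjI)
  define m where "m = n div 2"
  have n: "n = 2 * m" and m: "1 \<le> m"
    using assms by (auto simp: m_def)
  have bound: "\<lfloor>5 / 8 * (real n - 2)\<rfloor> = int ((m - 1) + (m - 1) div 4)"
    unfolding n by (rule five_eighths[OF m])
  show "\<exists>\<epsilon>>0. \<forall>v w :: nat \<Rightarrow> real \<times> real.
            (\<forall>i\<in>{1..n div 2}. dist (v i) (real i, 0) \<le> \<epsilon> \<and> dist (w i) (real i, 1) \<le> \<epsilon>)
            \<and> card (v ` {1..n div 2} \<union> w ` {1..n div 2}) = n
            \<and> generic (v ` {1..n div 2} \<union> w ` {1..n div 2})
            \<and> convex_position (v ` {1..n div 2} \<union> w ` {1..n div 2})
            \<longrightarrow> \<lfloor>5 / 8 * (real n - 2)\<rfloor> \<le> int (cr (v ` {1..n div 2} \<union> w ` {1..n div 2}))"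
    unfolding m_def[symmetric]
  proof (intro exI[of _ "1/100"] conjI allI impI)
    fix v w :: "nat \<Rightarrow> pt"
    let ?P = "v ` {1..m} \<union> w ` {1..m}" and ?p = "\<lambda>r i. if r then w i else v i"
    assume *: "(\<forall>i\<in>{1..m}. dist (v i) (real i, 0) \<le> 1/100 \<and> dist (w i) (real i, 1) \<le> 1/100)
      \<and> card ?P = n \<and> generic ?P \<and> convex_position ?P"
    interpret near_grid m ?p ?P
    proof
      show "?P = {?p r i | r i. 1 \<le> i \<and> i \<le> m}"
        by (rule rows_union)
    qed (use * in \<open>auto simp: grid_def\<close>)
    show "\<lfloor>5 / 8 * (real n - 2)\<rfloor> \<le> int (cr ?P)"
      unfolding bound using cr_lower[OF m] by simp
  qed simp
  show "\<forall>\<epsilon>>0. \<exists>v w :: nat \<Rightarrow> real \<times> real.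
            (\<forall>i\<in>{1..n div 2}. dist (v i) (real i, 0) \<le> \<epsilon> \<and> dist (w i) (real i, 1) \<le> \<epsilon>)
            \<and> card (v ` {1..n div 2} \<union> w ` {1..n div 2}) = n
            \<and> generic (v ` {1..n div 2} \<union> w ` {1..n div 2})
            \<and> convex_position (v ` {1..n div 2} \<union> w ` {1..n div 2})
            \<and> int (cr (v ` {1..n div 2} \<union> w ` {1..n div 2})) \<le> \<lfloor>5 / 8 * (real n - 2)\<rfloor>"
    unfolding m_def[symmetric]
  proof (intro allI impI)
    fix \<epsilon> :: real assume "\<epsilon> > 0"
    obtain p where p: "tied_grid m p" "\<And>r i. i \<in> {1..m} \<Longrightarrow> dist (p r i) (grid r i) < \<epsilon>"
      "convex_position {p r i | r i. 1 \<le> i \<and> i \<le> m}" "card {p r i | r i. 1 \<le> i \<and> i \<le> m} = 2 * m"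
      by (rule tied_grid_exists[OF \<open>\<epsilon> > 0\<close>], rule that)
    interpret tied_grid m p by (rule p(1))
    have "(\<lambda>r i. if r then p True i else p False i) = p"
      by (intro ext) simp
    then have P: "p False ` {1..m} \<union> p True ` {1..m} = {p r i | r i. 1 \<le> i \<and> i \<le> m}"
      using rows_union[of "p False" m "p True"] by (simp add: fun_eq_iff)
    have near: "\<forall>i\<in>{1..m}. dist (p False i) (real i, 0) \<le> \<epsilon> \<and> dist (p True i) (real i, 1) \<le> \<epsilon>"
      using p(2)[of _ False] p(2)[of _ True] by (auto simp: grid_def less_imp_le)
    have "int (cr {p r i | r i. 1 \<le> i \<and> i \<le> m}) \<le> \<lfloor>5 / 8 * (real n - 2)\<rfloor>"
      unfolding bound using cr_upper by (simp add: P_def)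
    then show "\<exists>v w :: nat \<Rightarrow> pt.
            (\<forall>i\<in>{1..m}. dist (v i) (real i, 0) \<le> \<epsilon> \<and> dist (w i) (real i, 1) \<le> \<epsilon>)
            \<and> card (v ` {1..m} \<union> w ` {1..m}) = n
            \<and> generic (v ` {1..m} \<union> w ` {1..m})
            \<and> convex_position (v ` {1..m} \<union> w ` {1..m})
            \<and> int (cr (v ` {1..m} \<union> w ` {1..m})) \<le> \<lfloor>5 / 8 * (real n - 2)\<rfloor>"
      using near p(3,4) generic n
      by (intro exI[of _ "p False"] exI[of _ "p True"]) (simp only: P simp_thms)
  qed
qed

end
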